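(* Let $k\in\mathbb{N}$, let $(X,\mathcal{B},\mu,T)$ be an ergodic measure preserving system, let $f_0,f_1,\ldots,f_k\in L^\infty(X)$, and let $$\alpha(n):=\int_X f_0\cdot T^{n}f_1\cdot\ldots\cdot T^{kn}f_k\,d\mu .$$ Then the spectrum $\sigma(\alpha)$ of the multi-correlation sequence $\alpha$ is contained in the discrete spectrum $\sigma(T)$ of the system $(X,\mathcal{B},\mu,T)$.
   Context: A measure preserving system $(X,\mathcal{B},\mu,T)$ is a probability space $(X,\mathcal{B},\mu)$ with a measure preserving transformation $T:X\to X$; $T^nf:=f\circ T^n$. Let $\mathbb{T}=\mathbb{R}/\mathbb{Z}$ and $e(\theta)=e^{2\pi i\theta}$. The discrete spectrum $\sigma(T)$ is the set of $\theta\in\mathbb{T}$ for which there is a non-zero $f\in L^2(X)$ with $f\circ T=e(\theta)f$. The spectrum $\sigma(\eta)$ of a bounded sequence $\eta:\mathbb{N}\to\mathbb{C}$ is the set of $\theta\in\mathbb{T}$ for which $\limsup_{N\to\infty}\left|\frac1N\sum_{n=1}^N\eta(n)e(-\theta n)\right|>0$. *)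

theory Defs
  imports "HOL-Probability.Probability"
begin

locale measure_preserving_system = prob_space M for M :: "'a measure" +
  fixes T :: "'a \<Rightarrow> 'a"
  assumes measurable_T: "T \<in> measurable M M"
    and measure_preserving: "distr M M T = M"

locale ergodic_system = measure_preserving_system +
  assumes ergodic: "\<And>A. A \<in> sets M \<Longrightarrow> T -` A \<inter> space M = A \<Longrightarrow> prob A = 0 \<or> prob A = 1"

text \<open>Elements of the spaces below are representatives; equality in them is equality
  almost everywhere.\<close>

definition L2 :: "'a measure \<Rightarrow> ('a \<Rightarrow> complex) set" where
  "L2 M = {f \<in> borel_measurable M. integrable M (\<lambda>x. (cmod (f x))\<^sup>2)}"

definition L_infinity :: "'a measure \<Rightarrow> ('a \<Rightarrow> complex) set" where
  "L_infinity M = {f \<in> borel_measurable M. \<exists>C. AE x in M. cmod (f x) \<le> C}"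

definition circle_exp :: "real \<Rightarrow> complex" where
  "circle_exp \<theta> = exp (2 * of_real pi * \<i> * of_real \<theta>)"

text \<open>An element of the circle group of reals modulo integers is given by a real
  representative, and a subset of that group by its preimage in the reals. Both spectra below are
  invariant under integer translations, so they are preimages of this kind, and inclusion
  of the preimages is inclusion of the subsets of the circle group.\<close>

definition discrete_spectrum :: "'a measure \<Rightarrow> ('a \<Rightarrow> 'a) \<Rightarrow> real set" where
  "discrete_spectrum M T =
     {\<theta>. \<exists>f \<in> L2 M. \<not> (AE x in M. f x = 0) \<and>
                     (AE x in M. f (T x) = circle_exp \<theta> * f x)}"

text \<open>The upper limit is taken in the extended reals, so no boundedness of the averages is
  needed for it to be meaningful.\<close>

definition seq_spectrum :: "(nat \<Rightarrow> complex) \<Rightarrow> real set" where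
  "seq_spectrum \<eta> =
     {\<theta>. limsup (\<lambda>N. ereal (cmod (1 / of_nat N *
              (\<Sum>n = 1..N. \<eta> n * circle_exp (- \<theta> * real n))))) > 0}"

definition multi_correlation ::
    "'a measure \<Rightarrow> ('a \<Rightarrow> 'a) \<Rightarrow> nat \<Rightarrow> (nat \<Rightarrow> 'a \<Rightarrow> complex) \<Rightarrow> nat \<Rightarrow> complex" where
  "multi_correlation M T k f n =
     (\<integral>x. f 0 x * (\<Prod>i = 1..k. f i ((T ^^ (i * n)) x)) \<partial>M)"

lemma circle_exp_add_int: "circle_exp (\<theta> + of_int m) = circle_exp \<theta>"
proof -
  have "circle_exp (\<theta> + of_int m) = circle_exp \<theta> * exp (2 * of_int m * of_real pi * \<i>)"
    unfolding circle_exp_def exp_add [symmetric]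
    by (simp only: of_real_add of_real_of_int_eq) (simp only: algebra_simps)
  also have "exp (2 * of_int m * of_real pi * \<i>) = (1::complex)"
    using exp_integer_2pi [of "of_int m"] by simp
  finally show ?thesis by simp
qed

lemma discrete_spectrum_add_int:
  "\<theta> + of_int m \<in> discrete_spectrum M T \<longleftrightarrow> \<theta> \<in> discrete_spectrum M T"
  by (simp add: discrete_spectrum_def circle_exp_add_int)

lemma seq_spectrum_add_int:
  "\<theta> + of_int m \<in> seq_spectrum \<eta> \<longleftrightarrow> \<theta> \<in> seq_spectrum \<eta>"
proof -
  have "circle_exp (- (\<theta> + of_int m) * real n) = circle_exp (- \<theta> * real n)" for n
    using circle_exp_add_int [of "- \<theta> * real n" "- m * int n"] by (simp add: algebra_simps)
  then show ?thesis
    by (simp only: seq_spectrum_def mem_Collect_eq)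
qed

end

theory Submission
  imports Defs "HOL-Library.Function_Algebras"
begin

text \<open>Fix \<open>w = e(-\<theta>)\<close> with \<open>\<theta>\<close> outside the discrete spectrum. By induction on \<open>k\<close>, and for all systems
  without eigenfunctions \<open>w (f \<circ> T) = f\<close> at once, the averages over \<open>n\<close> of
  \<open>w ^ n \<integral> f\<^sub>0 \<cdot> T ^ n f\<^sub>1 \<cdots> T ^ (k n) f\<^sub>k\<close> tend to \<open>0\<close>; the case \<open>k = 1\<close> is the mean ergodic theorem. Otherwise
  the averages of \<open>w ^ n T ^ n f\<^sub>1 \<cdots> T ^ (k n) f\<^sub>k\<close> have, along a subsequence, a weak limit point \<open>G\<close> with
  \<open>\<integral> f\<^sub>0 G \<noteq> 0\<close>. The \<open>k\<close>-th Gowers-Host-Kra seminorm of \<open>G\<close> is the integral of \<open>G\<close> against the product of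
  the other vertices of its cube, in the \<open>k\<close>-fold iterated relative square of the system. A measure preserving
  map \<open>W\<close> of this iterated square fixes the first vertex and moves every other vertex by a power \<open>T ^ i\<close>
  with \<open>1 \<le> i \<le> k\<close>. Applying \<open>W ^ n\<close> and cancelling one \<open>T ^ n\<close> turns that integral into a limit of averages
  for \<open>k - 1\<close>. Since \<open>w\<close> does not become an eigenvalue in a relative square, the induction hypothesis
  shows that the seminorm is \<open>0\<close>. By van der Corput the averages are then asymptotically orthogonal to \<open>G\<close>,
  so \<open>\<integral> \<bar>G\<bar>\<^sup>2 = 0\<close>, a contradiction.\<close>

section \<open>Algebras of bounded functions with a positive functional\<close>

text \<open>The argument needs relative joinings over and over, and these are in general not
  ergodic; as measures, each would call for a disintegration. A system is therefore only an algebra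
  of bounded functions with a state and an invariant map. The joining is a Cesaro limit of states,
  which exists by the mean ergodic theorem, and a formal completion supplies the norm limits that
  the next stage needs. No structure theorem for characteristic factors enters. The weak limit G is
  tested against the other vertices of its own cube, and this pairing is linear in the first vertex:
  only that copy of G is replaced by the averages, while all others stay fixed. The exponents fit
  because a vertex with i coordinates in second factors is moved by \<open>T ^ i\<close>. Hence
  these vertices can be grouped by exponent with \<open>f\<^sub>1\<close>, ...,
  \<open>f\<^sub>k\<close>, and every exponent is at least 1, so that one \<open>T ^ n\<close>
  cancels. The price is that the induction moves to a larger system, where new eigenvalues might
  appear; excluding them is the hardest step. The map is not assumed invertible, so negative powers
  have to be avoided throughout.\<close>

definition cst :: "complex \<Rightarrow> 'w \<Rightarrow> complex" where
  "cst c = (\<lambda>_. c)"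

definition cj :: "('w \<Rightarrow> complex) \<Rightarrow> 'w \<Rightarrow> complex" where
  "cj f = (\<lambda>x. cnj (f x))"

definition pull :: "('w \<Rightarrow> 'w) \<Rightarrow> nat \<Rightarrow> ('w \<Rightarrow> complex) \<Rightarrow> 'w \<Rightarrow> complex" where
  "pull T n f = (\<lambda>x. f ((T ^^ n) x))"

definition bounded_by :: "real \<Rightarrow> ('w \<Rightarrow> complex) \<Rightarrow> bool" where
  "bounded_by C f \<longleftrightarrow> (\<forall>x. cmod (f x) \<le> C)"

definition nrm :: "(('w \<Rightarrow> complex) \<Rightarrow> complex) \<Rightarrow> ('w \<Rightarrow> complex) \<Rightarrow> real" where
  "nrm \<phi> f = sqrt (Re (\<phi> (f * cj f)))"

definition avg :: "nat \<Rightarrow> (nat \<Rightarrow> 'w \<Rightarrow> complex) \<Rightarrow> 'w \<Rightarrow> complex" where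
  "avg N F = cst (1 / of_nat N) * (\<Sum>n<N. F n)"

lemma cst_apply [simp]: "cst c x = c"
  by (simp add: cst_def)

lemma cj_apply [simp]: "cj f x = cnj (f x)"
  by (simp add: cj_def)

lemma pull_apply: "pull T n f x = f ((T ^^ n) x)"
  by (simp add: pull_def)

lemma minus_fun_apply' [simp]: "(f - g) x = f x - (g x :: 'b :: minus)"
  by (simp add: fun_diff_def)

lemma sum_fun_apply: "(\<Sum>i\<in>I. F i) x = (\<Sum>i\<in>I. F i x :: 'b :: comm_monoid_add)"
  by (induction I rule: infinite_finite_induct) auto

lemma prod_fun_apply: "(\<Prod>i\<in>I. F i) x = (\<Prod>i\<in>I. F i x :: 'b :: comm_monoid_mult)"
  by (induction I rule: infinite_finite_induct) auto

lemma avg_apply: "avg N F x = (\<Sum>n<N. F n x) / of_nat N"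
  by (simp add: avg_def sum_fun_apply)

lemma cst_1 [simp]: "cst 1 = 1" and cst_0 [simp]: "cst 0 = 0"
  by (auto simp: fun_eq_iff)

lemma cst_mult: "cst (c * d) = cst c * cst d"
  and cst_minus: "cst (- c) = - cst c"
  by (auto simp: fun_eq_iff fun_Compl_def)

lemma cj_add [simp]: "cj (f + g) = cj f + cj g"
  and cj_diff [simp]: "cj (f - g) = cj f - cj g"
  and cj_mult [simp]: "cj (f * g) = cj f * cj g"
  and cj_cj [simp]: "cj (cj f) = f"
  and cj_cst [simp]: "cj (cst c) = cst (cnj c)"
  and cj_1 [simp]: "cj 1 = 1"
  and cj_0 [simp]: "cj 0 = 0"
  and cj_sum [simp]: "cj (\<Sum>i\<in>I. F i) = (\<Sum>i\<in>I. cj (F i))"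
  and cj_prod [simp]: "cj (\<Prod>i\<in>I. F i) = (\<Prod>i\<in>I. cj (F i))"
  by (auto simp: fun_eq_iff sum_fun_apply prod_fun_apply)

lemma pull_add [simp]: "pull T n (f + g) = pull T n f + pull T n g"
  and pull_diff [simp]: "pull T n (f - g) = pull T n f - pull T n g"
  and pull_mult [simp]: "pull T n (f * g) = pull T n f * pull T n g"
  and pull_cst [simp]: "pull T n (cst c) = cst c"
  and pull_1 [simp]: "pull T n 1 = 1"
  and pull_cj [simp]: "pull T n (cj f) = cj (pull T n f)"
  and pull_sum [simp]: "pull T n (\<Sum>i\<in>I. F i) = (\<Sum>i\<in>I. pull T n (F i))"
  and pull_prod [simp]: "pull T n (\<Prod>i\<in>I. F i) = (\<Prod>i\<in>I. pull T n (F i))"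
  and pull_0 [simp]: "pull T 0 f = f"
  by (auto simp: fun_eq_iff pull_apply sum_fun_apply prod_fun_apply)

lemma pull_pull [simp]: "pull T m (pull T n f) = pull T (m + n) f"
  by (auto simp: fun_eq_iff pull_apply funpow_add add.commute[of m])

lemma pull_Suc: "pull T (Suc n) f = pull T 1 (pull T n f)"
  by simp

lemma pull_avg: "pull T m (avg N F) = avg N (\<lambda>n. pull T m (F n))"
  by (simp add: avg_def)

lemma cj_avg: "cj (avg N F) = avg N (\<lambda>n. cj (F n))"
  by (simp add: avg_def)

lemma mult_avg: "g * avg N F = avg N (\<lambda>n. g * F n)"
  by (simp add: avg_def sum_distrib_left mult.left_commute)

lemma avg_diff: "avg N (\<lambda>n. F n - G n) = avg N F - avg N G"
  by (simp add: avg_def sum_subtractf right_diff_distrib)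

lemma avg_add: "avg N (\<lambda>n. F n + G n) = avg N F + avg N G"
  by (simp add: avg_def sum.distrib distrib_left)

lemma bounded_byD: "bounded_by C f \<Longrightarrow> cmod (f x) \<le> C"
  by (simp add: bounded_by_def)

lemma bounded_by_nonneg: "bounded_by C f \<Longrightarrow> 0 \<le> C"
  using bounded_byD[of C f undefined] norm_ge_zero order_trans by blast

lemma bounded_by_cst: "cmod c \<le> C \<Longrightarrow> bounded_by C (cst c)"
  by (simp add: bounded_by_def)

lemma bounded_by_1 [simp]: "bounded_by 1 1"
  by (simp add: bounded_by_def)

lemma bounded_by_cj [simp]: "bounded_by C (cj f) = bounded_by C f"
  by (simp add: bounded_by_def)

lemma bounded_by_pull: "bounded_by C f \<Longrightarrow> bounded_by C (pull T n f)"
  by (simp add: bounded_by_def pull_apply)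

lemma bounded_by_add: "bounded_by C f \<Longrightarrow> bounded_by D g \<Longrightarrow> bounded_by (C + D) (f + g)"
  unfolding bounded_by_def by (auto intro!: norm_triangle_mono)

lemma bounded_by_mult: "bounded_by C f \<Longrightarrow> bounded_by D g \<Longrightarrow> bounded_by (C * D) (f * g)"
  unfolding bounded_by_def by (auto simp: norm_mult intro!: mult_mono order_trans[OF norm_ge_zero])

lemma bounded_by_mult1: "bounded_by 1 f \<Longrightarrow> bounded_by 1 g \<Longrightarrow> bounded_by 1 (f * g)"
  using bounded_by_mult[of 1 f 1 g] by simp

lemma bounded_by_prod1: "(\<And>i. i \<in> I \<Longrightarrow> bounded_by 1 (F i)) \<Longrightarrow> bounded_by 1 (\<Prod>i\<in>I. F i)"
  by (induction I rule: infinite_finite_induct) (auto intro: bounded_by_mult1)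

lemma bounded_by_avg:
  assumes "\<And>n. n < N \<Longrightarrow> bounded_by C (F n)" "0 \<le> C"
  shows "bounded_by C (avg N F)"
  unfolding bounded_by_def
proof
  fix x
  have "cmod (\<Sum>n<N. F n x) \<le> (\<Sum>n<N. C)"
    using assms by (intro sum_norm_le) (auto simp: bounded_by_def)
  then show "cmod (avg N F x) \<le> C"
    using assms(2) by (cases "N = 0") (auto simp: avg_apply norm_divide field_simps)
qed

text \<open>A state on a unital algebra of bounded functions stands in for a probability measure.
  Unlike a measure, it can be defined directly as a limit of averages. The elements are genuine
  functions, and \<open>nrm \<phi> f = 0\<close> takes the place of vanishing almost
  everywhere.\<close>

locale funalg =
  fixes A :: "('w \<Rightarrow> complex) set" and \<phi> :: "('w \<Rightarrow> complex) \<Rightarrow> complex"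
  assumes cst_in [simp]: "cst c \<in> A"
    and add_in [simp]: "f \<in> A \<Longrightarrow> g \<in> A \<Longrightarrow> f + g \<in> A"
    and mult_in [simp]: "f \<in> A \<Longrightarrow> g \<in> A \<Longrightarrow> f * g \<in> A"
    and cj_in [simp]: "f \<in> A \<Longrightarrow> cj f \<in> A"
    and bdd: "f \<in> A \<Longrightarrow> \<exists>C. bounded_by C f"
    and phi_add: "f \<in> A \<Longrightarrow> g \<in> A \<Longrightarrow> \<phi> (f + g) = \<phi> f + \<phi> g"
    and phi_scale: "f \<in> A \<Longrightarrow> \<phi> (cst c * f) = c * \<phi> f"
    and phi_cj: "f \<in> A \<Longrightarrow> \<phi> (cj f) = cnj (\<phi> f)"
    and phi_pos: "f \<in> A \<Longrightarrow> (\<And>x. Im (f x) = 0 \<and> 0 \<le> Re (f x)) \<Longrightarrow> 0 \<le> Re (\<phi> f)"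
    and phi_one: "\<phi> 1 = 1"
begin

lemma one_in [simp]: "1 \<in> A" and zero_in [simp]: "0 \<in> A"
  using cst_in[of 1] cst_in[of 0] by simp_all

lemma diff_eq_cst: "f - g = f + cst (- 1) * g"
  by (simp add: cst_minus)

lemma diff_in [simp]: "f \<in> A \<Longrightarrow> g \<in> A \<Longrightarrow> f - g \<in> A"
  unfolding diff_eq_cst by simp

lemma sum_in [simp]: "(\<And>i. i \<in> I \<Longrightarrow> F i \<in> A) \<Longrightarrow> (\<Sum>i\<in>I. F i) \<in> A"
  by (induction I rule: infinite_finite_induct) auto

lemma prod_in [simp]: "(\<And>i. i \<in> I \<Longrightarrow> F i \<in> A) \<Longrightarrow> (\<Prod>i\<in>I. F i) \<in> A"
  by (induction I rule: infinite_finite_induct) auto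

lemma avg_in [simp]: "(\<And>i. F i \<in> A) \<Longrightarrow> avg N F \<in> A"
  by (simp add: avg_def)

lemma phi_diff: "f \<in> A \<Longrightarrow> g \<in> A \<Longrightarrow> \<phi> (f - g) = \<phi> f - \<phi> g"
  unfolding diff_eq_cst by (simp add: phi_add phi_scale)

lemma phi_0 [simp]: "\<phi> 0 = 0"
  using phi_diff[of 1 1] by simp

lemma phi_sum: "(\<And>i. i \<in> I \<Longrightarrow> F i \<in> A) \<Longrightarrow> \<phi> (\<Sum>i\<in>I. F i) = (\<Sum>i\<in>I. \<phi> (F i))"
  by (induction I rule: infinite_finite_induct) (auto simp: phi_add)

lemma phi_avg: "(\<And>i. F i \<in> A) \<Longrightarrow> \<phi> (avg N F) = (\<Sum>i<N. \<phi> (F i)) / of_nat N"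
  by (simp add: avg_def phi_scale phi_sum)

lemma phi_mono_abs:
  assumes "f \<in> A" "g \<in> A" "\<And>x. Im (f x) = 0" "\<And>x. Im (g x) = 0" "\<And>x. Re (f x) \<le> Re (g x)"
  shows "Re (\<phi> f) \<le> Re (\<phi> g)"
  using phi_pos[of "g - f"] assms by (simp add: phi_diff)

lemma phi_sq_pos: "f \<in> A \<Longrightarrow> 0 \<le> Re (\<phi> (f * cj f))"
  by (rule phi_pos) (auto simp: complex_mult_cnj)

lemma nrm_nonneg [simp]: "f \<in> A \<Longrightarrow> 0 \<le> nrm \<phi> f"
  by (simp add: nrm_def phi_sq_pos)

lemma nrm_sq: "f \<in> A \<Longrightarrow> (nrm \<phi> f)\<^sup>2 = Re (\<phi> (f * cj f))"
  by (simp add: nrm_def phi_sq_pos)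

lemma phi_sq: "f \<in> A \<Longrightarrow> \<phi> (f * cj f) = of_real ((nrm \<phi> f)\<^sup>2)"
  using phi_cj[of "f * cj f"] by (simp add: nrm_sq complex_eq_iff mult.commute)

lemma nrm_cj [simp]: "nrm \<phi> (cj f) = nrm \<phi> f"
  by (simp add: nrm_def mult.commute)

lemma nrm_cst_mult: "f \<in> A \<Longrightarrow> nrm \<phi> (cst c * f) = cmod c * nrm \<phi> f"
proof -
  assume f: "f \<in> A"
  have "cst c * f * cj (cst c * f) = cst (c * cnj c) * (f * cj f)"
    by (simp add: cst_mult mult_ac)
  then have "\<phi> (cst c * f * cj (cst c * f)) = of_real ((cmod c)\<^sup>2) * of_real ((nrm \<phi> f)\<^sup>2)"
    using f by (simp only: phi_scale phi_sq mult_in cj_in complex_norm_square)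
  then show ?thesis
    using f by (simp add: nrm_def[of _ "cst c * f"] real_sqrt_mult)
qed

lemma nrm_minus_commute: "f \<in> A \<Longrightarrow> g \<in> A \<Longrightarrow> nrm \<phi> (f - g) = nrm \<phi> (g - f)"
proof -
  have "(f - g) * cj (f - g) = (g - f) * cj (g - f)"
    by (simp add: algebra_simps)
  then show ?thesis by (simp add: nrm_def)
qed

lemma nrm_0 [simp]: "nrm \<phi> 0 = 0"
  by (simp add: nrm_def)

section \<open>Cauchy-Schwarz and the inequalities for the seminorm\<close>

lemma cauchy_schwarz_cj:
  assumes f: "f \<in> A" and g: "g \<in> A"
  shows "cmod (\<phi> (f * cj g)) \<le> nrm \<phi> f * nrm \<phi> g"
proof -
  define c where "c = \<phi> (f * cj g)"
  have c': "\<phi> (g * cj f) = cnj c"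
    using phi_cj[of "f * cj g"] f g by (simp add: c_def mult.commute)
  have key: "0 \<le> (nrm \<phi> f)\<^sup>2 - 2 * s * (cmod c)\<^sup>2 + s\<^sup>2 * (cmod c)\<^sup>2 * (nrm \<phi> g)\<^sup>2" for s :: real
  proof -
    define t where "t = of_real s * c"
    have "(f - cst t * g) * cj (f - cst t * g) =
        f * cj f - cst (cnj t) * (f * cj g) - cst t * (g * cj f) + cst (t * cnj t) * (g * cj g)"
      by (simp add: algebra_simps cst_mult)
    then have "\<phi> ((f - cst t * g) * cj (f - cst t * g)) =
        of_real ((nrm \<phi> f)\<^sup>2) - cnj t * c - t * cnj c + t * cnj t * of_real ((nrm \<phi> g)\<^sup>2)"
      using f g by (simp add: phi_diff phi_add phi_scale phi_sq c' c_def[symmetric])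
    moreover have "cnj t * c = of_real (s * (cmod c)\<^sup>2)" "t * cnj c = of_real (s * (cmod c)\<^sup>2)"
      "t * cnj t = of_real (s\<^sup>2 * (cmod c)\<^sup>2)"
      using complex_norm_square[of c]
      by (simp_all add: t_def power_mult_distrib power2_eq_square[of "of_real s"] mult.commute[of "cnj c"])
    ultimately have "\<phi> ((f - cst t * g) * cj (f - cst t * g)) =
        of_real ((nrm \<phi> f)\<^sup>2 - s * (cmod c)\<^sup>2 - s * (cmod c)\<^sup>2 + s\<^sup>2 * (cmod c)\<^sup>2 * (nrm \<phi> g)\<^sup>2)"
      by simp
    then have "Re (\<phi> ((f - cst t * g) * cj (f - cst t * g))) =
        (nrm \<phi> f)\<^sup>2 - 2 * s * (cmod c)\<^sup>2 + s\<^sup>2 * (cmod c)\<^sup>2 * (nrm \<phi> g)\<^sup>2"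
      by simp
    with phi_sq_pos[of "f - cst t * g"] f g show ?thesis by simp
  qed
  have "(cmod c)\<^sup>2 \<le> (nrm \<phi> f)\<^sup>2 * (nrm \<phi> g)\<^sup>2"
  proof (cases "nrm \<phi> g = 0")
    case True
    show ?thesis
    proof (rule ccontr)
      assume "\<not> ?thesis"
      then have pos: "0 < (cmod c)\<^sup>2" using True by auto
      \<comment> \<open>The chosen \<open>s\<close> makes the right-hand side of \<open>key\<close>
        equal to -1 when \<open>nrm \<phi> g = 0\<close>.\<close>
      show False
        using key[of "((nrm \<phi> f)\<^sup>2 + 1) / (2 * (cmod c)\<^sup>2)"] pos True by simp
    qed
  next
    case False
    then have pos: "0 < (nrm \<phi> g)\<^sup>2" by simp
    have "0 \<le> (nrm \<phi> f)\<^sup>2 - (cmod c)\<^sup>2 / (nrm \<phi> g)\<^sup>2"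
    proof -
      have "(1 / y)\<^sup>2 * x * y = x / y" if "y > 0" for x y :: real
        using that by (simp add: power2_eq_square)
      then show ?thesis using key[of "1 / (nrm \<phi> g)\<^sup>2"] pos by simp
    qed
    then show ?thesis using pos by (simp add: field_simps)
  qed
  then have "(cmod c)\<^sup>2 \<le> (nrm \<phi> f * nrm \<phi> g)\<^sup>2" by (simp add: power_mult_distrib)
  then show ?thesis
    unfolding c_def[symmetric] using f g by (meson nrm_nonneg mult_nonneg_nonneg power2_le_imp_le)
qed

lemma cauchy_schwarz:
  "f \<in> A \<Longrightarrow> g \<in> A \<Longrightarrow> cmod (\<phi> (f * g)) \<le> nrm \<phi> f * nrm \<phi> g"
  using cauchy_schwarz_cj[of f "cj g"] by simp

lemma nrm_triangle:
  assumes f: "f \<in> A" and g: "g \<in> A"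
  shows "nrm \<phi> (f + g) \<le> nrm \<phi> f + nrm \<phi> g"
proof -
  have "(f + g) * cj (f + g) = f * cj f + f * cj g + cj (f * cj g) + g * cj g"
    by (simp add: algebra_simps)
  then have "(nrm \<phi> (f + g))\<^sup>2 = (nrm \<phi> f)\<^sup>2 + 2 * Re (\<phi> (f * cj g)) + (nrm \<phi> g)\<^sup>2"
    using f g by (simp add: nrm_sq phi_add phi_cj del: cj_mult)
  also have "\<dots> \<le> (nrm \<phi> f)\<^sup>2 + 2 * (nrm \<phi> f * nrm \<phi> g) + (nrm \<phi> g)\<^sup>2"
    using cauchy_schwarz_cj[OF f g] complex_Re_le_cmod[of "\<phi> (f * cj g)"] by linarith
  also have "\<dots> = (nrm \<phi> f + nrm \<phi> g)\<^sup>2" by (simp add: power2_sum)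
  finally show ?thesis
    using f g by (meson add_nonneg_nonneg nrm_nonneg power2_le_imp_le)
qed

lemma nrm_triangle3:
  assumes "f \<in> A" "g \<in> A" "h \<in> A"
  shows "nrm \<phi> (f + g + h) \<le> nrm \<phi> f + nrm \<phi> g + nrm \<phi> h"
  using nrm_triangle[of "f + g" h] nrm_triangle[of f g] assms by simp

lemma nrm_triangle_diff:
  assumes "f \<in> A" "g \<in> A" "h \<in> A"
  shows "nrm \<phi> (f - h) \<le> nrm \<phi> (f - g) + nrm \<phi> (g - h)"
  using nrm_triangle[of "f - g" "g - h"] assms by simp

lemma nrm_le_add_diff: "f \<in> A \<Longrightarrow> g \<in> A \<Longrightarrow> nrm \<phi> f \<le> nrm \<phi> g + nrm \<phi> (f - g)"
  using nrm_triangle[of g "f - g"] by simp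

lemma nrm_abs_diff: "f \<in> A \<Longrightarrow> g \<in> A \<Longrightarrow> \<bar>nrm \<phi> f - nrm \<phi> g\<bar> \<le> nrm \<phi> (f - g)"
  using nrm_le_add_diff[of f g] nrm_le_add_diff[of g f] nrm_minus_commute[of f g] by auto

lemma parallelogram:
  assumes f: "f \<in> A" and g: "g \<in> A"
  shows "(nrm \<phi> (f + g))\<^sup>2 + (nrm \<phi> (f - g))\<^sup>2 = 2 * (nrm \<phi> f)\<^sup>2 + 2 * (nrm \<phi> g)\<^sup>2"
proof -
  have "(f + g) * cj (f + g) + (f - g) * cj (f - g) = (f * cj f + f * cj f) + (g * cj g + g * cj g)"
    by (simp add: algebra_simps)
  then have "\<phi> ((f + g) * cj (f + g) + (f - g) * cj (f - g)) =
      \<phi> ((f * cj f + f * cj f) + (g * cj g + g * cj g))" by simp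
  then have "\<phi> ((f + g) * cj (f + g)) + \<phi> ((f - g) * cj (f - g)) =
      \<phi> (f * cj f) + \<phi> (f * cj f) + (\<phi> (g * cj g) + \<phi> (g * cj g))"
    using f g by (simp only: phi_add add_in diff_in mult_in cj_in)
  then have "Re (\<phi> ((f + g) * cj (f + g)) + \<phi> ((f - g) * cj (f - g))) =
      Re (\<phi> (f * cj f) + \<phi> (f * cj f) + (\<phi> (g * cj g) + \<phi> (g * cj g)))" by simp
  then show ?thesis using f g by (simp only: nrm_sq add_in diff_in plus_complex.sel)
qed

lemma nrm_mult_le:
  assumes f: "f \<in> A" and g: "g \<in> A" and b: "bounded_by C g"
  shows "nrm \<phi> (g * f) \<le> C * nrm \<phi> f"
proof -
  have "Re (\<phi> ((g * f) * cj (g * f))) \<le> Re (\<phi> (cst (of_real (C\<^sup>2)) * (f * cj f)))"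
  proof (rule phi_mono_abs)
    fix x
    have "(cmod (g x))\<^sup>2 \<le> C\<^sup>2" using b by (simp add: bounded_by_def power_mono)
    moreover have "g x * f x * (cnj (g x) * cnj (f x)) = of_real ((cmod (g x))\<^sup>2 * (cmod (f x))\<^sup>2)"
      by (simp only: of_real_mult complex_norm_square mult_ac)
    moreover have "f x * cnj (f x) = of_real ((cmod (f x))\<^sup>2)"
      by (simp only: complex_norm_square)
    ultimately show "Re ((g * f * cj (g * f)) x) \<le> Re ((cst (of_real (C\<^sup>2)) * (f * cj f)) x)"
      by (simp del: of_real_power add: mult_right_mono flip: of_real_mult)
  qed (use f g in \<open>auto simp: algebra_simps simp flip: of_real_power\<close>)
  also have "\<dots> = (C * nrm \<phi> f)\<^sup>2"
    using f phi_scale[of "f * cj f" "of_real (C\<^sup>2)"]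
    by (simp add: nrm_sq power_mult_distrib flip: of_real_power)
  finally have "(nrm \<phi> (g * f))\<^sup>2 \<le> (C * nrm \<phi> f)\<^sup>2" using f g by (simp add: nrm_sq)
  then show ?thesis
    using f bounded_by_nonneg[OF b] by (meson nrm_nonneg mult_nonneg_nonneg power2_le_imp_le)
qed

lemma nrm_1 [simp]: "nrm \<phi> 1 = 1"
  by (simp add: nrm_def phi_one)

lemma nrm_le_bound: "g \<in> A \<Longrightarrow> bounded_by C g \<Longrightarrow> nrm \<phi> g \<le> C"
  using nrm_mult_le[of 1 g C] by simp

lemma phi_le_nrm: "f \<in> A \<Longrightarrow> cmod (\<phi> f) \<le> nrm \<phi> f"
  using cauchy_schwarz[of f 1] by simp

lemma nrm_sum_le: "(\<And>i. i \<in> I \<Longrightarrow> F i \<in> A) \<Longrightarrow> nrm \<phi> (\<Sum>i\<in>I. F i) \<le> (\<Sum>i\<in>I. nrm \<phi> (F i))"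
proof (induction I rule: infinite_finite_induct)
  case (insert i I)
  have "nrm \<phi> (F i + (\<Sum>i\<in>I. F i)) \<le> nrm \<phi> (F i) + nrm \<phi> (\<Sum>i\<in>I. F i)"
    using insert.prems by (intro nrm_triangle sum_in) auto
  also have "\<dots> \<le> nrm \<phi> (F i) + (\<Sum>i\<in>I. nrm \<phi> (F i))"
    using insert.IH insert.prems by auto
  finally show ?case using insert.hyps by (simp only: sum.insert not_False_eq_True)
qed auto

lemma nrm_avg_le:
  assumes "\<And>i. F i \<in> A"
  shows "nrm \<phi> (avg N F) \<le> (\<Sum>i<N. nrm \<phi> (F i)) / N"
proof -
  have "nrm \<phi> (avg N F) = nrm \<phi> (\<Sum>i<N. F i) / N"
    using assms by (simp add: avg_def nrm_cst_mult norm_divide)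
  also have "\<dots> \<le> (\<Sum>i<N. nrm \<phi> (F i)) / N"
    using assms by (intro divide_right_mono nrm_sum_le) auto
  finally show ?thesis .
qed

lemma nrm_avg_le_const:
  assumes "\<And>i. F i \<in> A" "\<And>i. i < N \<Longrightarrow> nrm \<phi> (F i) \<le> C" "0 \<le> C"
  shows "nrm \<phi> (avg N F) \<le> C"
proof (cases "N = 0")
  case False
  have "(\<Sum>i<N. nrm \<phi> (F i)) \<le> real (card {..<N}) * C"
    using assms by (intro sum_bounded_above) auto
  then have "(\<Sum>i<N. nrm \<phi> (F i)) / N \<le> C" using False by (simp add: field_simps)
  then show ?thesis using nrm_avg_le[of F N] assms by (meson order_trans)
qed (use assms in \<open>simp add: avg_def\<close>)

text \<open>Convexity of the square. It compares the norm of an average with the mean of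
  \<open>\<phi> (F i * cj (F i))\<close>, as needed for van der Corput and for conditional
  expectations.\<close>

lemma nrm_avg_sq_le:
  assumes "\<And>i. F i \<in> A"
  shows "(nrm \<phi> (avg N F))\<^sup>2 \<le> (\<Sum>i<N. (nrm \<phi> (F i))\<^sup>2) / N"
proof (cases "N = 0")
  case False
  have "(nrm \<phi> (avg N F))\<^sup>2 \<le> ((\<Sum>i<N. nrm \<phi> (F i)) / N)\<^sup>2"
    using assms by (intro power_mono nrm_avg_le) auto
  also have "\<dots> = (\<Sum>i<N. nrm \<phi> (F i))\<^sup>2 / N\<^sup>2" by (simp add: power_divide)
  also have "\<dots> \<le> ((\<Sum>i<N. (nrm \<phi> (F i))\<^sup>2) * N) / N\<^sup>2"
    using sum_squared_le_sum_of_squares[of "\<lambda>i. nrm \<phi> (F i)" "{..<N}"]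
    by (intro divide_right_mono) auto
  also have "\<dots> = (\<Sum>i<N. (nrm \<phi> (F i))\<^sup>2) / N"
    using False by (simp add: power2_eq_square)
  finally show ?thesis .
qed (use assms in \<open>simp add: avg_def\<close>)

end

lemmas fun_apply = plus_fun_apply times_fun_apply one_fun_apply zero_fun_apply minus_fun_apply' cst_apply cj_apply

declare fun_apply [simp del]

lemma avg_cst: "avg N (\<lambda>n. cst c * F n) = cst c * avg N F"
  by (simp add: mult_avg)

section \<open>The mean ergodic theorem\<close>

text \<open>The limit of these averages is the projection to the functions with
  \<open>cst w * pull T 1 f = f\<close>; for \<open>w = 1\<close> it is the projection to the
  invariant functions.\<close>

definition tavg :: "('w \<Rightarrow> 'w) \<Rightarrow> complex \<Rightarrow> nat \<Rightarrow> ('w \<Rightarrow> complex) \<Rightarrow> 'w \<Rightarrow> complex" where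
  "tavg T w N f = avg N (\<lambda>n. cst (w ^ n) * pull T n f)"

lemma tavg_add: "tavg T w N (f + g) = tavg T w N f + tavg T w N g"
  by (simp add: tavg_def distrib_left avg_add)

lemma tavg_cst: "tavg T w N (cst c * f) = cst c * tavg T w N f"
  by (simp add: tavg_def mult.left_commute[of _ "cst c"] avg_cst)

lemma bounded_by_tavg:
  "cmod w = 1 \<Longrightarrow> bounded_by C f \<Longrightarrow> bounded_by C (tavg T w N f)"
  unfolding tavg_def
  by (intro bounded_by_avg bounded_by_nonneg[of C f])
    (auto simp: bounded_by_def norm_mult norm_power pull_apply fun_apply)

lemma sum_lessThan_add:
  "(\<Sum>n<m + k. V n) = (\<Sum>n<m. V n) + (\<Sum>n<k. V (n + m :: nat) :: 'b :: comm_monoid_add)"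
  by (induction k) (auto simp: add_ac)

context funalg
begin

lemma nrm_diff_le: "f \<in> A \<Longrightarrow> g \<in> A \<Longrightarrow> nrm \<phi> (f - g) \<le> nrm \<phi> f + nrm \<phi> g"
  using nrm_triangle_diff[of f 0 g] nrm_minus_commute[of 0 g] by simp

lemma nrm_avg_shift:
  assumes u: "\<And>n. u n \<in> A" "\<And>n. nrm \<phi> (u n) \<le> C"
  shows "nrm \<phi> (avg N (\<lambda>n. u (n + s)) - avg N u) \<le> 2 * s * C / N"
proof -
  have sums: "(\<Sum>n<N. u (n + s)) + (\<Sum>n<s. u n) = (\<Sum>n<N. u n) + (\<Sum>n<s. u (n + N))"
    unfolding sum_lessThan_add[symmetric] add.commute[of "\<Sum>n<N. u (n + s)"] by (simp add: add.commute)
  have "(\<Sum>n<N. u (n + s)) - (\<Sum>n<N. u n) = (\<Sum>n<s. u (n + N)) - (\<Sum>n<s. u n)"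
    unfolding diff_eq_eq diff_add_eq eq_diff_eq using sums by (simp only: add.commute)
  then have "avg N (\<lambda>n. u (n + s)) - avg N u = cst (1 / of_nat N) * (\<Sum>n<s. u (n + N) - u n)"
    by (simp only: avg_def right_diff_distrib[symmetric] sum_subtractf)
  then have "nrm \<phi> (avg N (\<lambda>n. u (n + s)) - avg N u) = nrm \<phi> (\<Sum>n<s. u (n + N) - u n) / N"
    using u by (simp add: nrm_cst_mult norm_divide)
  also have "\<dots> \<le> (\<Sum>n<s. 2 * C) / N"
  proof (intro divide_right_mono order_trans[OF nrm_sum_le] sum_mono)
    show "nrm \<phi> (u (n + N) - u n) \<le> 2 * C" for n
      using nrm_diff_le[OF u(1) u(1), of "n + N" n] u(2)[of "n + N"] u(2)[of n] by linarith
  qed (use u in auto)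
  finally show ?thesis by (simp add: mult_ac)
qed

end

locale dyn = funalg +
  fixes T :: "'a \<Rightarrow> 'a"
  assumes pull1_in: "f \<in> A \<Longrightarrow> pull T 1 f \<in> A"
    and phi_pull1: "f \<in> A \<Longrightarrow> \<phi> (pull T 1 f) = \<phi> f"
begin

lemma pull_in [simp]: "f \<in> A \<Longrightarrow> pull T n f \<in> A"
  by (induction n) (simp, metis pull_Suc pull1_in)

lemma phi_pull [simp]: "f \<in> A \<Longrightarrow> \<phi> (pull T n f) = \<phi> f"
  by (induction n) (simp, metis pull_Suc phi_pull1 pull_in)

lemma nrm_pull [simp]: "f \<in> A \<Longrightarrow> nrm \<phi> (pull T n f) = nrm \<phi> f"
  using phi_pull[of "f * cj f" n] by (simp add: nrm_def)

lemma tavg_in [simp]: "f \<in> A \<Longrightarrow> tavg T w N f \<in> A"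
  by (simp add: tavg_def)

lemma nrm_tavg_le: "cmod w = 1 \<Longrightarrow> f \<in> A \<Longrightarrow> nrm \<phi> (tavg T w N f) \<le> nrm \<phi> f"
  unfolding tavg_def by (rule nrm_avg_le_const) (auto simp: nrm_cst_mult norm_power)

lemma tavg_pull_diff:
  assumes w: "cmod w = 1" and f: "f \<in> A"
  shows "nrm \<phi> (tavg T w K (cst (w ^ i) * pull T i f) - tavg T w K f) \<le> 2 * i * nrm \<phi> f / K"
  using nrm_avg_shift[of "\<lambda>n. cst (w ^ n) * pull T n f" "nrm \<phi> f" K i] assms
  by (simp add: tavg_def power_add cst_mult mult.assoc nrm_cst_mult norm_power)

lemma tavg_cauchy:
  assumes w: "cmod w = 1" and f: "f \<in> A" and e: "e > 0"
  shows "\<exists>K. \<forall>M\<ge>K. \<forall>N\<ge>K. nrm \<phi> (tavg T w M f - tavg T w N f) < e"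
proof -
  define B where "B = nrm \<phi> f"
  define a where "a N = tavg T w N f" for N
  define h where "h = (\<lambda>(M, N). nrm \<phi> (cst (1/2) * (a M + a N)))"
  \<comment> \<open>Length 0 is excluded: an average over no terms is 0 and would force the infimum
    \<open>d\<close> to be 0.\<close>
  define P where "P = {1::nat..} \<times> {1::nat..}"
  define d where "d = Inf (h ` P)"
  have aA [simp]: "a N \<in> A" for N using f by (simp add: a_def)
  have B0: "B \<ge> 0" using f by (simp add: B_def)
  have bb: "bdd_below (h ` P)" by (rule bdd_belowI[of _ 0]) (auto simp: h_def)
  have ne: "h ` P \<noteq> {}" by (auto simp: P_def)
  have d0: "0 \<le> d" unfolding d_def using ne by (rule cInf_greatest) (auto simp: h_def)
  have dle: "d \<le> nrm \<phi> (cst (1/2) * (a M + a N))" if "M \<ge> 1" "N \<ge> 1" for M N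
  proof -
    have "d \<le> h (M, N)" unfolding d_def by (rule cInf_lower) (use that bb in \<open>auto simp: P_def\<close>)
    then show ?thesis by (simp add: h_def)
  qed
  \<comment> \<open>\<open>tavg T w K (a N)\<close> is the mean over \<open>i < N\<close> of
    averages shifted by i, each of which is within \<open>2 * i * B / K\<close> of
    \<open>a K\<close>.\<close>
  have comm: "nrm \<phi> (tavg T w K (a N) - a K) \<le> 2 * N * B / K" if "K \<ge> 1" "N \<ge> 1" for K N
  proof -
    have "tavg T w K (a N) = avg N (\<lambda>i. tavg T w K (cst (w ^ i) * pull T i f))"
      unfolding a_def tavg_def pull_avg mult_avg avg_def pull_mult pull_sum pull_cst sum_distrib_left
      by (subst sum.swap) (simp add: mult_ac add.commute)
    moreover have "avg N (\<lambda>i. a K) = a K"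
      using that by (auto simp: fun_eq_iff avg_apply)
    ultimately have eq: "tavg T w K (a N) - a K = avg N (\<lambda>i. tavg T w K (cst (w ^ i) * pull T i f) - a K)"
      by (simp only: avg_diff)
    have key: "nrm \<phi> (tavg T w K (cst (w ^ i) * pull T i f) - a K) \<le> 2 * N * B / K" if "i < N" for i
    proof -
      have "nrm \<phi> (tavg T w K (cst (w ^ i) * pull T i f) - a K) \<le> 2 * i * B / K"
        using tavg_pull_diff[OF w f, of K i] by (simp add: a_def B_def)
      also have "\<dots> \<le> 2 * N * B / K"
        using B0 \<open>i < N\<close> by (intro divide_right_mono mult_right_mono) auto
      finally show ?thesis .
    qed
    show ?thesis
      unfolding eq using key f B0 by (intro nrm_avg_le_const) auto
  qed
  \<comment> \<open>For large K the average \<open>a K\<close> is close to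
    \<open>tavg T w K u\<close>, with \<open>u\<close> a nearly minimal midpoint, and averaging does
    not increase the norm of \<open>u\<close>.\<close>
  have near: "\<exists>K0\<ge>1. \<forall>K\<ge>K0. nrm \<phi> (a K) < d + \<epsilon>" if eps: "\<epsilon> > 0" for \<epsilon>
  proof -
    obtain M N where MN: "M \<ge> 1" "N \<ge> 1" and lt: "nrm \<phi> (cst (1/2) * (a M + a N)) < d + \<epsilon>/2"
    proof -
      have "\<exists>x\<in>h ` P. x < d + \<epsilon>/2"
        using cInf_lessD[OF ne, of "d + \<epsilon>/2"] eps by (auto simp: d_def)
      then show ?thesis using that by (auto simp: h_def P_def)
    qed
    define u where "u = cst (1/2) * (a M + a N)"
    have uA: "u \<in> A" by (simp add: u_def)
    define K0 where "K0 = nat \<lceil>2 * (M + N) * B / \<epsilon>\<rceil> + 1"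
    have "nrm \<phi> (a K) < d + \<epsilon>" if K: "K \<ge> K0" for K
    proof -
      have K1: "K \<ge> 1" using K by (simp add: K0_def)
      have "2 * (M + N) * B / \<epsilon> < K" using K unfolding K0_def by linarith
      then have Kb: "(M + N) * B / K < \<epsilon> / 2" using eps K1 by (simp add: field_simps)
      have half: "cst (1/2) * (a K + a K) = a K"
        by (auto simp: fun_eq_iff fun_apply)
      have "tavg T w K u - a K = cst (1/2) * (tavg T w K (a M) + tavg T w K (a N)) - cst (1/2) * (a K + a K)"
        by (simp only: half u_def tavg_cst tavg_add)
      also have "\<dots> = cst (1/2) * ((tavg T w K (a M) - a K) + (tavg T w K (a N) - a K))"
        by (simp only: right_diff_distrib[symmetric] add_diff_add)
      finally have "nrm \<phi> (tavg T w K u - a K) =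
          1/2 * nrm \<phi> ((tavg T w K (a M) - a K) + (tavg T w K (a N) - a K))"
        using f uA by (simp only: nrm_cst_mult diff_in add_in tavg_in aA) simp
      also have "\<dots> \<le> 1/2 * (2 * M * B / K + 2 * N * B / K)"
        using nrm_triangle[of "tavg T w K (a M) - a K" "tavg T w K (a N) - a K"] comm[OF K1 MN(1)] comm[OF K1 MN(2)]
        by simp
      also have "\<dots> = (M + N) * B / K" using K1 by (simp add: field_simps)
      finally have "nrm \<phi> (tavg T w K u - a K) < \<epsilon> / 2"
        using Kb by (rule order_le_less_trans)
      then have "nrm \<phi> (a K - tavg T w K u) < \<epsilon> / 2"
        using uA nrm_minus_commute[of "a K" "tavg T w K u"] by (simp only: aA tavg_in)
      moreover have "nrm \<phi> (tavg T w K u) < d + \<epsilon>/2"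
        using nrm_tavg_le[OF w uA, of K] lt by (simp add: u_def)
      ultimately show ?thesis
        using nrm_le_add_diff[of "a K" "tavg T w K u"] uA by simp
    qed
    then show ?thesis by (intro exI[of _ K0]) (auto simp: K0_def)
  qed
  \<comment> \<open>The parallelogram law will bound the squared distance by
    \<open>4 * \<epsilon> * (2 * d + \<epsilon>)\<close>; together with \<epsilon> \<le> 1 this
    choice keeps it below the square of e.\<close>
  define \<epsilon> where "\<epsilon> = min 1 (e\<^sup>2 / (8 * (2 * d + 1)))"
  have eps: "\<epsilon> > 0" "\<epsilon> \<le> 1" using e d0 by (auto simp: \<epsilon>_def)
  have eps2: "4 * \<epsilon> * (2 * d + 1) < e\<^sup>2"
  proof -
    have "\<epsilon> * (8 * (2 * d + 1)) \<le> e\<^sup>2 / (8 * (2 * d + 1)) * (8 * (2 * d + 1))"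
      using d0 by (intro mult_right_mono) (auto simp: \<epsilon>_def)
    also have "\<dots> = e\<^sup>2" using d0 by simp
    finally have "4 * \<epsilon> * (2 * d + 1) \<le> e\<^sup>2 / 2" by (simp add: algebra_simps)
    moreover have "e\<^sup>2 / 2 < e\<^sup>2" using e by simp
    ultimately show ?thesis by linarith
  qed
  obtain K where K1: "K \<ge> 1" and K: "\<And>N. N \<ge> K \<Longrightarrow> nrm \<phi> (a N) < d + \<epsilon>"
    using near[OF eps(1)] by blast
  have "nrm \<phi> (a M - a N) < e" if "M \<ge> K" "N \<ge> K" for M N
  proof -
    have "2 * d \<le> nrm \<phi> (a M + a N)"
      using dle[of M N] that K1 by (simp add: nrm_cst_mult)
    then have "(2 * d)\<^sup>2 \<le> (nrm \<phi> (a M + a N))\<^sup>2" using d0 by (intro power_mono) auto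
    moreover have "(nrm \<phi> (a M))\<^sup>2 \<le> (d + \<epsilon>)\<^sup>2" "(nrm \<phi> (a N))\<^sup>2 \<le> (d + \<epsilon>)\<^sup>2"
      using K[of M] K[of N] that by (simp_all add: power_mono)
    ultimately have "(nrm \<phi> (a M - a N))\<^sup>2 \<le> 4 * (d + \<epsilon>)\<^sup>2 - (2 * d)\<^sup>2"
      using parallelogram[of "a M" "a N"] by simp
    also have "\<dots> = 4 * \<epsilon> * (2 * d + \<epsilon>)" by (simp add: power2_eq_square algebra_simps)
    also have "\<dots> \<le> 4 * \<epsilon> * (2 * d + 1)" using eps by (intro mult_left_mono) auto
    also have "\<dots> < e\<^sup>2" by (rule eps2)
    finally show ?thesis using e by (meson less_imp_le power_less_imp_less_base)
  qed
  then show ?thesis unfolding a_def by blast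
qed

end

text \<open>Only uniformly bounded sequences are considered, and the limit keeps their bound: balls
  of the supremum norm are complete in the quadratic norm, whereas the whole algebra of bounded
  functions usually is not.\<close>

definition seq_complete :: "('w \<Rightarrow> complex) set \<Rightarrow> (('w \<Rightarrow> complex) \<Rightarrow> complex) \<Rightarrow> bool" where
  "seq_complete A \<phi> \<longleftrightarrow> (\<forall>F C. (\<forall>n. F n \<in> A \<and> bounded_by C (F n)) \<and>
      (\<forall>e>0. \<exists>K. \<forall>m\<ge>K. \<forall>n\<ge>K. nrm \<phi> (F m - F n) < e) \<longrightarrow>
      (\<exists>f\<in>A. bounded_by C f \<and> (\<lambda>n. nrm \<phi> (F n - f)) \<longlonglongrightarrow> 0))"

locale sys = dyn +
  assumes complete: "seq_complete A \<phi>"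
begin

lemma limit_exists:
  assumes "\<And>n. F n \<in> A" "\<And>n. bounded_by C (F n)"
    and "\<And>e. e > 0 \<Longrightarrow> \<exists>K. \<forall>m\<ge>K. \<forall>n\<ge>K. nrm \<phi> (F m - F n) < e"
  obtains f where "f \<in> A" "bounded_by C f" "(\<lambda>n. nrm \<phi> (F n - f)) \<longlonglongrightarrow> 0"
  using complete assms unfolding seq_complete_def by metis

end

context funalg
begin

lemma phi_tendsto:
  assumes "\<And>n. F n \<in> A" "f \<in> A" "g \<in> A" "(\<lambda>n. nrm \<phi> (F n - f)) \<longlonglongrightarrow> 0"
  shows "(\<lambda>n. \<phi> (g * F n)) \<longlonglongrightarrow> \<phi> (g * f)"
proof (rule LIM_zero_cancel, rule tendsto_norm_zero_cancel, rule tendsto_sandwich)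
  show "\<forall>\<^sub>F n in sequentially. 0 \<le> cmod (\<phi> (g * F n) - \<phi> (g * f))" by simp
  have "\<phi> (g * F n) - \<phi> (g * f) = \<phi> (g * (F n - f))" for n
    using assms by (simp add: right_diff_distrib phi_diff)
  then show "\<forall>\<^sub>F n in sequentially. cmod (\<phi> (g * F n) - \<phi> (g * f)) \<le> nrm \<phi> g * nrm \<phi> (F n - f)"
    using assms by (simp add: cauchy_schwarz)
  show "(\<lambda>n. nrm \<phi> g * nrm \<phi> (F n - f)) \<longlonglongrightarrow> 0"
    using assms(4) by (rule tendsto_mult_right_zero)
qed auto

lemma nrm_tendsto:
  assumes "\<And>n. F n \<in> A" "f \<in> A" "(\<lambda>n. nrm \<phi> (F n - f)) \<longlonglongrightarrow> 0"
  shows "(\<lambda>n. nrm \<phi> (F n)) \<longlonglongrightarrow> nrm \<phi> f"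
proof (rule LIM_zero_cancel, rule tendsto_norm_zero_cancel, rule tendsto_sandwich)
  show "\<forall>\<^sub>F n in sequentially. norm (nrm \<phi> (F n) - nrm \<phi> f) \<le> nrm \<phi> (F n - f)"
    using nrm_abs_diff[OF assms(1,2)] by simp
  show "\<forall>\<^sub>F n in sequentially. 0 \<le> norm (nrm \<phi> (F n) - nrm \<phi> f)" by simp
qed (use assms(3) in auto)

lemma nrm_cauchyI:
  assumes "\<And>n. F n \<in> A" "f \<in> A" "(\<lambda>n. nrm \<phi> (F n - f)) \<longlonglongrightarrow> 0" "e > 0"
  shows "\<exists>K. \<forall>m\<ge>K. \<forall>n\<ge>K. nrm \<phi> (F m - F n) < e"
proof -
  obtain K where K: "\<And>n. n \<ge> K \<Longrightarrow> nrm \<phi> (F n - f) < e / 2"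
    using order_tendstoD(2)[OF assms(3), of "e/2"] \<open>e > 0\<close> unfolding eventually_sequentially by auto
  have "nrm \<phi> (F m - F n) < e" if "m \<ge> K" "n \<ge> K" for m n
    using nrm_triangle_diff[of "F m" f "F n"] K[OF that(1)] K[OF that(2)] nrm_minus_commute[of f "F n"] assms
    by auto
  then show ?thesis by blast
qed

end

text \<open>\<open>w\<close> stands for the inverse of the eigenvalue, as in the weights of the averages.\<close>

definition no_eigen :: "('w \<Rightarrow> complex) set \<Rightarrow> (('w \<Rightarrow> complex) \<Rightarrow> complex) \<Rightarrow> ('w \<Rightarrow> 'w) \<Rightarrow> complex \<Rightarrow> bool"
  where "no_eigen A \<phi> T w \<longleftrightarrow> (\<forall>f\<in>A. nrm \<phi> (cst w * pull T 1 f - f) = 0 \<longrightarrow> nrm \<phi> f = 0)"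

context sys
begin

text \<open>Applying \<open>cst w * pull T 1\<close> to an average of length N moves it by at most
  \<open>2 * nrm \<phi> f / N\<close>, so the limit is fixed up to a null function.\<close>

lemma tavg_limit:
  assumes w: "cmod w = 1" and f: "f \<in> A"
  obtains p where "p \<in> A" "(\<lambda>N. nrm \<phi> (tavg T w N f - p)) \<longlonglongrightarrow> 0"
    "nrm \<phi> (cst w * pull T 1 p - p) = 0"
proof -
  obtain C where C: "bounded_by C f" using bdd f by blast
  obtain p where p: "p \<in> A" "bounded_by C p" and lim: "(\<lambda>N. nrm \<phi> (tavg T w N f - p)) \<longlonglongrightarrow> 0"
    using limit_exists[of "\<lambda>N. tavg T w N f" C] f bounded_by_tavg[OF w C] tavg_cauchy[OF w f] by auto
  have le: "nrm \<phi> (cst w * pull T 1 p - p) \<le> 2 * nrm \<phi> (tavg T w N f - p) + 2 * nrm \<phi> f / N" if "N > 0" for N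
  proof -
    let ?a = "tavg T w N f"
    have eq: "tavg T w N (cst (w ^ 1) * pull T 1 f) = cst w * pull T 1 ?a"
      by (simp add: tavg_cst) (simp add: tavg_def pull_avg)
    have "cst w * pull T 1 p - p = (cst w * pull T 1 (p - ?a)) + (cst w * pull T 1 ?a - ?a) + (?a - p)"
      by (simp add: algebra_simps)
    then have "nrm \<phi> (cst w * pull T 1 p - p) \<le>
        nrm \<phi> (cst w * pull T 1 (p - ?a)) + nrm \<phi> (cst w * pull T 1 ?a - ?a) + nrm \<phi> (?a - p)"
      using p f by (simp only: nrm_triangle3 diff_in mult_in cst_in pull_in tavg_in)
    moreover have "nrm \<phi> (cst w * pull T 1 (p - ?a)) = nrm \<phi> (?a - p)"
      using p f w nrm_minus_commute[of p ?a] by (simp add: nrm_cst_mult del: pull_diff)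
    moreover have "nrm \<phi> (cst w * pull T 1 ?a - ?a) \<le> 2 * nrm \<phi> f / N"
      using tavg_pull_diff[OF w f, of N 1] eq by simp
    ultimately show ?thesis by simp
  qed
  have "(\<lambda>N. 2 * nrm \<phi> (tavg T w N f - p) + 2 * nrm \<phi> f / real N) \<longlonglongrightarrow> 2 * 0 + 0"
    by (intro tendsto_intros lim lim_const_over_n)
  then have "nrm \<phi> (cst w * pull T 1 p - p) \<le> 2 * 0 + 0"
  proof (rule tendsto_lowerbound)
    show "\<forall>\<^sub>F N in sequentially.
        nrm \<phi> (cst w * pull T 1 p - p) \<le> 2 * nrm \<phi> (tavg T w N f - p) + 2 * nrm \<phi> f / real N"
      using eventually_gt_at_top[of 0] by eventually_elim (rule le)
  qed simp
  then have eig: "nrm \<phi> (cst w * pull T 1 p - p) = 0"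
    using nrm_nonneg[OF diff_in[OF mult_in[OF cst_in pull_in[OF p(1)]] p(1)], of w 1] by linarith
  show ?thesis using p(1) lim eig by (rule that)
qed

lemma no_eigen_tavg:
  assumes "cmod w = 1" "no_eigen A \<phi> T w" "f \<in> A"
  shows "(\<lambda>N. nrm \<phi> (tavg T w N f)) \<longlonglongrightarrow> 0"
proof -
  obtain p where p: "p \<in> A" "(\<lambda>N. nrm \<phi> (tavg T w N f - p)) \<longlonglongrightarrow> 0"
    "nrm \<phi> (cst w * pull T 1 p - p) = 0"
    using tavg_limit[OF assms(1,3)] .
  moreover have "nrm \<phi> p = 0"
    using assms(2) p unfolding no_eigen_def by blast
  ultimately show ?thesis using nrm_tendsto[OF tavg_in[OF assms(3)] p(1,2)] by simp
qed

end

lemma cesaro_shift: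
  fixes x :: "nat \<Rightarrow> complex"
  assumes b: "\<And>n. cmod (x n) \<le> C"
  shows "cmod ((\<Sum>n<N. x (n + s)) / of_nat N - (\<Sum>n<N. x n) / of_nat N) \<le> 2 * s * C / N"
proof -
  have "(\<Sum>n<N. x (n + s)) + (\<Sum>n<s. x n) = (\<Sum>n<N. x n) + (\<Sum>n<s. x (n + N))"
    using sum_lessThan_add[of x s N] sum_lessThan_add[of x N s] by (simp add: add_ac)
  then have eq: "(\<Sum>n<N. x (n + s)) - (\<Sum>n<N. x n) = (\<Sum>n<s. x (n + N) - x n)"
    by (simp add: sum_subtractf algebra_simps)
  have "cmod (x (n + N) - x n) \<le> 2 * C" for n
    using norm_triangle_ineq4[of "x (n + N)" "x n"] b[of "n + N"] b[of n] by linarith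
  then have "cmod (\<Sum>n<s. x (n + N) - x n) \<le> (\<Sum>n<s. 2 * C)"
    by (rule sum_norm_le)
  then have "cmod (\<Sum>n<s. x (n + N) - x n) / N \<le> 2 * s * C / N"
    by (intro divide_right_mono) (simp_all add: mult_ac)
  then show ?thesis
    by (simp only: eq norm_divide norm_of_nat diff_divide_distrib[symmetric])
qed

lemma tendsto_0_squeeze:
  fixes f g :: "nat \<Rightarrow> real"
  assumes "\<And>n. 0 \<le> f n" "\<And>n. f n \<le> g n" "g \<longlonglongrightarrow> 0"
  shows "f \<longlonglongrightarrow> 0"
  by (rule Lim_null_comparison[OF _ assms(3)]) (use assms in auto)

section \<open>Relative squares\<close>

text \<open>One type carries a system together with all its iterated relative squares: each extension adds a coordinate
  in \<^typ>\<open>nat\<close>, and functions on the extension are sequences of functions, by \<open>slice\<close>. The sequence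
  \<open>f \<cdot> T ^ n g\<close> represents \<open>f \<otimes> g\<close>, because its mean is the integral of \<open>f \<otimes> g\<close> over the joining
  relative to the invariant factor. Shifting the sequence is the action of \<open>T\<close> on the second factor.\<close>

type_synonym 'a om = "'a \<times> (nat \<Rightarrow> nat)"

definition ext :: "nat \<Rightarrow> 'a om \<Rightarrow> 'a om" where
  "ext n w = (fst w, case_nat n (snd w))"

definition hd_om :: "'a om \<Rightarrow> nat" where
  "hd_om w = snd w 0"

definition tl_om :: "'a om \<Rightarrow> 'a om" where
  "tl_om w = (fst w, \<lambda>i. snd w (Suc i))"

lemma hd_ext [simp]: "hd_om (ext n w) = n" and tl_ext [simp]: "tl_om (ext n w) = w"
  by (simp_all add: ext_def hd_om_def tl_om_def)

lemma ext_hd_tl [simp]: "ext (hd_om w) (tl_om w) = w"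
  by (auto simp: ext_def hd_om_def tl_om_def prod_eq_iff fun_eq_iff split: nat.split)

definition slice :: "nat \<Rightarrow> ('a om \<Rightarrow> complex) \<Rightarrow> 'a om \<Rightarrow> complex" where
  "slice n F = (\<lambda>w. F (ext n w))"

text \<open>For W commuting with T, this acts on tensors as W on the first factor and as W followed
  by \<open>T ^ s\<close> on the second, see \<open>pull_tensor\<close>. Thus
  \<open>lift 0 T\<close> is the diagonal map, and \<open>lift 1 id\<close> moves the second factor
  alone.\<close>

definition lift :: "nat \<Rightarrow> ('a om \<Rightarrow> 'a om) \<Rightarrow> 'a om \<Rightarrow> 'a om" where
  "lift s W w = ext (hd_om w + s) (W (tl_om w))"

definition emb :: "('a om \<Rightarrow> complex) \<Rightarrow> 'a om \<Rightarrow> complex" where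
  "emb f = (\<lambda>w. f (tl_om w))"

definition tensor :: "('a om \<Rightarrow> 'a om) \<Rightarrow> ('a om \<Rightarrow> complex) \<Rightarrow> ('a om \<Rightarrow> complex) \<Rightarrow> 'a om \<Rightarrow> complex"
  where "tensor T f g = (\<lambda>w. f (tl_om w) * g ((T ^^ hd_om w) (tl_om w)))"

lemma slice_add [simp]: "slice n (F + G) = slice n F + slice n G"
  and slice_diff [simp]: "slice n (F - G) = slice n F - slice n G"
  and slice_mult [simp]: "slice n (F * G) = slice n F * slice n G"
  and slice_cst [simp]: "slice n (cst c) = cst c"
  and slice_1 [simp]: "slice n 1 = 1"
  and slice_cj [simp]: "slice n (cj F) = cj (slice n F)"
  and slice_emb [simp]: "slice n (emb f) = f"
  and slice_tensor [simp]: "slice n (tensor T f g) = f * pull T n g"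
  by (auto simp: fun_eq_iff fun_apply slice_def emb_def tensor_def pull_apply)

lemma lift_ext: "lift s W (ext n w) = ext (n + s) (W w)"
  by (simp add: lift_def)

lemma lift_pow_ext: "(lift s W ^^ m) (ext n w) = ext (n + s * m) ((W ^^ m) w)"
  by (induction m) (auto simp: lift_ext add_ac)

lemma slice_pull [simp]: "slice n (pull (lift s W) m F) = pull W m (slice (n + s * m) F)"
  by (simp add: fun_eq_iff slice_def pull_apply lift_pow_ext)

lemma slice_eqI: "(\<And>n. slice n F = slice n G) \<Longrightarrow> F = G"
  by (metis (no_types) ext ext_hd_tl slice_def)

lemma bounded_by_slice: "bounded_by C F \<Longrightarrow> bounded_by C (slice n F)"
  unfolding bounded_by_def slice_def by blast

lemma bounded_by_sliceI: "(\<And>n. bounded_by C (slice n F)) \<Longrightarrow> bounded_by C F"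
  unfolding bounded_by_def slice_def by (metis ext_hd_tl)

lemma bounded_by_emb: "bounded_by C f \<Longrightarrow> bounded_by C (emb f)"
  unfolding bounded_by_def emb_def by blast

lemma emb_add [simp]: "emb (f + g) = emb f + emb g"
  and emb_mult [simp]: "emb (f * g) = emb f * emb g"
  and emb_cst [simp]: "emb (cst c) = cst c"
  and emb_1 [simp]: "emb 1 = 1"
  and emb_cj [simp]: "emb (cj f) = cj (emb f)"
  and pull_emb [simp]: "pull (lift s W) m (emb f) = emb (pull W m f)"
  by (rule slice_eqI, simp)+

lemma tensor_add_left: "tensor T (f + f') g = tensor T f g + tensor T f' g"
  and tensor_mult: "tensor T (f * f') (g * g') = tensor T f g * tensor T f' g'"
  and cj_tensor: "cj (tensor T f g) = tensor T (cj f) (cj g)"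
  and tensor_cst: "tensor T (cst c * f) g = cst c * tensor T f g"
  and tensor_1 [simp]: "tensor T 1 1 = 1"
  by (rule slice_eqI, simp add: algebra_simps)+

lemma pull_commute: "W \<circ> T = T \<circ> W \<Longrightarrow> pull W m (pull T n f) = pull T n (pull W m f)"
proof -
  assume c: "W \<circ> T = T \<circ> W"
  have 1: "(W ^^ m) (T x) = T ((W ^^ m) x)" for x
    by (induction m) (use c in \<open>auto simp: fun_eq_iff\<close>)
  have "(T ^^ n) ((W ^^ m) x) = (W ^^ m) ((T ^^ n) x)" for x
    by (induction n) (auto simp: 1)
  then show ?thesis by (simp add: pull_def)
qed

lemma pull_tensor:
  assumes "W \<circ> T = T \<circ> W"
  shows "pull (lift s W) m (tensor T f g) = tensor T (pull W m f) (pull W m (pull T (s * m) g))"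
  by (rule slice_eqI) (simp add: pull_commute[OF assms] add.commute)

text \<open>Sums without coefficients already form a linear space, because a constant can be
  absorbed into the first factor.\<close>

inductive tensor_sum :: "('a om \<Rightarrow> complex) set \<Rightarrow> ('a om \<Rightarrow> 'a om) \<Rightarrow> ('a om \<Rightarrow> complex) \<Rightarrow> bool"
  for A T where
  "f \<in> A \<Longrightarrow> g \<in> A \<Longrightarrow> tensor_sum A T (tensor T f g)"
| "tensor_sum A T F \<Longrightarrow> tensor_sum A T G \<Longrightarrow> tensor_sum A T (F + G)"

definition tensors :: "('a om \<Rightarrow> complex) set \<Rightarrow> ('a om \<Rightarrow> 'a om) \<Rightarrow> ('a om \<Rightarrow> complex) set" where
  "tensors A T = {F. tensor_sum A T F}"

lemma tensorI: "f \<in> A \<Longrightarrow> g \<in> A \<Longrightarrow> tensor T f g \<in> tensors A T"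
  and tensors_add: "F \<in> tensors A T \<Longrightarrow> G \<in> tensors A T \<Longrightarrow> F + G \<in> tensors A T"
  by (simp_all only: tensors_def mem_Collect_eq tensor_sum.intros)

lemma tensors_induct [consumes 1, case_names tensor add, induct set: tensors]:
  assumes "F \<in> tensors A T"
    and "\<And>f g. f \<in> A \<Longrightarrow> g \<in> A \<Longrightarrow> P (tensor T f g)"
    and "\<And>F G. F \<in> tensors A T \<Longrightarrow> P F \<Longrightarrow> G \<in> tensors A T \<Longrightarrow> P G \<Longrightarrow> P (F + G)"
  shows "P F"
proof -
  have "tensor_sum A T F" using assms(1) by (simp only: tensors_def mem_Collect_eq)
  then show ?thesis
    by (induction rule: tensor_sum.induct) (simp_all only: assms tensors_def mem_Collect_eq)
qed

definition mean_phi :: "(('a om \<Rightarrow> complex) \<Rightarrow> complex) \<Rightarrow> ('a om \<Rightarrow> complex) \<Rightarrow> complex" where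
  "mean_phi \<phi> F = lim (\<lambda>N. (\<Sum>n<N. \<phi> (slice n F)) / of_nat N)"

section \<open>The joining relative to the invariant factor, on sums of tensors\<close>

context
  fixes A :: "('a om \<Rightarrow> complex) set" and \<phi> T
  assumes S: "sys A \<phi> T"
begin

interpretation sys A \<phi> T by (rule S)

lemma tensors_slice: "F \<in> tensors A T \<Longrightarrow> slice n F \<in> A"
  by (induction rule: tensors_induct) auto

text \<open>The slices of \<open>tensor T f g\<close> are \<open>f * pull T n g\<close>, so their
  averages tend to f times the invariant projection of g. The norm limit is the conditional
  expectation on the first factor; its integral is \<open>mean_phi\<close>.\<close>

lemma tensors_conv:
  assumes "F \<in> tensors A T"
  shows "\<exists>e\<in>A. (\<lambda>N. nrm \<phi> (avg N (\<lambda>n. slice n F) - e)) \<longlonglongrightarrow> 0"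
  using assms
proof (induction rule: tensors_induct)
  case (tensor f g)
  obtain C where C: "bounded_by C f" using bdd tensor by blast
  obtain p where p: "p \<in> A" "(\<lambda>N. nrm \<phi> (tavg T 1 N g - p)) \<longlonglongrightarrow> 0"
    using tavg_limit[of 1 g] tensor by auto
  have eq: "avg N (\<lambda>n. slice n (tensor T f g)) - f * p = f * (tavg T 1 N g - p)" for N
    by (simp add: tavg_def right_diff_distrib mult_avg)
  have "(\<lambda>N. nrm \<phi> (f * (tavg T 1 N g - p))) \<longlonglongrightarrow> 0"
    using p tensor C
    by (intro tendsto_0_squeeze[OF _ _ tendsto_mult_right_zero[OF p(2), of C]] nrm_mult_le nrm_nonneg) auto
  then show ?case using p tensor by (intro bexI[of _ "f * p"]) (simp_all only: eq mult_in)
next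
  case (add F G)
  then obtain d e where d: "d \<in> A" "(\<lambda>N. nrm \<phi> (avg N (\<lambda>n. slice n F) - d)) \<longlonglongrightarrow> 0"
    and e: "e \<in> A" "(\<lambda>N. nrm \<phi> (avg N (\<lambda>n. slice n G) - e)) \<longlonglongrightarrow> 0" by blast
  have sl: "slice n F \<in> A" "slice n G \<in> A" for n
    using add tensors_slice by auto
  have eq: "avg N (\<lambda>n. slice n (F + G)) - (d + e) =
      (avg N (\<lambda>n. slice n F) - d) + (avg N (\<lambda>n. slice n G) - e)" for N
    by (simp add: avg_add)
  have "(\<lambda>N. nrm \<phi> ((avg N (\<lambda>n. slice n F) - d) + (avg N (\<lambda>n. slice n G) - e))) \<longlonglongrightarrow> 0"
    using sl d(1) e(1) tendsto_add_zero[OF d(2) e(2)]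
    by (intro tendsto_0_squeeze[OF nrm_nonneg nrm_triangle]) (auto simp only: diff_in add_in avg_in)
  then show ?case using d e by (intro bexI[of _ "d + e"]) (simp_all only: eq add_in)
qed

lemma mean_phi_lim:
  assumes F: "F \<in> tensors A T"
  shows "(\<lambda>N. (\<Sum>n<N. \<phi> (slice n F)) / of_nat N) \<longlonglongrightarrow> mean_phi \<phi> F"
proof -
  obtain e where e: "e \<in> A" "(\<lambda>N. nrm \<phi> (avg N (\<lambda>n. slice n F) - e)) \<longlonglongrightarrow> 0"
    using tensors_conv[OF F] by blast
  have "(\<lambda>N. \<phi> (1 * avg N (\<lambda>n. slice n F))) \<longlonglongrightarrow> \<phi> (1 * e)"
    using phi_tendsto[OF _ e(1) one_in e(2)] tensors_slice[OF F] by auto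
  then have "(\<lambda>N. (\<Sum>n<N. \<phi> (slice n F)) / of_nat N) \<longlonglongrightarrow> \<phi> e"
    using tensors_slice[OF F] by (simp add: phi_avg)
  then show ?thesis unfolding mean_phi_def by (simp add: limI)
qed

lemma mean_phi_eqI:
  assumes "F \<in> tensors A T" "(\<lambda>N. (\<Sum>n<N. \<phi> (slice n F)) / of_nat N) \<longlonglongrightarrow> c"
  shows "mean_phi \<phi> F = c"
  using LIMSEQ_unique[OF mean_phi_lim[OF assms(1)] assms(2)] .

lemma tensors_cst: "cst c \<in> tensors A T"
  using tensorI[of "cst c" A 1 T] tensor_cst[of T c 1 1] by simp

lemma tensors_mult:
  assumes "F \<in> tensors A T" "G \<in> tensors A T"
  shows "F * G \<in> tensors A T"
  using assms
proof (induction arbitrary: G rule: tensors_induct)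
  case (tensor f g)
  from tensor(3) show ?case
  proof (induction rule: tensors_induct)
    case (tensor f' g')
    then show ?case
      using tensorI[of "f * f'" A "g * g'" T] \<open>f \<in> A\<close> \<open>g \<in> A\<close> by (simp add: tensor_mult)
  qed (simp add: distrib_left tensors_add)
qed (simp add: distrib_right tensors_add)

lemma tensors_cj: "F \<in> tensors A T \<Longrightarrow> cj F \<in> tensors A T"
  by (induction rule: tensors_induct) (auto simp: cj_tensor intro: tensorI tensors_add)

lemma tensors_bdd: "F \<in> tensors A T \<Longrightarrow> \<exists>C. bounded_by C F"
proof (induction rule: tensors_induct)
  case (tensor f g)
  obtain C where "bounded_by C f" using bdd tensor by blast
  moreover obtain D where "bounded_by D g" using bdd tensor by blast
  ultimately have "bounded_by (C * D) (slice n (tensor T f g))" for n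
    unfolding slice_tensor by (intro bounded_by_mult bounded_by_pull)
  then have "bounded_by (C * D) (tensor T f g)"
    by (rule bounded_by_sliceI)
  then show ?case by blast
qed (blast intro: bounded_by_add)

lemma funalg_tensors: "funalg (tensors A T) (mean_phi \<phi>)"
proof
  fix F G c
  assume F: "F \<in> tensors A T"
  note [simp] = tensors_slice[OF F]
  show "cj F \<in> tensors A T" using F by (rule tensors_cj)
  show "\<exists>C. bounded_by C F" using F by (rule tensors_bdd)
  show "mean_phi \<phi> (cst c * F) = c * mean_phi \<phi> F"
    using F tendsto_mult_left[OF mean_phi_lim[OF F], of c]
    by (intro mean_phi_eqI tensors_mult tensors_cst) (simp_all add: phi_scale sum_distrib_left)
  show "mean_phi \<phi> (cj F) = cnj (mean_phi \<phi> F)"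
    using F tendsto_cnj[OF mean_phi_lim[OF F]]
    by (intro mean_phi_eqI tensors_cj) (simp_all add: phi_cj)
  show "0 \<le> Re (mean_phi \<phi> F)" if "\<And>x. Im (F x) = 0 \<and> 0 \<le> Re (F x)"
  proof -
    have "0 \<le> Re (\<phi> (slice n F))" for n
      by (rule phi_pos[OF tensors_slice[OF F]]) (simp add: slice_def that)
    then have "0 \<le> Re ((\<Sum>n<N. \<phi> (slice n F)) / of_nat N)" for N
      by (simp add: sum_nonneg)
    then show ?thesis
      by (intro LIMSEQ_le_const[OF tendsto_Re[OF mean_phi_lim[OF F]]]) blast
  qed
  assume G: "G \<in> tensors A T"
  note [simp] = tensors_slice[OF G]
  show "F + G \<in> tensors A T" using F G by (rule tensors_add)
  show "F * G \<in> tensors A T" using F G by (rule tensors_mult)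
  show "mean_phi \<phi> (F + G) = mean_phi \<phi> F + mean_phi \<phi> G"
    using F G tendsto_add[OF mean_phi_lim[OF F] mean_phi_lim[OF G]]
    by (intro mean_phi_eqI tensors_add) (simp_all add: phi_add sum.distrib add_divide_distrib)
next
  show "cst c \<in> tensors A T" for c by (rule tensors_cst)
  have "(\<lambda>N. (\<Sum>n<N. \<phi> (slice n 1)) / of_nat N) \<longlonglongrightarrow> 1"
  proof (rule tendsto_eventually)
    show "\<forall>\<^sub>F N in sequentially. (\<Sum>n<N. \<phi> (slice n 1)) / of_nat N = 1"
      using eventually_gt_at_top[of 0] by eventually_elim (simp add: phi_one)
  qed
  then show "mean_phi \<phi> 1 = 1"
    using tensors_cst[of 1] by (intro mean_phi_eqI) simp_all
qed

text \<open>W preserves \<phi> on every slice, and shifting the index by s does not change a Cesaro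
  limit.\<close>

lemma dyn_tensors:
  assumes W: "dyn A \<phi> W" and c: "W \<circ> T = T \<circ> W"
  shows "dyn (tensors A T) (mean_phi \<phi>) (lift s W)"
proof -
  interpret W: dyn A \<phi> W by (rule W)
  have in': "pull (lift s W) 1 F \<in> tensors A T" if "F \<in> tensors A T" for F
    using that
  proof (induction rule: tensors_induct)
    case (tensor f g)
    then show ?case unfolding pull_tensor[OF c] by (intro tensorI W.pull_in pull_in)
  qed (auto intro: tensors_add)
  have "mean_phi \<phi> (pull (lift s W) 1 F) = mean_phi \<phi> F" if F: "F \<in> tensors A T" for F
  proof (rule mean_phi_eqI)
    obtain C where C: "bounded_by C F" using tensors_bdd[OF F] by blast
    define x where "x n = \<phi> (slice n F)" for n
    have xC: "cmod (x n) \<le> C" for n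
      unfolding x_def using tensors_slice[OF F] C
      by (intro order_trans[OF phi_le_nrm] nrm_le_bound bounded_by_slice) auto
    have eq: "\<phi> (slice n (pull (lift s W) 1 F)) = x (n + s)" for n
      using W.phi_pull[OF tensors_slice[OF F]] by (simp add: x_def)
    have "(\<lambda>N. (\<Sum>n<N. x (n + s)) / of_nat N - (\<Sum>n<N. x n) / of_nat N) \<longlonglongrightarrow> 0"
    proof (rule Lim_null_comparison)
      show "\<forall>\<^sub>F N in sequentially. cmod ((\<Sum>n<N. x (n + s)) / of_nat N - (\<Sum>n<N. x n) / of_nat N)
          \<le> 2 * real s * C / real N"
        by (intro always_eventually allI cesaro_shift xC)
    qed (rule lim_const_over_n)
    from tendsto_add[OF this mean_phi_lim[OF F, folded x_def]]
    show "(\<lambda>N. (\<Sum>n<N. \<phi> (slice n (pull (lift s W) 1 F))) / of_nat N) \<longlonglongrightarrow> mean_phi \<phi> F"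
      unfolding eq by simp
  qed (rule in'[OF F])
  then show ?thesis
    using funalg_tensors in' by (simp add: dyn_def dyn_axioms_def)
qed

end

text \<open>Here the extra coordinate indexes Cauchy sequences.\<close>

definition completion :: "('a om \<Rightarrow> complex) set \<Rightarrow> (('a om \<Rightarrow> complex) \<Rightarrow> complex) \<Rightarrow> ('a om \<Rightarrow> complex) set" where
  "completion A \<phi> = {F. (\<forall>j. slice j F \<in> A) \<and> (\<exists>C. bounded_by C F) \<and>
     (\<forall>e>0. \<exists>K. \<forall>m\<ge>K. \<forall>n\<ge>K. nrm \<phi> (slice m F - slice n F) < e)}"

definition lim_phi :: "(('a om \<Rightarrow> complex) \<Rightarrow> complex) \<Rightarrow> ('a om \<Rightarrow> complex) \<Rightarrow> complex" where
  "lim_phi \<phi> F = lim (\<lambda>j. \<phi> (slice j F))"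

section \<open>Completion of a function algebra in its seminorm\<close>

context
  fixes A :: "('a om \<Rightarrow> complex) set" and \<phi>
  assumes S: "funalg A \<phi>"
begin

interpretation funalg A \<phi> by (rule S)

lemma completion_slice: "F \<in> completion A \<phi> \<Longrightarrow> slice j F \<in> A"
  unfolding completion_def by blast

lemma completion_bdd: "F \<in> completion A \<phi> \<Longrightarrow> \<exists>C. bounded_by C F"
  unfolding completion_def by blast

lemma completion_cauchy:
  "F \<in> completion A \<phi> \<Longrightarrow> e > 0 \<Longrightarrow> \<exists>K. \<forall>m\<ge>K. \<forall>n\<ge>K. nrm \<phi> (slice m F - slice n F) < e"
  unfolding completion_def by blast

lemma completion_lim:
  assumes F: "F \<in> completion A \<phi>"
  shows "(\<lambda>j. \<phi> (slice j F)) \<longlonglongrightarrow> lim_phi \<phi> F"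
proof -
  have "Cauchy (\<lambda>j. \<phi> (slice j F))"
  proof (rule metric_CauchyI)
    fix e :: real assume "e > 0"
    then obtain K where K: "\<forall>m\<ge>K. \<forall>n\<ge>K. nrm \<phi> (slice m F - slice n F) < e"
      using completion_cauchy[OF F] by blast
    have "dist (\<phi> (slice m F)) (\<phi> (slice n F)) < e" if "m \<ge> K" "n \<ge> K" for m n
    proof -
      have "dist (\<phi> (slice m F)) (\<phi> (slice n F)) = cmod (\<phi> (slice m F - slice n F))"
        using completion_slice[OF F] by (simp only: dist_norm phi_diff)
      also have "\<dots> \<le> nrm \<phi> (slice m F - slice n F)"
        using completion_slice[OF F] by (intro phi_le_nrm diff_in)
      also have "\<dots> < e" using K that by blast
      finally show ?thesis .
    qed
    then show "\<exists>M. \<forall>m\<ge>M. \<forall>n\<ge>M. dist (\<phi> (slice m F)) (\<phi> (slice n F)) < e" by blast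
  qed
  then show ?thesis
    unfolding lim_phi_def using Cauchy_convergent_iff convergent_LIMSEQ_iff by blast
qed

lemma lim_phi_eqI:
  assumes "F \<in> completion A \<phi>" "(\<lambda>j. \<phi> (slice j F)) \<longlonglongrightarrow> c"
  shows "lim_phi \<phi> F = c"
  using LIMSEQ_unique[OF completion_lim[OF assms(1)] assms(2)] .

text \<open>The common argument for sums, products, conjugates and images under W: each is Lipschitz
  in its arguments on slices.\<close>

lemma completionI:
  assumes sl: "\<And>j. slice j H \<in> A" and b: "bounded_by D H"
    and F: "F \<in> completion A \<phi>" and G: "G \<in> completion A \<phi>" and ab: "0 \<le> a" "0 \<le> b"
    and le: "\<And>m n. nrm \<phi> (slice m H - slice n H) \<le>
        a * nrm \<phi> (slice m F - slice n F) + b * nrm \<phi> (slice m G - slice n G)"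
  shows "H \<in> completion A \<phi>"
proof -
  have "\<exists>K. \<forall>m\<ge>K. \<forall>n\<ge>K. nrm \<phi> (slice m H - slice n H) < e" if e: "e > 0" for e
  proof -
    define d where "d = e / (a + b + 1)"
    have d: "d > 0" and d': "(a + b) * d < e"
      using e ab by (auto simp: d_def field_simps)
    obtain K1 where K1: "\<forall>m\<ge>K1. \<forall>n\<ge>K1. nrm \<phi> (slice m F - slice n F) < d"
      using completion_cauchy[OF F d] by blast
    obtain K2 where K2: "\<forall>m\<ge>K2. \<forall>n\<ge>K2. nrm \<phi> (slice m G - slice n G) < d"
      using completion_cauchy[OF G d] by blast
    have "nrm \<phi> (slice m H - slice n H) < e" if mn: "m \<ge> max K1 K2" "n \<ge> max K1 K2" for m n
    proof -
      have "a * nrm \<phi> (slice m F - slice n F) \<le> a * d"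
        using K1 mn ab by (intro mult_left_mono) (auto intro: less_imp_le)
      moreover have "b * nrm \<phi> (slice m G - slice n G) \<le> b * d"
        using K2 mn ab by (intro mult_left_mono) (auto intro: less_imp_le)
      ultimately show ?thesis
        using le[of m n] d' by (simp add: distrib_right)
    qed
    then show ?thesis by blast
  qed
  then show ?thesis unfolding completion_def using sl b by blast
qed

lemma completion_emb:
  assumes f: "f \<in> A"
  shows "emb f \<in> completion A \<phi>"
proof -
  obtain C where "bounded_by C f" using bdd f by blast
  then have "bounded_by C (emb f)" by (rule bounded_by_emb)
  then show ?thesis using f by (auto simp: completion_def)
qed

lemma lim_phi_emb: "f \<in> A \<Longrightarrow> lim_phi \<phi> (emb f) = \<phi> f"
  using completion_emb by (intro lim_phi_eqI) simp_all

lemma completion_add: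
  assumes F: "F \<in> completion A \<phi>" and G: "G \<in> completion A \<phi>"
  shows "F + G \<in> completion A \<phi>"
proof -
  obtain C where C: "bounded_by C F" using completion_bdd[OF F] by blast
  obtain D where D: "bounded_by D G" using completion_bdd[OF G] by blast
  note sl [simp] = completion_slice[OF F] completion_slice[OF G]
  have "nrm \<phi> (slice m (F + G) - slice n (F + G)) \<le>
      1 * nrm \<phi> (slice m F - slice n F) + 1 * nrm \<phi> (slice m G - slice n G)" for m n
    using nrm_triangle[of "slice m F - slice n F" "slice m G - slice n G"] by (simp add: algebra_simps)
  then show ?thesis
    by (intro completionI[where a = 1 and b = 1, OF _ bounded_by_add[OF C D] F G]) simp_all
qed

lemma completion_mult:
  assumes F: "F \<in> completion A \<phi>" and G: "G \<in> completion A \<phi>"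
  shows "F * G \<in> completion A \<phi>"
proof -
  obtain C where C: "bounded_by C F" using completion_bdd[OF F] by blast
  obtain D where D: "bounded_by D G" using completion_bdd[OF G] by blast
  note sl [simp] = completion_slice[OF F] completion_slice[OF G]
  have "nrm \<phi> (slice m (F * G) - slice n (F * G)) \<le>
      D * nrm \<phi> (slice m F - slice n F) + C * nrm \<phi> (slice m G - slice n G)" for m n
  proof -
    have eq: "slice m (F * G) - slice n (F * G) =
        slice m G * (slice m F - slice n F) + slice n F * (slice m G - slice n G)"
      by (simp add: algebra_simps)
    show ?thesis unfolding eq
      by (intro order_trans[OF nrm_triangle] add_mono nrm_mult_le bounded_by_slice C D) simp_all
  qed
  then show ?thesis
    using bounded_by_nonneg[OF C] bounded_by_nonneg[OF D]
    by (intro completionI[where a = D and b = C, OF _ bounded_by_mult[OF C D] F G]) simp_all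
qed

lemma completion_cj:
  assumes F: "F \<in> completion A \<phi>"
  shows "cj F \<in> completion A \<phi>"
proof -
  obtain C where C: "bounded_by C F" using completion_bdd[OF F] by blast
  note sl [simp] = completion_slice[OF F]
  have eq: "slice m (cj F) - slice n (cj F) = cj (slice m F - slice n F)" for m n by simp
  have "nrm \<phi> (slice m (cj F) - slice n (cj F)) \<le>
      1 * nrm \<phi> (slice m F - slice n F) + 0 * nrm \<phi> (slice m F - slice n F)" for m n
    unfolding eq by (simp del: cj_diff)
  then show ?thesis
    using C by (intro completionI[where a = 1 and b = 0 and D = C, OF _ _ F F]) simp_all
qed

lemma completion_cst: "cst c \<in> completion A \<phi>"
  using completion_emb[OF cst_in] by simp

lemma funalg_completion: "funalg (completion A \<phi>) (lim_phi \<phi>)"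
proof
  fix F G c
  assume F: "F \<in> completion A \<phi>"
  note [simp] = completion_slice[OF F]
  show "cj F \<in> completion A \<phi>" using F by (rule completion_cj)
  show "\<exists>C. bounded_by C F" using F by (rule completion_bdd)
  show "lim_phi \<phi> (cst c * F) = c * lim_phi \<phi> F"
    using F tendsto_mult_left[OF completion_lim[OF F], of c]
    by (intro lim_phi_eqI completion_mult completion_cst) (simp_all add: phi_scale)
  show "lim_phi \<phi> (cj F) = cnj (lim_phi \<phi> F)"
    using F tendsto_cnj[OF completion_lim[OF F]]
    by (intro lim_phi_eqI completion_cj) (simp_all add: phi_cj)
  show "0 \<le> Re (lim_phi \<phi> F)" if "\<And>x. Im (F x) = 0 \<and> 0 \<le> Re (F x)"
  proof -
    have "0 \<le> Re (\<phi> (slice n F))" for n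
      by (rule phi_pos[OF completion_slice[OF F]]) (simp add: slice_def that)
    then show ?thesis
      by (intro LIMSEQ_le_const[OF tendsto_Re[OF completion_lim[OF F]]]) blast
  qed
  assume G: "G \<in> completion A \<phi>"
  note [simp] = completion_slice[OF G]
  show "F + G \<in> completion A \<phi>" using F G by (rule completion_add)
  show "F * G \<in> completion A \<phi>" using F G by (rule completion_mult)
  show "lim_phi \<phi> (F + G) = lim_phi \<phi> F + lim_phi \<phi> G"
    using F G tendsto_add[OF completion_lim[OF F] completion_lim[OF G]]
    by (intro lim_phi_eqI completion_add) (simp_all add: phi_add)
next
  show "cst c \<in> completion A \<phi>" for c by (rule completion_cst)
  show "lim_phi \<phi> 1 = 1"
    using lim_phi_emb[OF one_in] by (simp add: phi_one)
qed

interpretation C: funalg "completion A \<phi>" "lim_phi \<phi>" by (rule funalg_completion)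

lemma completion_nrm_lim:
  assumes F: "F \<in> completion A \<phi>"
  shows "(\<lambda>j. nrm \<phi> (slice j F)) \<longlonglongrightarrow> nrm (lim_phi \<phi>) F"
  unfolding nrm_def
  using tendsto_real_sqrt[OF tendsto_Re[OF completion_lim[OF completion_mult[OF F completion_cj[OF F]]]]]
  by simp

lemma completion_dense:
  assumes F: "F \<in> completion A \<phi>"
  shows "(\<lambda>j. nrm (lim_phi \<phi>) (emb (slice j F) - F)) \<longlonglongrightarrow> 0"
proof (rule LIMSEQ_I)
  fix e :: real assume e: "e > 0"
  then obtain K where K: "\<forall>m\<ge>K. \<forall>n\<ge>K. nrm \<phi> (slice m F - slice n F) < e / 2"
    using completion_cauchy[OF F, of "e/2"] by auto
  have "norm (nrm (lim_phi \<phi>) (emb (slice j F) - F) - 0) < e" if j: "j \<ge> K" for j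
  proof -
    have in1: "emb (slice j F) - F \<in> completion A \<phi>"
      using completion_emb[OF completion_slice[OF F]] F by simp
    have "nrm (lim_phi \<phi>) (emb (slice j F) - F) \<le> e / 2"
    proof (rule LIMSEQ_le_const2[OF completion_nrm_lim[OF in1]])
      show "\<exists>N. \<forall>n\<ge>N. nrm \<phi> (slice n (emb (slice j F) - F)) \<le> e / 2"
        using K j by (auto intro!: exI[of _ K] less_imp_le)
    qed
    then show ?thesis using e C.nrm_nonneg[OF in1] by simp
  qed
  then show "\<exists>no. \<forall>n\<ge>no. norm (nrm (lim_phi \<phi>) (emb (slice n F) - F) - 0) < e" by blast
qed

text \<open>A diagonal argument: slice i of the limit is a slice of \<open>F i\<close> taken so late
  that \<open>F i\<close> varies by less than \<open>1 / Suc i\<close> from there on. The bound C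
  passes to the limit because it holds on every slice.\<close>

lemma seq_complete_completion: "seq_complete (completion A \<phi>) (lim_phi \<phi>)"
  unfolding seq_complete_def
proof (intro allI impI, elim conjE)
  fix F :: "nat \<Rightarrow> 'a om \<Rightarrow> complex" and C
  assume FC: "\<forall>n. F n \<in> completion A \<phi> \<and> bounded_by C (F n)"
    and cau: "\<forall>e>0. \<exists>K. \<forall>m\<ge>K. \<forall>n\<ge>K. nrm (lim_phi \<phi>) (F m - F n) < e"
  have F [simp]: "F n \<in> completion A \<phi>" and FB: "bounded_by C (F n)" for n using FC by auto
  note sl [simp] = completion_slice[OF F]
  have "\<exists>K. \<forall>m\<ge>K. \<forall>n\<ge>K. nrm \<phi> (slice m (F i) - slice n (F i)) < 1 / Suc i" for i
    by (rule completion_cauchy[OF F]) simp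
  then obtain k where k: "\<And>i m n. m \<ge> k i \<Longrightarrow> n \<ge> k i \<Longrightarrow> nrm \<phi> (slice m (F i) - slice n (F i)) < 1 / Suc i"
    by metis
  define H where "H w = F (hd_om w) (ext (k (hd_om w)) (tl_om w))" for w
  have slH: "slice i H = slice (k i) (F i)" for i
    by (simp add: slice_def H_def)
  have HB: "bounded_by C H"
    by (rule bounded_by_sliceI) (simp add: slH bounded_by_slice FB)
  \<comment> \<open>Both slices are compared with slice m of the same functions; as m grows, the
    remaining term becomes the norm of \<open>F i - F l\<close> in the completion.\<close>
  have close: "nrm \<phi> (slice (k i) (F i) - slice (k l) (F l)) \<le> 1 / Suc i + 1 / Suc l + nrm (lim_phi \<phi>) (F i - F l)" for i l
  proof -
    have "(\<lambda>m. 1 / Suc i + 1 / Suc l + nrm \<phi> (slice m (F i - F l))) \<longlonglongrightarrow>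
        1 / Suc i + 1 / Suc l + nrm (lim_phi \<phi>) (F i - F l)"
      by (intro tendsto_intros completion_nrm_lim) simp
    then show ?thesis
    proof (rule tendsto_lowerbound)
      show "\<forall>\<^sub>F m in sequentially. nrm \<phi> (slice (k i) (F i) - slice (k l) (F l)) \<le>
          1 / Suc i + 1 / Suc l + nrm \<phi> (slice m (F i - F l))"
        using eventually_ge_at_top[of "max (k i) (k l)"]
      proof eventually_elim
        case (elim m)
        have eq: "slice (k i) (F i) - slice (k l) (F l) = (slice (k i) (F i) - slice m (F i)) +
            (slice m (F l) - slice (k l) (F l)) + slice m (F i - F l)" by simp
        have "nrm \<phi> (slice (k i) (F i) - slice (k l) (F l)) \<le> nrm \<phi> (slice (k i) (F i) - slice m (F i)) +
            nrm \<phi> (slice m (F l) - slice (k l) (F l)) + nrm \<phi> (slice m (F i - F l))"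
          unfolding eq by (rule nrm_triangle3) simp_all
        then show ?case using k[of i "k i" m] k[of l m "k l"] elim by linarith
      qed
    qed simp
  qed
  have inv: "\<exists>K. \<forall>i\<ge>K. 1 / real (Suc i) < e" if "e > 0" for e :: real
    using order_tendstoD(2)[OF LIMSEQ_inverse_real_of_nat that]
    by (auto simp: eventually_sequentially inverse_eq_divide)
  have small: "\<exists>K. \<forall>i\<ge>K. \<forall>l\<ge>K. 1 / real (Suc i) + 1 / real (Suc l) + nrm (lim_phi \<phi>) (F i - F l) < e" if e: "e > 0" for e
  proof -
    obtain K1 where K1: "\<forall>i\<ge>K1. 1 / real (Suc i) < e / 3" using inv[of "e/3"] e by auto
    obtain K2 where K2: "\<forall>m\<ge>K2. \<forall>n\<ge>K2. nrm (lim_phi \<phi>) (F m - F n) < e / 3" using cau e by (meson divide_pos_pos zero_less_numeral)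
    have "1 / real (Suc i) + 1 / real (Suc l) + nrm (lim_phi \<phi>) (F i - F l) < e" if "i \<ge> max K1 K2" "l \<ge> max K1 K2" for i l
    proof -
      have "1 / real (Suc i) < e / 3" "1 / real (Suc l) < e / 3" "nrm (lim_phi \<phi>) (F i - F l) < e / 3"
        using K1 K2 that by auto
      then show ?thesis by linarith
    qed
    then show ?thesis by blast
  qed
  have H: "H \<in> completion A \<phi>"
  proof -
    have "\<exists>K. \<forall>m\<ge>K. \<forall>n\<ge>K. nrm \<phi> (slice m H - slice n H) < e" if "e > 0" for e
      unfolding slH using small[OF that] order_le_less_trans[OF close] by blast
    then show ?thesis using HB unfolding completion_def by (auto simp: slH)
  qed
  have "(\<lambda>i. nrm (lim_phi \<phi>) (F i - H)) \<longlonglongrightarrow> 0"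
  proof (rule LIMSEQ_I)
    fix e :: real assume e: "e > 0"
    obtain K1 where K1: "\<forall>i\<ge>K1. 1 / real (Suc i) < e / 4" using inv[of "e/4"] e by auto
    obtain K2 where K2: "\<forall>i\<ge>K2. \<forall>l\<ge>K2. 1 / real (Suc i) + 1 / real (Suc l) + nrm (lim_phi \<phi>) (F i - F l) < e / 4"
      using small[of "e/4"] e by auto
    have "norm (nrm (lim_phi \<phi>) (F i - H) - 0) < e" if i: "i \<ge> max K1 K2" for i
    proof -
      have "nrm (lim_phi \<phi>) (F i - H) \<le> e / 2"
      proof (rule LIMSEQ_le_const2[OF completion_nrm_lim])
        show "F i - H \<in> completion A \<phi>" using H by simp
        have "nrm \<phi> (slice m (F i - H)) \<le> e / 2" if m: "m \<ge> max K2 (k i)" for m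
        proof -
          have "nrm \<phi> (slice m (F i - H)) \<le> nrm \<phi> (slice m (F i) - slice (k i) (F i)) +
              nrm \<phi> (slice (k i) (F i) - slice (k m) (F m))"
            unfolding slice_diff slH by (rule nrm_triangle_diff) simp_all
          moreover have "nrm \<phi> (slice m (F i) - slice (k i) (F i)) < 1 / Suc i" using m by (intro k) auto
          moreover have "1 / real (Suc i) < e / 4" using K1 i by auto
          moreover have "nrm \<phi> (slice (k i) (F i) - slice (k m) (F m)) < e / 4"
            using K2 i m by (intro order_le_less_trans[OF close]) auto
          ultimately show ?thesis by linarith
        qed
        then show "\<exists>N. \<forall>n\<ge>N. nrm \<phi> (slice n (F i - H)) \<le> e / 2" by blast
      qed
      then show ?thesis using e C.nrm_nonneg[of "F i - H"] H by simp
    qed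
    then show "\<exists>no. \<forall>n\<ge>no. norm (nrm (lim_phi \<phi>) (F n - H) - 0) < e" by blast
  qed
  then show "\<exists>f\<in>completion A \<phi>. bounded_by C f \<and> (\<lambda>n. nrm (lim_phi \<phi>) (F n - f)) \<longlonglongrightarrow> 0"
    using H HB by blast
qed

lemma dyn_completion:
  assumes W: "dyn A \<phi> W"
  shows "dyn (completion A \<phi>) (lim_phi \<phi>) (lift 0 W)"
proof -
  interpret W: dyn A \<phi> W by (rule W)
  have in': "pull (lift 0 W) 1 F \<in> completion A \<phi>" if F: "F \<in> completion A \<phi>" for F
  proof -
    obtain C where C: "bounded_by C F" using completion_bdd[OF F] by blast
    have eq: "slice m (pull (lift 0 W) 1 F) - slice n (pull (lift 0 W) 1 F) =
        pull W 1 (slice m F - slice n F)" for m n by simp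
    have "nrm \<phi> (slice m (pull (lift 0 W) 1 F) - slice n (pull (lift 0 W) 1 F)) =
        nrm \<phi> (slice m F - slice n F)" for m n
      unfolding eq using completion_slice[OF F] by (intro W.nrm_pull diff_in)
    note iso = this
    show ?thesis
    proof (rule completionI[where a = 1 and b = 0 and D = C, OF _ _ F F])
      show "slice j (pull (lift 0 W) 1 F) \<in> A" for j
        unfolding slice_pull using completion_slice[OF F] by (rule W.pull_in)
    qed (rule bounded_by_pull[OF C], simp, simp, unfold iso, simp)
  qed
  have "lim_phi \<phi> (pull (lift 0 W) 1 F) = lim_phi \<phi> F" if F: "F \<in> completion A \<phi>" for F
    using in'[OF F] completion_lim[OF F] completion_slice[OF F] by (intro lim_phi_eqI) simp_all
  then show ?thesis
    using funalg_completion in' by (simp add: dyn_def dyn_axioms_def)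
qed

end

section \<open>The relative square as a complete system\<close>

definition square where
  "square A \<phi> T = completion (tensors A T) (mean_phi \<phi>)"

definition sq_phi where
  "sq_phi \<phi> = lim_phi (mean_phi \<phi>)"

text \<open>Each square adds two coordinates, the index of the tensor slices and outside it the
  index of the Cauchy sequence. Only the former is shifted.\<close>

definition sq_lift where
  "sq_lift s W = lift 0 (lift s W)"

definition sq_tensor where
  "sq_tensor T f g = emb (tensor T f g)"

lemma sq_tensor_mult: "sq_tensor T (f * f') (g * g') = sq_tensor T f g * sq_tensor T f' g'"
  by (simp add: sq_tensor_def tensor_mult)

lemma cj_sq_tensor: "cj (sq_tensor T f g) = sq_tensor T (cj f) (cj g)"
  by (simp add: sq_tensor_def cj_tensor flip: emb_cj)

lemma sq_tensor_1 [simp]: "sq_tensor T 1 1 = 1"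
  by (simp add: sq_tensor_def)

lemma sq_tensor_cst: "sq_tensor T (cst c * f) g = cst c * sq_tensor T f g"
  by (simp add: sq_tensor_def tensor_cst)

lemma sq_tensor_prod: "sq_tensor T (\<Prod>i\<in>I. f i) (\<Prod>i\<in>I. g i) = (\<Prod>i\<in>I. sq_tensor T (f i) (g i))"
  by (induction I rule: infinite_finite_induct) (simp_all only: prod.infinite prod.empty prod.insert sq_tensor_1 sq_tensor_mult not_False_eq_True)

lemma pull_sq_tensor:
  assumes "W \<circ> T = T \<circ> W"
  shows "pull (sq_lift s W) m (sq_tensor T f g) = sq_tensor T (pull W m f) (pull W m (pull T (s * m) g))"
  by (simp add: sq_tensor_def sq_lift_def pull_tensor[OF assms])

lemma pull_sq_tensor_T:
  "pull (sq_lift 0 T) m (sq_tensor T f g) = sq_tensor T (pull T m f) (pull T m g)"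
  by (simp add: pull_sq_tensor)

lemma sq_lift_commute:
  assumes "W \<circ> T = T \<circ> W"
  shows "sq_lift s W \<circ> sq_lift 0 T = sq_lift 0 T \<circ> sq_lift s W"
proof
  have "W (T x) = T (W x)" for x using fun_cong[OF assms, of x] by simp
  then show "(sq_lift s W \<circ> sq_lift 0 T) x = (sq_lift 0 T \<circ> sq_lift s W) x" for x
    by (simp add: sq_lift_def lift_def)
qed

lemma bounded_by_sq_tensor:
  assumes "bounded_by C f" "bounded_by D g"
  shows "bounded_by (C * D) (sq_tensor T f g)"
proof -
  have "bounded_by (C * D) (slice n (tensor T f g))" for n
    unfolding slice_tensor by (intro bounded_by_mult bounded_by_pull assms)
  then show ?thesis
    unfolding sq_tensor_def by (intro bounded_by_emb) (rule bounded_by_sliceI)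
qed

lemma bounded_by_sq_tensor1: "bounded_by 1 f \<Longrightarrow> bounded_by 1 g \<Longrightarrow> bounded_by 1 (sq_tensor T f g)"
  using bounded_by_sq_tensor[of 1 f 1 g] by simp

context funalg
begin

lemma phi_null: "nrm \<phi> d = 0 \<Longrightarrow> d \<in> A \<Longrightarrow> h \<in> A \<Longrightarrow> \<phi> (h * d) = 0"
  using cauchy_schwarz[of h d] by simp

end

context dyn
begin

lemma eigen_pow:
  assumes w: "cmod w = 1" and p: "p \<in> A" and e: "nrm \<phi> (cst w * pull T 1 p - p) = 0"
  shows "nrm \<phi> (cst (w ^ n) * pull T n p - p) = 0"
proof (induction n)
  case (Suc n)
  have eq: "cst (w ^ Suc n) * pull T (Suc n) p - cst (w ^ n) * pull T n p =
      cst (w ^ n) * pull T n (cst w * pull T 1 p - p)"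
    by (simp add: cst_mult algebra_simps)
  have "nrm \<phi> (cst (w ^ Suc n) * pull T (Suc n) p - cst (w ^ n) * pull T n p) = 0"
    unfolding eq using p e by (simp only: nrm_cst_mult pull_in diff_in mult_in cst_in nrm_pull mult_zero_right)
  moreover have "nrm \<phi> (cst (w ^ Suc n) * pull T (Suc n) p - p) \<le>
      nrm \<phi> (cst (w ^ Suc n) * pull T (Suc n) p - cst (w ^ n) * pull T n p) +
      nrm \<phi> (cst (w ^ n) * pull T n p - p)"
    using p by (intro nrm_triangle_diff mult_in pull_in cst_in)
  moreover have "0 \<le> nrm \<phi> (cst (w ^ Suc n) * pull T (Suc n) p - p)"
    using p by (intro nrm_nonneg diff_in mult_in pull_in cst_in)
  ultimately show ?case using Suc by linarith
qed (use p in simp)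

lemma phi_eigen:
  assumes "cmod w = 1" "p \<in> A" "nrm \<phi> (cst w * pull T 1 p - p) = 0" "h \<in> A"
  shows "\<phi> (h * (cst (w ^ n) * pull T n p)) = \<phi> (h * p)"
  using phi_null[OF eigen_pow[OF assms(1-3)] _ assms(4)] assms
  by (simp add: right_diff_distrib phi_diff)

end

section \<open>The invariant projection and conditional expectation on the first factor\<close>

context
  fixes A :: "('a om \<Rightarrow> complex) set" and \<phi> T
  assumes S: "sys A \<phi> T"
begin

interpretation sys A \<phi> T by (rule S)
interpretation P: dyn "tensors A T" "mean_phi \<phi>" "lift 0 T"
  by (rule dyn_tensors[OF S]) (unfold_locales, simp)

lemma sys_square: "sys (square A \<phi> T) (sq_phi \<phi>) (sq_lift 0 T)"
  unfolding square_def sq_phi_def sq_lift_def sys_def sys_axioms_def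
  by (intro conjI dyn_completion P.dyn_axioms seq_complete_completion P.funalg_axioms)

lemma dyn_square:
  assumes "dyn A \<phi> W" "W \<circ> T = T \<circ> W"
  shows "dyn (square A \<phi> T) (sq_phi \<phi>) (sq_lift s W)"
  unfolding square_def sq_phi_def sq_lift_def
  by (intro dyn_completion P.funalg_axioms dyn_tensors[OF S] assms)

interpretation J: sys "square A \<phi> T" "sq_phi \<phi>" "sq_lift 0 T" by (rule sys_square)

lemma sq_tensor_in: "f \<in> A \<Longrightarrow> g \<in> A \<Longrightarrow> sq_tensor T f g \<in> square A \<phi> T"
  unfolding sq_tensor_def square_def by (intro completion_emb P.funalg_axioms tensorI)

lemma sq_tensor_lim:
  assumes "f \<in> A" "g \<in> A"
  shows "(\<lambda>N. (\<Sum>n<N. \<phi> (f * pull T n g)) / of_nat N) \<longlonglongrightarrow> sq_phi \<phi> (sq_tensor T f g)"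
  using mean_phi_lim[OF S tensorI[OF assms]]
  by (simp add: sq_phi_def sq_tensor_def lim_phi_emb[OF P.funalg_axioms tensorI[OF assms]])

lemma sq_phi_emb1: "f \<in> A \<Longrightarrow> sq_phi \<phi> (sq_tensor T f 1) = \<phi> f"
proof -
  assume f: "f \<in> A"
  have "(\<lambda>N. (\<Sum>n<N. \<phi> (f * pull T n 1)) / of_nat N) \<longlonglongrightarrow> \<phi> f"
  proof (rule tendsto_eventually)
    show "\<forall>\<^sub>F N in sequentially. (\<Sum>n<N. \<phi> (f * pull T n 1)) / of_nat N = \<phi> f"
      using eventually_gt_at_top[of 0] by eventually_elim simp
  qed
  then show ?thesis using sq_tensor_lim[OF f one_in] LIMSEQ_unique by blast
qed

lemma nrm_sq_tensor1: "f \<in> A \<Longrightarrow> nrm (sq_phi \<phi>) (sq_tensor T f 1) = nrm \<phi> f"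
  using sq_phi_emb1[of "f * cj f"] sq_tensor_mult[of T f "cj f" 1 1] cj_sq_tensor[of T f 1]
  by (simp add: nrm_def)

text \<open>\<open>q\<close> is the projection of f to the invariant functions, and the formula for
  \<open>sq_phi\<close> says that this projection is self-adjoint: with p the projection of g,
  \<open>\<phi> (f * p) = \<phi> (q * p) = \<phi> (q * g)\<close>. These are the facts labelled 1, 2
  and 3.\<close>

lemma invariant_part:
  assumes f: "f \<in> A"
  obtains q where "q \<in> A" "(\<lambda>N. nrm \<phi> (tavg T 1 N f - q)) \<longlonglongrightarrow> 0"
    "\<forall>g\<in>A. sq_phi \<phi> (sq_tensor T f g) = \<phi> (q * g)"
    "sq_phi \<phi> (sq_tensor T f (cj f)) = of_real ((nrm \<phi> q)\<^sup>2)"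
proof -
  obtain q where q: "q \<in> A" and ql: "(\<lambda>N. nrm \<phi> (tavg T 1 N f - q)) \<longlonglongrightarrow> 0"
    and qi: "nrm \<phi> (cst 1 * pull T 1 q - q) = 0"
    using tavg_limit[of 1 f] f by auto
  \<comment> \<open>Pairing with an invariant function does not notice the averaging.\<close>
  have avgl: "\<phi> (tavg T 1 N f * p) = \<phi> (f * p)"
    if p: "p \<in> A" "nrm \<phi> (cst 1 * pull T 1 p - p) = 0" and f: "f \<in> A" and N: "N > 0" for f p N
  proof -
    have "\<phi> (pull T n f * p) = \<phi> (f * p)" for n
    proof -
      have "\<phi> (pull T n f * (cst (1 ^ n) * pull T n p)) = \<phi> (pull T n f * p)"
        using p f by (intro phi_eigen) auto
      moreover have "pull T n f * (cst (1 ^ n) * pull T n p) = pull T n (f * p)" by simp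
      ultimately show ?thesis using p f by (metis mult_in phi_pull)
    qed
    then show ?thesis
      using p f N by (simp add: tavg_def mult.commute[of _ p] mult_avg phi_avg)
  qed
  have sym: "sq_phi \<phi> (sq_tensor T f g) = \<phi> (q * g)" if g: "g \<in> A" for g
  proof -
    obtain p where p: "p \<in> A" and pl: "(\<lambda>N. nrm \<phi> (tavg T 1 N g - p)) \<longlonglongrightarrow> 0"
      and pinv: "nrm \<phi> (cst 1 * pull T 1 p - p) = 0"
      using tavg_limit[of 1 g] g by auto
    have "(\<lambda>N. \<phi> (f * tavg T 1 N g)) \<longlonglongrightarrow> \<phi> (f * p)"
      using f g p by (intro phi_tendsto pl) auto
    then have "(\<lambda>N. (\<Sum>n<N. \<phi> (f * pull T n g)) / of_nat N) \<longlonglongrightarrow> \<phi> (f * p)"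
      using f g by (simp add: tavg_def mult_avg phi_avg)
    then have 1: "sq_phi \<phi> (sq_tensor T f g) = \<phi> (f * p)"
      using sq_tensor_lim[OF f g] LIMSEQ_unique by blast
    have e: "eventually (\<lambda>N::nat. N > 0) sequentially" by (rule eventually_gt_at_top)
    have "(\<lambda>N. \<phi> (p * tavg T 1 N f)) \<longlonglongrightarrow> \<phi> (p * q)"
      using f q p by (intro phi_tendsto ql) auto
    moreover have "(\<lambda>N. \<phi> (p * tavg T 1 N f)) \<longlonglongrightarrow> \<phi> (f * p)"
      using e by (intro tendsto_eventually, elim eventually_mono)
        (use avgl[OF p pinv f] in \<open>simp add: mult.commute[of p]\<close>)
    ultimately have 2: "\<phi> (p * q) = \<phi> (f * p)" using LIMSEQ_unique by blast
    have "(\<lambda>N. \<phi> (q * tavg T 1 N g)) \<longlonglongrightarrow> \<phi> (q * p)"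
      using g q p by (intro phi_tendsto pl) auto
    moreover have "(\<lambda>N. \<phi> (q * tavg T 1 N g)) \<longlonglongrightarrow> \<phi> (g * q)"
      using e by (intro tendsto_eventually, elim eventually_mono)
        (use avgl[OF q qi g] in \<open>simp add: mult.commute[of q]\<close>)
    ultimately have 3: "\<phi> (q * p) = \<phi> (g * q)" using LIMSEQ_unique by blast
    show ?thesis using 1 2 3 by (simp add: mult.commute)
  qed
  have cq: "nrm \<phi> (cst 1 * pull T 1 (cj q) - cj q) = 0"
    using qi nrm_cj[of "cst 1 * pull T 1 q - q"] by simp
  have e: "eventually (\<lambda>N::nat. N > 0) sequentially" by (rule eventually_gt_at_top)
  have "(\<lambda>N. \<phi> (cj q * tavg T 1 N f)) \<longlonglongrightarrow> \<phi> (cj q * q)"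
    using f q by (intro phi_tendsto ql) auto
  moreover have "(\<lambda>N. \<phi> (cj q * tavg T 1 N f)) \<longlonglongrightarrow> \<phi> (f * cj q)"
    using e by (intro tendsto_eventually, elim eventually_mono)
      (use avgl[OF cj_in[OF q] cq f] in \<open>simp add: mult.commute[of "cj q"]\<close>)
  ultimately have "\<phi> (cj q * q) = \<phi> (f * cj q)" using LIMSEQ_unique by blast
  then have fq: "\<phi> (f * cj q) = of_real ((nrm \<phi> q)\<^sup>2)"
    using phi_sq[OF q] by (simp add: mult.commute)
  have "\<phi> (q * cj f) = cnj (\<phi> (f * cj q))"
    using phi_cj[of "f * cj q"] f q by (simp add: mult.commute)
  then have "sq_phi \<phi> (sq_tensor T f (cj f)) = of_real ((nrm \<phi> q)\<^sup>2)"
    using sym[of "cj f"] f fq by simp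
  then show ?thesis using that[OF q ql] sym by blast
qed

text \<open>Cauchy-Schwarz after f has been replaced by its invariant projection. This is the base
  case of the seminorm estimates, since the expression under the root is the first seminorm of f,
  squared.\<close>

lemma sq_tensor_le:
  assumes f: "f \<in> A" and g: "g \<in> A"
  shows "cmod (sq_phi \<phi> (sq_tensor T f g)) \<le> sqrt (Re (sq_phi \<phi> (sq_tensor T f (cj f)))) * nrm \<phi> g"
    and "0 \<le> Re (sq_phi \<phi> (sq_tensor T f (cj f)))"
proof -
  obtain q where q: "q \<in> A" "(\<lambda>N. nrm \<phi> (tavg T 1 N f - q)) \<longlonglongrightarrow> 0"
    "\<forall>g\<in>A. sq_phi \<phi> (sq_tensor T f g) = \<phi> (q * g)"
    "sq_phi \<phi> (sq_tensor T f (cj f)) = of_real ((nrm \<phi> q)\<^sup>2)"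
    by (rule invariant_part[OF f])
  show "cmod (sq_phi \<phi> (sq_tensor T f g)) \<le> sqrt (Re (sq_phi \<phi> (sq_tensor T f (cj f)))) * nrm \<phi> g"
    using cauchy_schwarz[OF q(1) g] bspec[OF q(3) g] q(4) q(1) by simp
  show "0 \<le> Re (sq_phi \<phi> (sq_tensor T f (cj f)))"
    unfolding q(4) by simp
qed

text \<open>Tensors span a dense subspace, and the uniform norm bound on \<open>X N\<close> carries
  the limit over to K. The version for sequences is needed because the functions tested later are
  averages of growing length.\<close>

lemma square_dense_tendsto:
  assumes X: "\<And>N. X N \<in> square A \<phi> T" and b: "\<And>N. nrm (sq_phi \<phi>) (X N) \<le> C"
    and K: "K \<in> square A \<phi> T"
    and lim: "\<And>a b. a \<in> A \<Longrightarrow> b \<in> A \<Longrightarrow> (\<lambda>N. sq_phi \<phi> (X N * sq_tensor T a b)) \<longlonglongrightarrow> 0"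
  shows "(\<lambda>N. sq_phi \<phi> (X N * K)) \<longlonglongrightarrow> 0"
proof -
  have embP: "emb P \<in> square A \<phi> T" if "P \<in> tensors A T" for P
    unfolding square_def by (intro completion_emb P.funalg_axioms that)
  have tens: "(\<lambda>N. sq_phi \<phi> (X N * emb P)) \<longlonglongrightarrow> 0" if "P \<in> tensors A T" for P
    using that
  proof (induction rule: tensors_induct)
    case (tensor f g)
    then show ?case using lim unfolding sq_tensor_def by blast
  next
    case (add F G)
    have "sq_phi \<phi> (X N * emb (F + G)) = sq_phi \<phi> (X N * emb F) + sq_phi \<phi> (X N * emb G)" for N
      using X embP add by (simp add: distrib_left J.phi_add)
    then show ?case using tendsto_add[OF add.IH] by simp
  qed
  have C0: "0 \<le> C" using J.nrm_nonneg[OF X] b order_trans by blast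
  show ?thesis
  proof (rule LIMSEQ_I)
    fix e :: real assume e: "e > 0"
    have "e / (2 * (C + 1)) > 0" using e C0 by simp
    then obtain j where j: "nrm (sq_phi \<phi>) (emb (slice j K) - K) < e / (2 * (C + 1))"
      using LIMSEQ_D[OF completion_dense[OF P.funalg_axioms K[unfolded square_def]], folded sq_phi_def]
      by (metis abs_ge_self le_less_trans order_refl real_norm_def diff_zero)
    define P where "P = slice j K"
    have P: "P \<in> tensors A T"
      unfolding P_def using completion_slice[OF P.funalg_axioms K[unfolded square_def]] .
    obtain N0 where N0: "\<And>N. N \<ge> N0 \<Longrightarrow> cmod (sq_phi \<phi> (X N * emb P)) < e / 2"
      using LIMSEQ_D[OF tens[OF P], of "e/2"] e by auto
    have "cmod (sq_phi \<phi> (X N * K)) < e" if N: "N \<ge> N0" for N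
    proof -
      have "sq_phi \<phi> (X N * K) = sq_phi \<phi> (X N * emb P) - sq_phi \<phi> (X N * (emb P - K))"
        using X embP[OF P] K by (simp add: right_diff_distrib J.phi_diff)
      then have "cmod (sq_phi \<phi> (X N * K)) \<le> cmod (sq_phi \<phi> (X N * emb P)) + cmod (sq_phi \<phi> (X N * (emb P - K)))"
        by (simp add: norm_triangle_ineq4)
      also have "cmod (sq_phi \<phi> (X N * (emb P - K))) \<le> nrm (sq_phi \<phi>) (X N) * nrm (sq_phi \<phi>) (emb P - K)"
        using X embP[OF P] K by (intro J.cauchy_schwarz J.diff_in)
      also have "\<dots> \<le> C * (e / (2 * (C + 1)))"
        using b j C0 X embP[OF P] K unfolding P_def[symmetric] by (intro mult_mono) (auto intro!: less_imp_le J.nrm_nonneg)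
      also have "\<dots> \<le> e / 2" using C0 e by (simp add: field_simps)
      finally show ?thesis using N0[OF N] by simp
    qed
    then show "\<exists>no. \<forall>n\<ge>no. norm (sq_phi \<phi> (X n * K) - 0) < e" by auto
  qed
qed

lemma square_dense_zero:
  assumes X: "X \<in> square A \<phi> T" and K: "K \<in> square A \<phi> T"
    and z: "\<And>a b. a \<in> A \<Longrightarrow> b \<in> A \<Longrightarrow> sq_phi \<phi> (X * sq_tensor T a b) = 0"
  shows "sq_phi \<phi> (X * K) = 0"
  using square_dense_tendsto[of "\<lambda>_. X" "nrm (sq_phi \<phi>) X" K] assms by (simp add: LIMSEQ_const_iff)

text \<open>\<open>tensors_conv\<close> gives a limit without the bound C. The averages themselves
  are bounded by C, and completeness yields a limit with the same bound, which makes the conditional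
  expectations of all approximants of a completed function uniformly bounded.\<close>

lemma tensors_fibre_mean:
  assumes P: "P \<in> tensors A T" and C: "bounded_by C P"
  shows "\<exists>e\<in>A. bounded_by C e \<and> (\<lambda>N. nrm \<phi> (avg N (\<lambda>n. slice n P) - e)) \<longlonglongrightarrow> 0"
proof -
  note sl = tensors_slice[OF S P]
  have av: "avg N (\<lambda>n. slice n P) \<in> A" "bounded_by C (avg N (\<lambda>n. slice n P))" for N
    using sl bounded_by_avg[OF bounded_by_slice[OF C] bounded_by_nonneg[OF C]] by simp_all
  obtain e where e: "e \<in> A" "(\<lambda>N. nrm \<phi> (avg N (\<lambda>n. slice n P) - e)) \<longlonglongrightarrow> 0"
    using tensors_conv[OF S P] by blast
  show ?thesis
    using limit_exists[OF av nrm_cauchyI[OF av(1) e]] by blast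
qed

text \<open>Convexity of the squared norm, applied to finite averages of slices before passing to
  the limit.\<close>

lemma fibre_mean_contraction:
  assumes P: "P \<in> tensors A T" and Q: "Q \<in> tensors A T" and d: "d \<in> A" and e: "e \<in> A"
    and dl: "(\<lambda>N. nrm \<phi> (avg N (\<lambda>n. slice n P) - d)) \<longlonglongrightarrow> 0"
    and el: "(\<lambda>N. nrm \<phi> (avg N (\<lambda>n. slice n Q) - e)) \<longlonglongrightarrow> 0"
  shows "nrm \<phi> (d - e) \<le> nrm (mean_phi \<phi>) (P - Q)"
proof -
  note [simp] = tensors_slice[OF S P] tensors_slice[OF S Q]
  define R where "R = P - Q"
  have R: "R \<in> tensors A T" unfolding R_def using P Q by simp
  note [simp] = tensors_slice[OF S R]
  have "(\<lambda>N. nrm \<phi> (avg N (\<lambda>n. slice n P) - d) + nrm \<phi> (avg N (\<lambda>n. slice n Q) - e)) \<longlonglongrightarrow> 0"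
    using tendsto_add_zero[OF dl el] .
  moreover have "nrm \<phi> (avg N (\<lambda>n. slice n R) - (d - e)) \<le>
      nrm \<phi> (avg N (\<lambda>n. slice n P) - d) + nrm \<phi> (avg N (\<lambda>n. slice n Q) - e)" for N
  proof -
    have eq: "avg N (\<lambda>n. slice n R) - (d - e) = (avg N (\<lambda>n. slice n P) - d) - (avg N (\<lambda>n. slice n Q) - e)"
      by (simp add: R_def avg_diff)
    show ?thesis unfolding eq using d e by (intro nrm_diff_le diff_in avg_in) auto
  qed
  ultimately have "(\<lambda>N. nrm \<phi> (avg N (\<lambda>n. slice n R) - (d - e))) \<longlonglongrightarrow> 0"
    using d e by (intro tendsto_0_squeeze[where f = "\<lambda>N. nrm \<phi> (avg N (\<lambda>n. slice n R) - (d - e))"] nrm_nonneg diff_in avg_in) auto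
  then have 1: "(\<lambda>N. (nrm \<phi> (avg N (\<lambda>n. slice n R)))\<^sup>2) \<longlonglongrightarrow> (nrm \<phi> (d - e))\<^sup>2"
    using d e by (intro tendsto_power nrm_tendsto) auto
  have 2: "(\<lambda>N. Re ((\<Sum>n<N. \<phi> (slice n (R * cj R))) / of_nat N)) \<longlonglongrightarrow> Re (mean_phi \<phi> (R * cj R))"
    using R by (intro tendsto_Re mean_phi_lim[OF S]) simp
  have "(nrm \<phi> (d - e))\<^sup>2 \<le> Re (mean_phi \<phi> (R * cj R))"
  proof (rule LIMSEQ_le[OF 1 2], intro exI allI impI)
    fix N
    show "(nrm \<phi> (avg N (\<lambda>n. slice n R)))\<^sup>2 \<le> Re ((\<Sum>n<N. \<phi> (slice n (R * cj R))) / of_nat N)"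
      using nrm_avg_sq_le[of "\<lambda>n. slice n R" N] by (simp add: nrm_sq)
  qed
  then show ?thesis
    using d e R P.nrm_sq[OF R] unfolding R_def[symmetric] by (metis P.nrm_nonneg power2_le_imp_le)
qed

text \<open>\<open>e\<close> is the conditional expectation of F on the first factor, built on the
  approximating tensor sums and extended by contraction. If F is a kernel times a function of the
  second factor, then \<open>e\<close> is the image of that function under the integral operator
  with this kernel.\<close>

lemma fibre_mean:
  assumes F: "F \<in> square A \<phi> T"
  obtains e where "e \<in> A"
    "\<And>v n. v \<in> A \<Longrightarrow> \<phi> (v * pull T n e) = sq_phi \<phi> (sq_tensor T v 1 * pull (sq_lift 0 T) n F)"
proof -
  note F' = F[unfolded square_def]
  obtain C where C: "bounded_by C F" using J.bdd[OF F] by blast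
  note sl = completion_slice[OF P.funalg_axioms F']
  obtain e where e: "\<And>j. e j \<in> A" "\<And>j. bounded_by C (e j)"
    and el: "\<And>j. (\<lambda>N. nrm \<phi> (avg N (\<lambda>n. slice n (slice j F)) - e j)) \<longlonglongrightarrow> 0"
    using tensors_fibre_mean[OF sl bounded_by_slice[OF C]] by metis
  have "nrm \<phi> (e i - e j) \<le> nrm (mean_phi \<phi>) (slice i F - slice j F)" for i j
    by (rule fibre_mean_contraction[OF sl sl e(1) e(1) el el])
  then have "\<exists>K. \<forall>m\<ge>K. \<forall>n\<ge>K. nrm \<phi> (e m - e n) < \<epsilon>" if "\<epsilon> > 0" for \<epsilon>
    using completion_cauchy[OF P.funalg_axioms F' that] le_less_trans by blast
  then obtain c where c: "c \<in> A" and cl: "(\<lambda>j. nrm \<phi> (e j - c)) \<longlonglongrightarrow> 0"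
    using limit_exists[of e C] e by metis
  have "\<phi> (v * pull T n c) = sq_phi \<phi> (sq_tensor T v 1 * pull (sq_lift 0 T) n F)" if v: "v \<in> A" for v n
  proof -
    have pre: "\<phi> (v * pull T n (e j)) = mean_phi \<phi> (tensor T v 1 * pull (lift 0 T) n (slice j F))" for j
    proof -
      have "(\<lambda>N. nrm \<phi> (pull T n (avg N (\<lambda>m. slice m (slice j F))) - pull T n (e j))) \<longlonglongrightarrow> 0"
        unfolding pull_diff[symmetric] using el[of j] e(1) tensors_slice[OF S sl]
        by (simp only: nrm_pull diff_in avg_in)
      then have "(\<lambda>N. \<phi> (v * pull T n (avg N (\<lambda>m. slice m (slice j F))))) \<longlonglongrightarrow> \<phi> (v * pull T n (e j))"
        using v e(1) tensors_slice[OF S sl] by (intro phi_tendsto) auto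
      moreover have "\<phi> (v * pull T n (avg N (\<lambda>m. slice m (slice j F)))) =
          (\<Sum>m<N. \<phi> (slice m (tensor T v 1 * pull (lift 0 T) n (slice j F)))) / of_nat N" for N
        using v tensors_slice[OF S sl] by (simp add: pull_avg mult_avg phi_avg)
      ultimately have lim: "(\<lambda>N. (\<Sum>m<N. \<phi> (slice m (tensor T v 1 * pull (lift 0 T) n (slice j F)))) / of_nat N)
          \<longlonglongrightarrow> \<phi> (v * pull T n (e j))" by simp
      have "tensor T v 1 * pull (lift 0 T) n (slice j F) \<in> tensors A T"
        using sl tensorI[OF v one_in] by (intro P.mult_in P.pull_in)
      from mean_phi_eqI[OF S this lim] show ?thesis by simp
    qed
    have "(\<lambda>j. nrm \<phi> (pull T n (e j) - pull T n c)) \<longlonglongrightarrow> 0"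
      unfolding pull_diff[symmetric] using cl c e(1) by (simp only: nrm_pull diff_in)
    then have 1: "(\<lambda>j. \<phi> (v * pull T n (e j))) \<longlonglongrightarrow> \<phi> (v * pull T n c)"
      using v c e(1) by (intro phi_tendsto) auto
    have "sq_tensor T v 1 * pull (sq_lift 0 T) n F \<in> completion (tensors A T) (mean_phi \<phi>)"
      using J.mult_in[OF sq_tensor_in[OF v one_in] J.pull_in[OF F]] unfolding square_def .
    from completion_lim[OF P.funalg_axioms this]
    have 2: "(\<lambda>j. \<phi> (v * pull T n (e j))) \<longlonglongrightarrow> sq_phi \<phi> (sq_tensor T v 1 * pull (sq_lift 0 T) n F)"
      unfolding pre sq_phi_def by (simp add: sq_tensor_def sq_lift_def)
    show ?thesis using LIMSEQ_unique[OF 1 2] .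
  qed
  then show ?thesis using c by (intro that)
qed

end

lemma pull_id [simp]: "pull id n f = f"
  by (simp add: pull_def)

text \<open>K may be replaced by the equivalent \<open>cst (w ^ n) * pull T n K\<close>. Its
  conjugate cancels the weight, and invariance of \<phi> removes the translation.\<close>

lemma (in dyn) phi_tavg_eigen:
  assumes w: "cmod w = 1" and K: "K \<in> A" "nrm \<phi> (cst w * pull T 1 K - K) = 0"
    and F: "F \<in> A" and N: "N > 0"
  shows "\<phi> (tavg T w N F * cj K) = \<phi> (F * cj K)"
proof -
  have cK: "nrm \<phi> (cst (cnj w) * pull T 1 (cj K) - cj K) = 0"
    using K(2) nrm_cj[of "cst w * pull T 1 K - K"] by simp
  have ww: "w ^ n * cnj w ^ n = 1" for n
    using w by (simp add: complex_norm_square[symmetric] flip: power_mult_distrib)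
  have "\<phi> (cst (w ^ n) * pull T n F * cj K) = \<phi> (F * cj K)" for n
  proof -
    have "\<phi> (cst (w ^ n) * pull T n F * cj K) =
        \<phi> (cst (w ^ n) * pull T n F * (cst (cnj w ^ n) * pull T n (cj K)))"
      using w K F cK by (intro phi_eigen[symmetric]) auto
    also have "cst (w ^ n) * pull T n F * (cst (cnj w ^ n) * pull T n (cj K)) =
        cst (w ^ n * cnj w ^ n) * pull T n (F * cj K)"
      by (simp add: cst_mult mult_ac)
    also have "\<phi> \<dots> = \<phi> (F * cj K)"
      unfolding ww cst_1 mult_1_left using F K by (intro phi_pull mult_in cj_in)
    finally show ?thesis .
  qed
  then show ?thesis
    using F K N by (simp add: tavg_def mult.commute[of _ "cj K"] mult_avg phi_avg)
qed

text \<open>Cauchy-Schwarz; it passes from squared norms of projections to the norms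
  themselves.\<close>

lemma Cesaro_sqrt_null:
  fixes x :: "nat \<Rightarrow> real"
  assumes x: "\<And>n. 0 \<le> x n" and lim: "(\<lambda>N. (\<Sum>n<N. x n) / N) \<longlonglongrightarrow> 0"
  shows "(\<lambda>N. (\<Sum>n<N. sqrt (x n)) / N) \<longlonglongrightarrow> 0"
proof -
  have "(\<Sum>n<N. sqrt (x n)) / N \<le> sqrt ((\<Sum>n<N. x n) / N)" for N
  proof (cases "N = 0")
    case False
    have "(\<Sum>n<N. sqrt (x n))\<^sup>2 \<le> (\<Sum>n<N. (sqrt (x n))\<^sup>2) * N"
      using sum_squared_le_sum_of_squares[of "\<lambda>n. sqrt (x n)" "{..<N}"] by simp
    then have "((\<Sum>n<N. sqrt (x n)) / N)\<^sup>2 \<le> (\<Sum>n<N. x n) / N"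
      using False x by (simp add: field_simps power2_eq_square)
    then show ?thesis by (rule real_le_rsqrt)
  qed simp
  then show ?thesis
    using x tendsto_real_sqrt[OF lim]
    by (rule_tac tendsto_0_squeeze[where g = "\<lambda>N. sqrt ((\<Sum>n<N. x n) / N)"]) (simp_all add: sum_nonneg)
qed

section \<open>Eigenvalues of relative squares\<close>

text \<open>An eigenfunction \<open>K\<close> of the square is viewed as the kernel of an integral operator, with \<open>k\<close> the image
  of some \<open>f\<close>. Since \<open>k \<otimes> cj k\<close> need not be relatively constant, it is projected to an invariant \<open>L\<close>, and \<open>\<kappa>\<close>
  is the image of \<open>k\<close> under the operator with kernel \<open>L\<close>. As \<open>L\<close> is invariant, the ergodic averages of \<open>a \<cdot> T ^ d \<kappa>\<close>
  converge uniformly in \<open>d\<close>, which reduces the averages of \<open>\<kappa> \<otimes> f\<close> to the hypothesis on \<open>A\<close>.\<close>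

theorem no_eigen_square:
  assumes S: "sys A \<phi> T" and w: "cmod w = 1" and ne: "no_eigen A \<phi> T w"
  shows "no_eigen (square A \<phi> T) (sq_phi \<phi>) (sq_lift 0 T) w"
  unfolding no_eigen_def
proof (intro ballI impI, rule ccontr)
  interpret sys A \<phi> T by (rule S)
  define Q where "Q = square A \<phi> T"
  define \<psi> where "\<psi> = sq_phi \<phi>"
  define R where "R = sq_lift 0 T"
  \<comment> \<open>\<open>V\<close> is T on the second factor and the identity on the first. It
    preserves \<psi> and absorbs a difference between the exponents of the two factors.\<close>
  define V :: "'a om \<Rightarrow> 'a om" where "V = sq_lift 1 id"
  interpret J: sys Q \<psi> R unfolding Q_def \<psi>_def R_def by (rule sys_square[OF S])
  interpret V: dyn Q \<psi> V
    unfolding Q_def \<psi>_def V_def by (intro dyn_square[OF S]) (unfold_locales, simp_all)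
  note tt_in [simp] = sq_tensor_in[OF S, folded Q_def]
  have pullR: "pull R m (sq_tensor T f g) = sq_tensor T (pull T m f) (pull T m g)" for m f g
    unfolding R_def by (rule pull_sq_tensor_T)
  have pullV: "pull V m (sq_tensor T f g) = sq_tensor T f (pull T m g)" for m f g
    unfolding V_def by (subst pull_sq_tensor) simp_all
  fix K
  assume K': "K \<in> square A \<phi> T" and
    eig': "nrm (sq_phi \<phi>) (cst w * pull (sq_lift 0 T) 1 K - K) = 0" and
    nz': "nrm (sq_phi \<phi>) K \<noteq> 0"
  note K [simp] = K'[folded Q_def] and eig = eig'[folded \<psi>_def R_def] and nz = nz'[folded \<psi>_def]
  note dense0 = square_dense_zero[OF S, folded Q_def \<psi>_def]
  note dense = square_dense_tendsto[OF S, folded Q_def \<psi>_def]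
  note fib = fibre_mean[OF S, folded Q_def \<psi>_def R_def]
  obtain a0 f where a0: "a0 \<in> A" and f: "f \<in> A" and a0f: "\<psi> (sq_tensor T a0 f * cj K) \<noteq> 0"
  proof -
    have "\<psi> (cj K * K) \<noteq> 0"
      using J.phi_sq[OF K] nz by (simp add: mult.commute)
    then show ?thesis
      using dense0[of "cj K" K] that by (metis J.cj_in K mult.commute)
  qed
  have tt1: "sq_tensor T a b = sq_tensor T a 1 * sq_tensor T 1 b" for a b
    using sq_tensor_mult[of T a 1 1 b] by simp
  obtain k where k: "k \<in> A" and kdef: "\<And>v n. v \<in> A \<Longrightarrow>
      \<phi> (v * pull T n k) = \<psi> (sq_tensor T v 1 * pull R n (K * sq_tensor T 1 (cj f)))"
    using fib[of "K * sq_tensor T 1 (cj f)"] f by auto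
  \<comment> \<open>Pairing with \<open>cj k\<close> on the first factor amounts to pairing with
    \<open>cj K\<close> after tensoring by f, so the eigenfunction can be tested by functions of one
    factor.\<close>
  have hk: "\<phi> (a * cj k) = \<psi> (sq_tensor T a f * cj K)" if a: "a \<in> A" for a
  proof -
    have "\<phi> (a * cj k) = cnj (\<phi> (cj a * pull T 0 k))"
      using phi_cj[of "cj a * k"] a k by simp
    also have "\<phi> (cj a * pull T 0 k) = \<psi> (sq_tensor T (cj a) 1 * pull R 0 (K * sq_tensor T 1 (cj f)))"
      using a by (intro kdef cj_in)
    also have "cnj \<dots> = \<psi> (cj (sq_tensor T (cj a) 1 * pull R 0 (K * sq_tensor T 1 (cj f))))"
      using a f by (intro J.phi_cj[symmetric] J.mult_in J.pull_in tt_in K cj_in one_in)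
    also have "cj (sq_tensor T (cj a) 1 * pull R 0 (K * sq_tensor T 1 (cj f))) = sq_tensor T a f * cj K"
      unfolding tt1[of a f] by (simp add: cj_sq_tensor mult_ac)
    finally show ?thesis .
  qed
  have knz: "nrm \<phi> k \<noteq> 0"
    using hk[OF a0] a0f phi_null[of "cj k" a0] k a0 by auto
  \<comment> \<open>The pairing with \<open>cj K\<close> is unchanged when the tensor is replaced by
    its weighted averages. It therefore vanishes as soon as these averages are weakly null, which by
    density needs to be checked against tensors only.\<close>
  have vanish: "\<psi> (sq_tensor T g f * cj K) = 0"
    if g: "g \<in> A" and lim: "\<And>a b. a \<in> A \<Longrightarrow> b \<in> A \<Longrightarrow>
      (\<lambda>N. \<psi> (tavg R w N (sq_tensor T g f) * sq_tensor T a b)) \<longlonglongrightarrow> 0" for g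
  proof -
    have "(\<lambda>N. \<psi> (tavg R w N (sq_tensor T g f) * cj K)) \<longlonglongrightarrow> 0"
    proof (rule dense[where C = "nrm \<psi> (sq_tensor T g f)"])
      show "nrm \<psi> (tavg R w N (sq_tensor T g f)) \<le> nrm \<psi> (sq_tensor T g f)" for N
        using g f by (intro J.nrm_tavg_le w tt_in)
    qed (use g f lim in \<open>simp_all only: J.tavg_in tt_in J.cj_in K\<close>)
    moreover have "(\<lambda>N. \<psi> (tavg R w N (sq_tensor T g f) * cj K)) \<longlonglongrightarrow> \<psi> (sq_tensor T g f * cj K)"
    proof (rule tendsto_eventually)
      show "\<forall>\<^sub>F N in sequentially. \<psi> (tavg R w N (sq_tensor T g f) * cj K) = \<psi> (sq_tensor T g f * cj K)"
        using eventually_gt_at_top[of 0]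
        by eventually_elim (rule J.phi_tavg_eigen[OF w K eig], use g f in auto)
    qed
    ultimately show ?thesis using LIMSEQ_unique by blast
  qed
  have expand: "\<psi> (tavg R z N (sq_tensor T g h) * sq_tensor T a b) =
      (\<Sum>d<N. z ^ d * \<psi> (sq_tensor T (pull T d g * a) (pull T d h * b))) / N"
    if "g \<in> A" "h \<in> A" "a \<in> A" "b \<in> A" for z N g h a b
    using that by (simp add: tavg_def mult.commute[of _ "sq_tensor T a b"] mult_avg J.phi_avg pullR
        mult.left_commute[of _ "cst c" for c] J.phi_scale sq_tensor_mult[symmetric] mult.commute[of a] mult.commute[of b])
  obtain L where L [simp]: "L \<in> Q" and Ll: "(\<lambda>N. nrm \<psi> (tavg R 1 N (sq_tensor T k (cj k)) - L)) \<longlonglongrightarrow> 0"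
    and Le: "nrm \<psi> (cst 1 * pull R 1 L - L) = 0"
    using J.tavg_limit[of 1 "sq_tensor T k (cj k)"] k by auto
  obtain CL where CL: "bounded_by CL L" using J.bdd[OF L] by blast
  have CL0: "0 \<le> CL" using bounded_by_nonneg[OF CL] .
  have bd: "\<exists>D\<ge>0. \<forall>d. nrm \<phi> (pull T d f * b) \<le> D" if b: "b \<in> A" for b
  proof -
    obtain C where C: "bounded_by C b" using bdd b by blast
    have "nrm \<phi> (pull T d f * b) \<le> C * nrm \<phi> f" for d
      using nrm_mult_le[of "pull T d f" b C] f b C by (simp add: mult.commute)
    then show ?thesis using bounded_by_nonneg[OF C] f by (intro exI[of _ "C * nrm \<phi> f"]) auto
  qed
  \<comment> \<open>\<open>x d\<close> is the squared norm of the invariant projection of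
    \<open>pull T d k * a\<close>. The mean of these numbers tends to the pairing of
    \<open>L\<close> with a tensor. If \<open>L\<close> were null, the mean of the norms would tend
    to 0 too, so \<open>vanish\<close> would apply to k and give
    \<open>\<phi> (k * cj k) = 0\<close>.\<close>
  have Lnz: "nrm \<psi> L \<noteq> 0"
  proof
    assume L0: "nrm \<psi> L = 0"
    have "\<psi> (sq_tensor T k f * cj K) = 0"
    proof (rule vanish[OF k])
      fix a b assume a: "a \<in> A" and b: "b \<in> A"
      define x where "x d = Re (\<psi> (sq_tensor T (pull T d k * a) (cj (pull T d k * a))))" for d
      obtain D where D: "D \<ge> 0" "\<And>d. nrm \<phi> (pull T d f * b) \<le> D" using bd[OF b] by blast
      have x0: "0 \<le> x d" for d
        unfolding x_def \<psi>_def using k a by (intro sq_tensor_le(2)[OF S _ one_in]) auto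
      have le: "cmod (\<psi> (sq_tensor T (pull T d k * a) (pull T d f * b))) \<le> sqrt (x d) * D" for d
      proof -
        have "cmod (\<psi> (sq_tensor T (pull T d k * a) (pull T d f * b))) \<le> sqrt (x d) * nrm \<phi> (pull T d f * b)"
          unfolding x_def \<psi>_def using k a f b by (intro sq_tensor_le(1)[OF S]) auto
        also have "\<dots> \<le> sqrt (x d) * D" using D x0 by (intro mult_left_mono) auto
        finally show ?thesis .
      qed
      have "(\<lambda>N. \<psi> (sq_tensor T a (cj a) * tavg R 1 N (sq_tensor T k (cj k)))) \<longlonglongrightarrow> \<psi> (sq_tensor T a (cj a) * L)"
        using a k by (intro J.phi_tendsto Ll) auto
      moreover have "\<psi> (sq_tensor T a (cj a) * L) = 0"
        using J.phi_null[OF L0 L] a by simp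
      moreover have "\<psi> (sq_tensor T a (cj a) * tavg R 1 N (sq_tensor T k (cj k))) =
          (\<Sum>d<N. \<psi> (sq_tensor T (pull T d k * a) (cj (pull T d k * a)))) / N" for N
        using expand[of k "cj k" a "cj a" 1 N] k a by (simp add: mult.commute)
      ultimately have "(\<lambda>N. Re ((\<Sum>d<N. \<psi> (sq_tensor T (pull T d k * a) (cj (pull T d k * a)))) / N)) \<longlonglongrightarrow> 0"
        using tendsto_Re by fastforce
      then have "(\<lambda>N. (\<Sum>d<N. x d) / N) \<longlonglongrightarrow> 0"
        unfolding x_def by simp
      from tendsto_mult_left_zero[OF Cesaro_sqrt_null[OF x0 this], of D]
      have "(\<lambda>N. (\<Sum>d<N. sqrt (x d)) / N * D) \<longlonglongrightarrow> 0" .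
      then show "(\<lambda>N. \<psi> (tavg R w N (sq_tensor T k f) * sq_tensor T a b)) \<longlonglongrightarrow> 0"
      proof (rule Lim_null_comparison[rotated], intro always_eventually allI)
        fix N
        have "cmod (\<Sum>d<N. w ^ d * \<psi> (sq_tensor T (pull T d k * a) (pull T d f * b))) \<le> (\<Sum>d<N. sqrt (x d) * D)"
          using le w by (intro sum_norm_le) (auto simp: norm_mult norm_power)
        then show "cmod (\<psi> (tavg R w N (sq_tensor T k f) * sq_tensor T a b)) \<le> (\<Sum>d<N. sqrt (x d)) / N * D"
          using expand[OF k f a b, of w N] by (simp add: norm_divide divide_right_mono sum_distrib_right)
      qed
    qed
    then have "\<phi> (k * cj k) = 0" using hk[OF k] by simp
    then show False using phi_sq[OF k] knz by simp
  qed
  obtain \<kappa> where \<kappa>: "\<kappa> \<in> A" and \<kappa>def: "\<And>v n. v \<in> A \<Longrightarrow>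
      \<phi> (v * pull T n \<kappa>) = \<psi> (sq_tensor T v 1 * pull R n (L * sq_tensor T 1 k))"
    using fib[of "L * sq_tensor T 1 k"] k by auto
  \<comment> \<open>As \<open>L\<close> is the projection of \<open>k \<otimes> cj k\<close>,
    pairing the latter with \<open>cj L\<close> gives the squared norm of \<open>L\<close>; the
    definition of \<kappa> turns this number into \<open>\<phi> (\<kappa> * cj k)\<close>.\<close>
  have \<kappa>nz: "\<psi> (sq_tensor T \<kappa> f * cj K) \<noteq> 0"
  proof -
    have "(\<lambda>N. \<psi> (cj L * tavg R 1 N (sq_tensor T k (cj k)))) \<longlonglongrightarrow> \<psi> (cj L * L)"
      using k by (intro J.phi_tendsto Ll) auto
    moreover have "(\<lambda>N. \<psi> (cj L * tavg R 1 N (sq_tensor T k (cj k)))) \<longlonglongrightarrow> \<psi> (sq_tensor T k (cj k) * cj L)"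
    proof (rule tendsto_eventually)
      show "\<forall>\<^sub>F N in sequentially. \<psi> (cj L * tavg R 1 N (sq_tensor T k (cj k))) = \<psi> (sq_tensor T k (cj k) * cj L)"
        using eventually_gt_at_top[of 0]
        by eventually_elim (subst mult.commute, rule J.phi_tavg_eigen[OF _ L Le], use k in auto)
    qed
    ultimately have "\<psi> (sq_tensor T k (cj k) * cj L) = \<psi> (cj L * L)"
      by (rule LIMSEQ_unique[rotated])
    also have "\<dots> = of_real ((nrm \<psi> L)\<^sup>2)"
      unfolding mult.commute[of "cj L"] by (rule J.phi_sq[OF L])
    finally have 1: "\<psi> (sq_tensor T k (cj k) * cj L) = of_real ((nrm \<psi> L)\<^sup>2)" .
    have "\<phi> (\<kappa> * cj k) = \<phi> (cj k * pull T 0 \<kappa>)" by (simp add: mult.commute)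
    also have "\<dots> = \<psi> (sq_tensor T (cj k) 1 * pull R 0 (L * sq_tensor T 1 k))"
      using k by (intro \<kappa>def cj_in)
    also have "sq_tensor T (cj k) 1 * pull R 0 (L * sq_tensor T 1 k) = cj (sq_tensor T k (cj k) * cj L)"
      unfolding tt1[of k "cj k"] by (simp add: cj_sq_tensor mult_ac)
    also have "\<psi> \<dots> = of_real ((nrm \<psi> L)\<^sup>2)"
      using 1 J.phi_cj[of "sq_tensor T k (cj k) * cj L"] k by simp
    finally show ?thesis using hk[OF \<kappa>] Lnz by simp
  qed
  moreover have "\<psi> (sq_tensor T \<kappa> f * cj K) = 0"
  proof (rule vanish[OF \<kappa>])
    fix a b assume a: "a \<in> A" and b: "b \<in> A"
    obtain D where D: "D \<ge> 0" "\<And>d. nrm \<phi> (pull T d f * b) \<le> D" using bd[OF b] by blast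
    define q where "q d = pull T d \<kappa> * a" for d
    define r where "r d = pull T d f * b" for d
    have q [simp]: "q d \<in> A" and r [simp]: "r d \<in> A" for d
      using \<kappa> a f b by (auto simp: q_def r_def)
    \<comment> \<open>Invariance of \<open>L\<close> lets \<open>T ^ (m + d)\<close> act on k alone
      under the kernel. The average of \<open>q d\<close> is thus the image under conditional
      expectation of \<open>L\<close> times a translate by \<open>V ^ d\<close> of averages that do
      not involve d.\<close>
    have av: "\<phi> (v * tavg T 1 M (q d)) = \<psi> (sq_tensor T v 1 * (L * pull V d (tavg R 1 M (sq_tensor T a k))))"
      if v: "v \<in> A" for v M d
    proof -
      have "\<phi> (v * pull T m (q d)) = \<psi> (sq_tensor T v 1 * (L * pull V d (pull R m (sq_tensor T a k))))" for m
      proof -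
        have "\<phi> (v * pull T m (q d)) = \<phi> ((v * pull T m a) * pull T (m + d) \<kappa>)"
          by (simp add: q_def mult_ac)
        also have "\<dots> = \<psi> (sq_tensor T (v * pull T m a) 1 * pull R (m + d) (L * sq_tensor T 1 k))"
          using v a by (intro \<kappa>def) auto
        also have "sq_tensor T (v * pull T m a) 1 * pull R (m + d) (L * sq_tensor T 1 k) =
            sq_tensor T v 1 * sq_tensor T (pull T m a) (pull T (d + m) k) * (cst (1 ^ (m + d)) * pull R (m + d) L)"
          using sq_tensor_mult[of T v "pull T m a" 1 1] tt1[of "pull T m a" "pull T (d + m) k"]
          by (simp add: pullR mult_ac add.commute)
        also have "\<psi> \<dots> = \<psi> (sq_tensor T v 1 * sq_tensor T (pull T m a) (pull T (d + m) k) * L)"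
          using v a k Le by (intro J.phi_eigen) auto
        also have "sq_tensor T (pull T m a) (pull T (d + m) k) = pull V d (pull R m (sq_tensor T a k))"
          by (simp add: pullR pullV)
        finally show ?thesis by (simp add: mult_ac)
      qed
      then show ?thesis
        using v a k by (simp add: tavg_def mult_avg pull_avg phi_avg J.phi_avg)
    qed
    \<comment> \<open>The difference is tested against itself. Since \<open>V ^ d\<close> is an
      isometry and \<open>L\<close> is bounded by \<open>CL\<close>, the estimate is the same for
      all d.\<close>
    have unif: "nrm \<phi> (tavg T 1 M (q d) - tavg T 1 M' (q d)) \<le>
        CL * nrm \<psi> (tavg R 1 M (sq_tensor T a k) - tavg R 1 M' (sq_tensor T a k))" for M M' d
    proof -
      define u where "u = tavg T 1 M (q d) - tavg T 1 M' (q d)"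
      define \<Delta> where "\<Delta> = tavg R 1 M (sq_tensor T a k) - tavg R 1 M' (sq_tensor T a k)"
      have u: "u \<in> A" by (simp add: u_def)
      have \<Delta>: "\<Delta> \<in> Q" using a k by (simp add: \<Delta>_def)
      have eq: "\<phi> (cj u * u) = \<psi> (sq_tensor T (cj u) 1 * (L * pull V d \<Delta>))"
      proof -
        have "\<phi> (cj u * u) = \<phi> (cj u * tavg T 1 M (q d)) - \<phi> (cj u * tavg T 1 M' (q d))"
        proof -
          have "cj u * u = cj u * tavg T 1 M (q d) - cj u * tavg T 1 M' (q d)"
            by (simp only: right_diff_distrib[symmetric]) (simp only: u_def)
          then have "\<phi> (cj u * u) = \<phi> (cj u * tavg T 1 M (q d) - cj u * tavg T 1 M' (q d))"
            by (rule arg_cong)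
          also have "\<dots> = \<phi> (cj u * tavg T 1 M (q d)) - \<phi> (cj u * tavg T 1 M' (q d))"
            using u by (intro phi_diff mult_in cj_in tavg_in q)
          finally show ?thesis .
        qed
        also have "\<dots> = \<psi> (sq_tensor T (cj u) 1 * (L * pull V d \<Delta>))"
          using u a k by (simp add: av \<Delta>_def right_diff_distrib J.phi_diff)
        finally show ?thesis .
      qed
      have "(nrm \<phi> u)\<^sup>2 = cmod (\<phi> (cj u * u))"
        using phi_sq[OF u] by (simp add: mult.commute norm_power)
      also have "\<dots> \<le> nrm \<psi> (sq_tensor T (cj u) 1) * nrm \<psi> (L * pull V d \<Delta>)"
        unfolding eq using u \<Delta> by (intro J.cauchy_schwarz) auto
      also have "\<dots> \<le> nrm \<phi> u * (CL * nrm \<psi> \<Delta>)"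
      proof (rule mult_mono)
        show "nrm \<psi> (sq_tensor T (cj u) 1) \<le> nrm \<phi> u"
          unfolding \<psi>_def using nrm_sq_tensor1[OF S cj_in[OF u]] by simp
        show "nrm \<psi> (L * pull V d \<Delta>) \<le> CL * nrm \<psi> \<Delta>"
          using J.nrm_mult_le[OF V.pull_in[OF \<Delta>] L CL] \<Delta> by simp
      qed (use u \<Delta> in auto)
      finally have "nrm \<phi> u * nrm \<phi> u \<le> nrm \<phi> u * (CL * nrm \<psi> \<Delta>)"
        by (simp add: power2_eq_square)
      moreover have "0 \<le> CL * nrm \<psi> \<Delta>" using CL0 \<Delta> by simp
      ultimately have "nrm \<phi> u \<le> CL * nrm \<psi> \<Delta>"
        using nrm_nonneg[OF u] by (cases "nrm \<phi> u = 0") auto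
      then show ?thesis by (simp add: u_def \<Delta>_def)
    qed
    \<comment> \<open>\<open>\<psi> (sq_tensor T (q d) (r d))\<close> is the limit over M of
      \<open>\<phi> (r d * tavg T 1 M (q d))\<close>; by \<open>unif\<close> one M serves all
      d.\<close>
    have approx: "\<exists>M>0. \<forall>d. cmod (\<psi> (sq_tensor T (q d) (r d)) - \<phi> (r d * tavg T 1 M (q d))) \<le> e" if e: "e > 0" for e
    proof -
      define \<delta> where "\<delta> = e / (CL * D + 1)"
      have CD: "0 \<le> CL * D" using CL0 D by simp
      have \<delta>: "\<delta> > 0" and \<delta>': "CL * \<delta> * D \<le> e" using e CD by (auto simp: \<delta>_def field_simps)
      obtain M where M: "\<forall>m\<ge>M. \<forall>n\<ge>M. nrm \<psi> (tavg R 1 m (sq_tensor T a k) - tavg R 1 n (sq_tensor T a k)) < \<delta>"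
        using J.tavg_cauchy[of 1 "sq_tensor T a k" \<delta>] a k \<delta> by auto
      define M1 where "M1 = Suc M"
      have "cmod (\<psi> (sq_tensor T (q d) (r d)) - \<phi> (r d * tavg T 1 M1 (q d))) \<le> e" for d
      proof -
        obtain p where p: "p \<in> A" "(\<lambda>N. nrm \<phi> (tavg T 1 N (q d) - p)) \<longlonglongrightarrow> 0"
          "\<forall>g\<in>A. sq_phi \<phi> (sq_tensor T (q d) g) = \<phi> (p * g)"
          by (rule invariant_part[OF S q[of d]])
        have "(\<lambda>N. \<phi> (r d * tavg T 1 N (q d))) \<longlonglongrightarrow> \<phi> (r d * p)"
          using p by (intro phi_tendsto) auto
        then have lim: "(\<lambda>N. \<phi> (r d * tavg T 1 N (q d))) \<longlonglongrightarrow> \<psi> (sq_tensor T (q d) (r d))"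
          using p(3) r[of d] unfolding \<psi>_def by (simp add: mult.commute)
        have "cmod (\<phi> (r d * tavg T 1 N (q d)) - \<phi> (r d * tavg T 1 M1 (q d))) \<le> e" if N: "N \<ge> M" for N
        proof -
          have "\<phi> (r d * tavg T 1 N (q d)) - \<phi> (r d * tavg T 1 M1 (q d)) =
              \<phi> (r d * (tavg T 1 N (q d) - tavg T 1 M1 (q d)))"
            by (simp add: right_diff_distrib phi_diff)
          also have "cmod \<dots> \<le> nrm \<phi> (r d) * nrm \<phi> (tavg T 1 N (q d) - tavg T 1 M1 (q d))"
            by (intro cauchy_schwarz) auto
          also have "\<dots> \<le> D * (CL * \<delta>)"
          proof (rule mult_mono)
            have "nrm \<phi> (tavg T 1 N (q d) - tavg T 1 M1 (q d)) \<le>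
                CL * nrm \<psi> (tavg R 1 N (sq_tensor T a k) - tavg R 1 M1 (sq_tensor T a k))" by (rule unif)
            also have "\<dots> \<le> CL * \<delta>"
              using M N CL0 by (intro mult_left_mono) (auto simp: M1_def intro: less_imp_le)
            finally show "nrm \<phi> (tavg T 1 N (q d) - tavg T 1 M1 (q d)) \<le> CL * \<delta>" .
          qed (use D in \<open>auto simp: r_def[symmetric]\<close>)
          also have "\<dots> \<le> e" using \<delta>' by (simp add: mult_ac)
          finally show ?thesis .
        qed
        then show ?thesis
          by (intro LIMSEQ_le_const2[OF tendsto_norm[OF tendsto_diff[OF lim tendsto_const]]]) blast
      qed
      then show ?thesis by (intro exI[of _ M1]) (auto simp: M1_def)
    qed
    \<comment> \<open>For fixed M the inner average is a finite mean over m of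
      \<open>\<phi> ((b * pull T m a) * pull T d (pull T m \<kappa> * f))\<close>. To each term the
      mean ergodic theorem with weight w applies, and its limit is 0 because w is not an eigenvalue
      on A.\<close>
    have small: "(\<lambda>N. (\<Sum>d<N. w ^ d * \<phi> (r d * tavg T 1 M (q d))) / N) \<longlonglongrightarrow> 0" for M
    proof -
      have "(\<lambda>N. \<phi> ((b * pull T m a) * tavg T w N (pull T m \<kappa> * f))) \<longlonglongrightarrow> \<phi> ((b * pull T m a) * 0)" for m
        using no_eigen_tavg[OF w ne, of "pull T m \<kappa> * f"] \<kappa> f a b by (intro phi_tendsto) auto
      then have "(\<lambda>N. \<Sum>m<M. \<phi> ((b * pull T m a) * tavg T w N (pull T m \<kappa> * f))) \<longlonglongrightarrow> (\<Sum>m<M. \<phi> ((b * pull T m a) * 0))"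
        by (rule tendsto_sum)
      then have "(\<lambda>N. (\<Sum>m<M. \<phi> ((b * pull T m a) * tavg T w N (pull T m \<kappa> * f))) / M) \<longlonglongrightarrow> 0"
        by (intro tendsto_divide_zero) simp
      moreover have "(\<Sum>d<N. w ^ d * \<phi> (r d * tavg T 1 M (q d))) / N =
          (\<Sum>m<M. \<phi> ((b * pull T m a) * tavg T w N (pull T m \<kappa> * f))) / M" for N
      proof -
        have "\<phi> (r d * tavg T 1 M (q d)) = (\<Sum>m<M. \<phi> ((b * pull T m a) * pull T d (pull T m \<kappa> * f))) / M" for d
          using a b f \<kappa> by (simp add: tavg_def mult_avg phi_avg r_def q_def mult_ac add.commute)
        moreover have "\<phi> ((b * pull T m a) * tavg T w N (pull T m \<kappa> * f)) =
            (\<Sum>d<N. w ^ d * \<phi> ((b * pull T m a) * pull T d (pull T m \<kappa> * f))) / N" for m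
          using a b f \<kappa> phi_scale[of "(b * pull T m a) * pull T d (pull T m \<kappa> * f)" for d]
          by (simp add: tavg_def mult_avg phi_avg mult.left_commute[of _ "cst c" for c] del: pull_mult pull_pull)
        ultimately show ?thesis
          by (simp add: sum_distrib_left sum_divide_distrib mult.commute del: pull_mult pull_pull) (rule sum.swap)
      qed
      ultimately show ?thesis by simp
    qed
    show "(\<lambda>N. \<psi> (tavg R w N (sq_tensor T \<kappa> f) * sq_tensor T a b)) \<longlonglongrightarrow> 0"
    proof (rule LIMSEQ_I)
      fix e :: real assume e: "e > 0"
      obtain M where M: "\<And>d. cmod (\<psi> (sq_tensor T (q d) (r d)) - \<phi> (r d * tavg T 1 M (q d))) \<le> e / 2"
        using approx[of "e/2"] e by auto
      obtain N0 where N0: "\<And>N. N \<ge> N0 \<Longrightarrow> cmod ((\<Sum>d<N. w ^ d * \<phi> (r d * tavg T 1 M (q d))) / N) < e / 2"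
        using LIMSEQ_D[OF small[of M], of "e/2"] e by auto
      have "cmod (\<psi> (tavg R w N (sq_tensor T \<kappa> f) * sq_tensor T a b)) < e" if N: "N \<ge> N0" for N
      proof -
        have "\<psi> (tavg R w N (sq_tensor T \<kappa> f) * sq_tensor T a b) =
            (\<Sum>d<N. w ^ d * \<psi> (sq_tensor T (q d) (r d))) / N"
          unfolding q_def r_def by (rule expand[OF \<kappa> f a b])
        also have "\<dots> = (\<Sum>d<N. w ^ d * (\<psi> (sq_tensor T (q d) (r d)) - \<phi> (r d * tavg T 1 M (q d)))) / N +
            (\<Sum>d<N. w ^ d * \<phi> (r d * tavg T 1 M (q d))) / N"
          by (simp add: algebra_simps sum_subtractf diff_divide_distrib)
        finally have "cmod (\<psi> (tavg R w N (sq_tensor T \<kappa> f) * sq_tensor T a b)) \<le>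
            cmod ((\<Sum>d<N. w ^ d * (\<psi> (sq_tensor T (q d) (r d)) - \<phi> (r d * tavg T 1 M (q d)))) / N) +
            cmod ((\<Sum>d<N. w ^ d * \<phi> (r d * tavg T 1 M (q d))) / N)"
          by (simp only: norm_triangle_ineq)
        moreover have "cmod ((\<Sum>d<N. w ^ d * (\<psi> (sq_tensor T (q d) (r d)) - \<phi> (r d * tavg T 1 M (q d)))) / N) \<le> e / 2"
        proof -
          have "cmod (\<Sum>d<N. w ^ d * (\<psi> (sq_tensor T (q d) (r d)) - \<phi> (r d * tavg T 1 M (q d)))) \<le> (\<Sum>d<N. e / 2)"
            using M w by (intro sum_norm_le) (auto simp: norm_mult norm_power)
          then show ?thesis using e by (cases "N = 0") (auto simp: norm_divide field_simps)
        qed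
        ultimately show ?thesis using N0[OF N] by linarith
      qed
      then show "\<exists>no. \<forall>n\<ge>no. norm (\<psi> (tavg R w n (sq_tensor T \<kappa> f) * sq_tensor T a b) - 0) < e" by auto
    qed
  qed
  ultimately show False by simp
qed

section \<open>Iterated squares and cubes\<close>

primrec tow_T :: "('a om \<Rightarrow> 'a om) \<Rightarrow> nat \<Rightarrow> 'a om \<Rightarrow> 'a om" where
  "tow_T T 0 = T"
| "tow_T T (Suc j) = sq_lift 0 (tow_T T j)"

primrec tow_phi :: "(('a om \<Rightarrow> complex) \<Rightarrow> complex) \<Rightarrow> nat \<Rightarrow> ('a om \<Rightarrow> complex) \<Rightarrow> complex" where
  "tow_phi \<phi> 0 = \<phi>"
| "tow_phi \<phi> (Suc j) = sq_phi (tow_phi \<phi> j)"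

primrec tow_A :: "('a om \<Rightarrow> complex) set \<Rightarrow> (('a om \<Rightarrow> complex) \<Rightarrow> complex) \<Rightarrow> ('a om \<Rightarrow> 'a om) \<Rightarrow>
    nat \<Rightarrow> ('a om \<Rightarrow> complex) set" where
  "tow_A A \<phi> T 0 = A"
| "tow_A A \<phi> T (Suc j) = square (tow_A A \<phi> T j) (tow_phi \<phi> j) (tow_T T j)"

text \<open>At each doubling the second half receives one further T, so a vertex that lies i times
  in the second half is moved by \<open>T ^ i\<close>.\<close>

primrec tow_W :: "nat \<Rightarrow> 'a om \<Rightarrow> 'a om" where
  "tow_W 0 = id"
| "tow_W (Suc j) = sq_lift 1 (tow_W j)"

primrec cube :: "('a om \<Rightarrow> 'a om) \<Rightarrow> nat \<Rightarrow> ('a om \<Rightarrow> complex) \<Rightarrow> 'a om \<Rightarrow> complex" where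
  "cube T 0 g = g"
| "cube T (Suc j) g = sq_tensor (tow_T T j) (cube T j g) (cj (cube T j g))"

primrec vertex :: "('a om \<Rightarrow> 'a om) \<Rightarrow> nat \<Rightarrow> ('a om \<Rightarrow> complex) \<Rightarrow> 'a om \<Rightarrow> complex" where
  "vertex T 0 g = g"
| "vertex T (Suc j) g = sq_tensor (tow_T T j) (vertex T j g) 1"

text \<open>The usual dual function is the conditional expectation of this product on the first
  vertex; it is never formed, since only pairings with functions of that vertex occur.\<close>

primrec dual :: "('a om \<Rightarrow> 'a om) \<Rightarrow> nat \<Rightarrow> ('a om \<Rightarrow> complex) \<Rightarrow> 'a om \<Rightarrow> complex" where
  "dual T 0 g = 1"
| "dual T (Suc j) g = sq_tensor (tow_T T j) (dual T j g) (cj (cube T j g))"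

text \<open>For positive j this is the \<open>2 ^ j\<close>-th power of the j-th Gowers-Host-Kra
  seminorm; for \<open>j = 0\<close> it is the integral of g.\<close>

definition ghk :: "(('a om \<Rightarrow> complex) \<Rightarrow> complex) \<Rightarrow> ('a om \<Rightarrow> 'a om) \<Rightarrow> nat \<Rightarrow> ('a om \<Rightarrow> complex) \<Rightarrow> complex"
  where "ghk \<phi> T j g = tow_phi \<phi> j (cube T j g)"

lemma cube_vertex_dual: "cube T j g = vertex T j g * dual T j g"
proof (induction j)
  case (Suc j)
  then show ?case
    using sq_tensor_mult[of "tow_T T j" "vertex T j g" "dual T j g" 1 "cj (cube T j g)"] by simp
qed simp

lemma cj_cube: "cj (cube T j g) = cube T j (cj g)"
  by (induction j) (simp_all only: cube.simps cj_sq_tensor)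

lemma cube_mult: "cube T j (f * g) = cube T j f * cube T j g"
  by (induction j) (simp_all only: cube.simps cj_mult sq_tensor_mult)

lemma pull_cube: "pull (tow_T T j) n (cube T j g) = cube T j (pull T n g)"
  by (induction j) (simp_all only: cube.simps tow_T.simps pull_sq_tensor_T pull_cj)

lemma vertex_mult: "vertex T j (f * g) = vertex T j f * vertex T j g"
proof (induction j)
  case (Suc j)
  then show ?case using sq_tensor_mult[of "tow_T T j" "vertex T j f" "vertex T j g" 1 1] by simp
qed simp

lemma vertex_add: "vertex T j (f + g) = vertex T j f + vertex T j g"
proof (induction j)
  case (Suc j)
  then show ?case by (simp add: sq_tensor_def tensor_add_left)
qed simp

lemma vertex_cst: "vertex T j (cst c) = cst c"
proof (induction j)
  case (Suc j)
  then show ?case using sq_tensor_cst[of "tow_T T j" c 1 1] by simp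
qed simp

lemma vertex_cst_mult: "vertex T j (cst c * f) = cst c * vertex T j f"
  by (simp add: vertex_mult vertex_cst)

lemma vertex_sum: "vertex T j (\<Sum>i\<in>I. F i) = (\<Sum>i\<in>I. vertex T j (F i))"
proof (induction I rule: infinite_finite_induct)
  case (infinite I)
  then show ?case using vertex_cst[of T j 0] by simp
next
  case empty
  show ?case using vertex_cst[of T j 0] by simp
next
  case (insert i I)
  then show ?case by (simp only: sum.insert vertex_add not_False_eq_True)
qed

lemma vertex_prod: "vertex T j (\<Prod>i\<in>I. F i) = (\<Prod>i\<in>I. vertex T j (F i))"
proof (induction I rule: infinite_finite_induct)
  case (infinite I)
  then show ?case using vertex_cst[of T j 1] by simp
next
  case empty
  show ?case using vertex_cst[of T j 1] by simp
next
  case (insert i I)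
  then show ?case by (simp only: prod.insert vertex_mult not_False_eq_True)
qed

lemma vertex_avg: "vertex T j (avg N F) = avg N (\<lambda>n. vertex T j (F n))"
  by (simp only: avg_def vertex_cst_mult vertex_sum)

lemma pull_vertex: "pull (tow_T T j) n (vertex T j g) = vertex T j (pull T n g)"
  by (induction j) (simp_all only: vertex.simps tow_T.simps pull_sq_tensor_T pull_1)

lemma tow_W_commute: "tow_W j \<circ> tow_T T j = tow_T T j \<circ> tow_W j"
  by (induction j) (simp_all only: tow_W.simps tow_T.simps sq_lift_commute id_o o_id)

lemma pull_W_vertex: "pull (tow_W j) n (vertex T j g) = vertex T j g"
  by (induction j) (simp_all only: tow_W.simps vertex.simps pull_sq_tensor[OF tow_W_commute] pull_id pull_1)

section \<open>The powers of T by which the vertices of a cube move\<close>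

definition unit_ball :: "('w \<Rightarrow> complex) set \<Rightarrow> ('w \<Rightarrow> complex) set" where
  "unit_ball A = {f \<in> A. bounded_by 1 f}"

text \<open>\<open>Q i\<close> collects the vertices that \<open>tow_W\<close> moves by
  \<open>T ^ i\<close>.\<close>

definition W_poly where
  "W_poly T j F Q \<longleftrightarrow> (\<forall>n. pull (tow_W j) n F = (\<Prod>i\<le>j. pull (tow_T T j) (i * n) (Q i)))"

text \<open>The extra T on the second factor raises its exponents by one, hence
  \<open>R (i - 1)\<close>. Exponent 0 gets nothing from the second factor and exponent
  \<open>Suc j\<close> nothing from the first, which explains the default value 1.\<close>

lemma W_poly_tensor:
  fixes F G :: "'a om \<Rightarrow> complex"
  assumes F: "W_poly T j F Q" and G: "W_poly T j G R"
  shows "W_poly T (Suc j) (sq_tensor (tow_T T j) F G)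
    (\<lambda>i. sq_tensor (tow_T T j) (if i \<le> j then Q i else 1) (if i = 0 then 1 else R (i - 1)))"
  unfolding W_poly_def
proof
  fix n
  let ?T = "tow_T T j"
  let ?Q = "\<lambda>i. if i \<le> j then Q i else 1" and ?R = "\<lambda>i. if i = 0 then 1 else R (i - 1)"
  have "pull (tow_W (Suc j)) n (sq_tensor ?T F G) =
      sq_tensor ?T (pull (tow_W j) n F) (pull ?T n (pull (tow_W j) n G))"
    by (simp only: tow_W.simps pull_sq_tensor[OF tow_W_commute] pull_commute[OF tow_W_commute] mult_1_left)
  also have "pull (tow_W j) n F = (\<Prod>i\<le>Suc j. pull ?T (i * n) (?Q i))"
    using F by (simp add: W_poly_def)
  also have "pull ?T n (pull (tow_W j) n G) = (\<Prod>i\<le>Suc j. pull ?T (i * n) (?R i))"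
    using G by (simp add: W_poly_def prod.atMost_Suc_shift del: prod.atMost_Suc)
  also have "sq_tensor ?T (\<Prod>i\<le>Suc j. pull ?T (i * n) (?Q i)) (\<Prod>i\<le>Suc j. pull ?T (i * n) (?R i)) =
      (\<Prod>i\<le>Suc j. pull (tow_T T (Suc j)) (i * n) (sq_tensor ?T (?Q i) (?R i)))"
    by (simp only: sq_tensor_prod tow_T.simps pull_sq_tensor_T)
  finally show "pull (tow_W (Suc j)) n (sq_tensor ?T F G) =
      (\<Prod>i\<le>Suc j. pull (tow_T T (Suc j)) (i * n) (sq_tensor ?T (?Q i) (?R i)))" .
qed

context
  fixes A :: "('a om \<Rightarrow> complex) set" and \<phi> T
  assumes S: "sys A \<phi> T"
begin

lemma tower_sys: "sys (tow_A A \<phi> T j) (tow_phi \<phi> j) (tow_T T j)"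
  by (induction j) (simp_all only: tow_A.simps tow_phi.simps tow_T.simps S sys_square)

lemma tower_W: "dyn (tow_A A \<phi> T j) (tow_phi \<phi> j) (tow_W j)"
proof (induction j)
  case 0
  interpret sys A \<phi> T by (rule S)
  show ?case
    unfolding tow_A.simps tow_phi.simps tow_W.simps
    by (intro dyn.intro dyn_axioms.intro funalg_axioms) (simp_all only: pull_id)
next
  case (Suc j)
  then show ?case
    unfolding tow_A.simps tow_phi.simps tow_W.simps
    by (intro dyn_square[OF tower_sys] tow_W_commute)
qed

lemma tower_no_eigen:
  assumes "cmod w = 1" "no_eigen A \<phi> T w"
  shows "no_eigen (tow_A A \<phi> T j) (tow_phi \<phi> j) (tow_T T j) w"
  by (induction j) (simp_all only: tow_A.simps tow_phi.simps tow_T.simps assms no_eigen_square[OF tower_sys assms(1)])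

lemma unit_ball_1: "1 \<in> unit_ball (tow_A A \<phi> T j)"
proof -
  interpret sys "tow_A A \<phi> T j" "tow_phi \<phi> j" "tow_T T j" by (rule tower_sys)
  show ?thesis by (simp add: unit_ball_def)
qed

lemma unit_ball_cj: "f \<in> unit_ball (tow_A A \<phi> T j) \<Longrightarrow> cj f \<in> unit_ball (tow_A A \<phi> T j)"
proof -
  interpret sys "tow_A A \<phi> T j" "tow_phi \<phi> j" "tow_T T j" by (rule tower_sys)
  show "f \<in> unit_ball (tow_A A \<phi> T j) \<Longrightarrow> cj f \<in> unit_ball (tow_A A \<phi> T j)" by (simp add: unit_ball_def)
qed

lemma unit_ball_mult: "f \<in> unit_ball (tow_A A \<phi> T j) \<Longrightarrow> g \<in> unit_ball (tow_A A \<phi> T j) \<Longrightarrow> f * g \<in> unit_ball (tow_A A \<phi> T j)"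
proof -
  interpret sys "tow_A A \<phi> T j" "tow_phi \<phi> j" "tow_T T j" by (rule tower_sys)
  show "f \<in> unit_ball (tow_A A \<phi> T j) \<Longrightarrow> g \<in> unit_ball (tow_A A \<phi> T j) \<Longrightarrow> f * g \<in> unit_ball (tow_A A \<phi> T j)" by (simp add: unit_ball_def bounded_by_mult1)
qed

lemma unit_ball_tensor: "f \<in> unit_ball (tow_A A \<phi> T j) \<Longrightarrow> g \<in> unit_ball (tow_A A \<phi> T j) \<Longrightarrow> sq_tensor (tow_T T j) f g \<in> unit_ball (tow_A A \<phi> T (Suc j))"
  unfolding unit_ball_def mem_Collect_eq tow_A.simps
  by (elim conjE, intro conjI sq_tensor_in[OF tower_sys] bounded_by_sq_tensor1)

lemma cube_unit_ball: "g \<in> unit_ball A \<Longrightarrow> cube T j g \<in> unit_ball (tow_A A \<phi> T j)"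
  by (induction j) (simp_all only: cube.simps unit_ball_tensor unit_ball_cj tow_A.simps(1))

lemma vertex_unit_ball: "g \<in> unit_ball A \<Longrightarrow> vertex T j g \<in> unit_ball (tow_A A \<phi> T j)"
  by (induction j) (simp_all only: vertex.simps unit_ball_tensor unit_ball_1 tow_A.simps(1))

lemma dual_unit_ball: "g \<in> unit_ball A \<Longrightarrow> dual T j g \<in> unit_ball (tow_A A \<phi> T j)"
  by (induction j) (simp_all only: dual.simps unit_ball_tensor unit_ball_1 unit_ball_cj cube_unit_ball)

lemma vertex_in: "g \<in> A \<Longrightarrow> vertex T j g \<in> tow_A A \<phi> T j"
proof (induction j)
  case (Suc j)
  interpret sys "tow_A A \<phi> T j" "tow_phi \<phi> j" "tow_T T j" by (rule tower_sys)
  show ?case using Suc sq_tensor_in[OF tower_sys] by simp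
qed simp

lemma nrm_vertex: "g \<in> A \<Longrightarrow> nrm (tow_phi \<phi> j) (vertex T j g) = nrm \<phi> g"
  by (induction j) (simp_all only: vertex.simps tow_phi.simps nrm_sq_tensor1[OF tower_sys vertex_in])

lemma cube_W_poly:
  assumes g: "g \<in> unit_ball A"
  shows "\<exists>Q. (\<forall>i. Q i \<in> unit_ball (tow_A A \<phi> T j)) \<and> W_poly T j (cube T j g) Q"
proof (induction j)
  case 0
  show ?case using g by (intro exI[of _ "\<lambda>_. g"]) (simp add: W_poly_def)
next
  case (Suc j)
  then obtain Q where Q: "\<And>i. Q i \<in> unit_ball (tow_A A \<phi> T j)" "W_poly T j (cube T j g) Q" by blast
  have "W_poly T j (cj (cube T j g)) (\<lambda>i. cj (Q i))"
    using Q(2) by (simp add: W_poly_def)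
  from W_poly_tensor[OF Q(2) this] show ?case
    using Q(1) unit_ball_tensor unit_ball_cj unit_ball_1
    by (intro exI conjI allI) (simp_all only: cube.simps split: if_splits, auto)
qed

text \<open>\<open>B 0 = 1\<close> because only the first vertex stays fixed, and it is missing from
  \<open>dual\<close>. All remaining exponents are positive, which is what permits the cancellation
  of one \<open>T ^ n\<close>.\<close>

lemma dual_W_poly:
  assumes g: "g \<in> unit_ball A"
  shows "\<exists>B. (\<forall>i. B i \<in> unit_ball (tow_A A \<phi> T j)) \<and> B 0 = 1 \<and> W_poly T j (dual T j g) B"
proof (induction j)
  case 0
  show ?case using unit_ball_1[of 0] by (intro exI[of _ "\<lambda>_. 1"]) (simp add: W_poly_def)
next
  case (Suc j)
  then obtain B where B: "\<And>i. B i \<in> unit_ball (tow_A A \<phi> T j)" "B 0 = 1" "W_poly T j (dual T j g) B" by blast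
  obtain Q where Q: "\<And>i. Q i \<in> unit_ball (tow_A A \<phi> T j)" "W_poly T j (cube T j g) Q" using cube_W_poly[OF g] by blast
  have "W_poly T j (cj (cube T j g)) (\<lambda>i. cj (Q i))"
    using Q(2) by (simp add: W_poly_def)
  from W_poly_tensor[OF B(3) this] show ?case
    using B(1,2) Q(1) unit_ball_tensor unit_ball_cj unit_ball_1
    by (intro exI conjI allI) (simp_all only: dual.simps split: if_splits, auto)
qed

lemma ghk_nonneg: "g \<in> A \<Longrightarrow> 0 \<le> Re (ghk \<phi> T (Suc j) g)"
proof -
  assume g: "g \<in> A"
  have "cube T j g \<in> tow_A A \<phi> T j"
  proof (induction j)
    case (Suc j)
    interpret sys "tow_A A \<phi> T j" "tow_phi \<phi> j" "tow_T T j" by (rule tower_sys)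
    show ?case using Suc sq_tensor_in[OF tower_sys] by simp
  qed (use g in simp)
  then show ?thesis
    unfolding ghk_def tow_phi.simps cube.simps using sq_tensor_le(2)[OF tower_sys] by blast
qed

text \<open>The inductive formula for the seminorms. It holds because \<open>cube\<close> is
  multiplicative and commutes with T, while the next level is by construction a mean of pairings at
  level j.\<close>

lemma ghk_lim:
  assumes g: "g \<in> unit_ball A"
  shows "(\<lambda>N. (\<Sum>n<N. Re (ghk \<phi> T j (g * pull T n (cj g)))) / N) \<longlonglongrightarrow> Re (ghk \<phi> T (Suc j) g)"
proof -
  have c: "cube T j g \<in> tow_A A \<phi> T j" "cj (cube T j g) \<in> tow_A A \<phi> T j"
    using cube_unit_ball[OF g] unit_ball_cj[OF cube_unit_ball[OF g]] by (simp_all add: unit_ball_def)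
  have "(\<lambda>N. Re ((\<Sum>n<N. tow_phi \<phi> j (cube T j g * pull (tow_T T j) n (cj (cube T j g)))) / of_nat N)) \<longlonglongrightarrow>
      Re (ghk \<phi> T (Suc j) g)"
    unfolding ghk_def tow_phi.simps cube.simps by (intro tendsto_Re sq_tensor_lim[OF tower_sys] c)
  then show ?thesis
    by (simp add: ghk_def cube_mult pull_cube cj_cube)
qed

end

section \<open>Weak limits\<close>

text \<open>Closure under midpoints is all of convexity that the parallelogram law uses.\<close>

inductive mid_hull :: "(nat \<Rightarrow> 'w \<Rightarrow> complex) \<Rightarrow> nat \<Rightarrow> ('w \<Rightarrow> complex) \<Rightarrow> bool" for X m where
  "m \<le> i \<Longrightarrow> mid_hull X m (X i)"
| "mid_hull X m a \<Longrightarrow> mid_hull X m b \<Longrightarrow> mid_hull X m (cst (1/2) * (a + b))"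

lemma mid_hull_mono: "mid_hull X n a \<Longrightarrow> m \<le> n \<Longrightarrow> mid_hull X m a"
  by (induction rule: mid_hull.induct) (auto intro: mid_hull.intros)

definition bounded_functional ::
    "('w \<Rightarrow> complex) set \<Rightarrow> (('w \<Rightarrow> complex) \<Rightarrow> complex) \<Rightarrow> (('w \<Rightarrow> complex) \<Rightarrow> complex) \<Rightarrow> real \<Rightarrow> bool"
  where "bounded_functional A \<phi> \<l> K \<longleftrightarrow> (\<forall>a\<in>A. \<forall>b\<in>A. \<l> (a + b) = \<l> a + \<l> b) \<and>
    (\<forall>a\<in>A. \<forall>z. \<l> (cst z * a) = z * \<l> a) \<and> (\<forall>a\<in>A. cmod (\<l> a) \<le> K * nrm \<phi> a)"

context sys
begin

lemma bounded_functional_mult: "g \<in> A \<Longrightarrow> bounded_functional A \<phi> (\<lambda>a. \<phi> (g * a)) (nrm \<phi> g)"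
  by (simp add: bounded_functional_def distrib_left phi_add cauchy_schwarz mult.left_commute[of g] phi_scale)

text \<open>Almost shortest elements of the hulls of the tails form a Cauchy sequence, and its limit
  \<open>G\<close> lies in the closed hull of every tail. So \<open>G\<close> belongs to each closed
  half-space that contains a tail, which replaces weak compactness and the choice of a weakly
  convergent subsequence.\<close>

lemma weak_limit_halfspaces:
  fixes X :: "nat \<Rightarrow> 'a \<Rightarrow> complex"
  assumes X: "\<And>i. X i \<in> A" "\<And>i. bounded_by 1 (X i)"
  obtains G where "G \<in> A" "bounded_by 1 G"
    "\<forall>\<l> K c m. bounded_functional A \<phi> \<l> K \<longrightarrow> (\<forall>i\<ge>m. c \<le> Re (\<l> (X i))) \<longrightarrow> c \<le> Re (\<l> G)"
proof -
  have hullA: "a \<in> A" if "mid_hull X m a" for a m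
    using that X by (induction rule: mid_hull.induct) auto
  have hullB: "bounded_by 1 a" if "mid_hull X m a" for a m
    using that
  proof (induction rule: mid_hull.induct)
    case (2 a b)
    have "bounded_by (1/2 * (1 + 1)) (cst (1/2) * (a + b))"
      using 2 by (intro bounded_by_mult bounded_by_add bounded_by_cst) (auto simp: norm_divide)
    then show ?case by simp
  qed (use X in blast)
  define d where "d m = Inf (nrm \<phi> ` {a. mid_hull X m a})" for m
  have bb: "bdd_below (nrm \<phi> ` {a. mid_hull X m a})" for m
    using hullA by (intro bdd_belowI[of _ 0]) auto
  have ne: "nrm \<phi> ` {a. mid_hull X m a} \<noteq> {}" for m
    using mid_hull.intros(1)[of m m X] by blast
  have d_le: "d m \<le> nrm \<phi> a" if "mid_hull X m a" for m a
    unfolding d_def using that bb by (intro cInf_lower) auto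
  have d0: "0 \<le> d m" for m
    unfolding d_def using ne hullA by (intro cInf_greatest) auto
  have dmono: "d m \<le> d n" if "m \<le> n" for m n
    unfolding d_def using ne bb that by (intro cInf_superset_mono) (auto intro: mid_hull_mono)
  have d1: "d m \<le> 1" for m
    using d_le[OF mid_hull.intros(1)[of m m X]] nrm_le_bound[OF X(1,2), of m] by simp
  have "\<exists>a. mid_hull X m a \<and> nrm \<phi> a < d m + 1 / Suc m" for m
  proof -
    have "\<exists>x\<in>nrm \<phi> ` {a. mid_hull X m a}. x < d m + 1 / Suc m"
      by (intro cInf_lessD ne) (simp add: d_def)
    then show ?thesis by blast
  qed
  then obtain c where c: "\<And>m. mid_hull X m (c m)" "\<And>m. nrm \<phi> (c m) < d m + 1 / Suc m" by metis
  have cA: "c m \<in> A" for m using hullA c by blast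
  have inc: "incseq d" using dmono by (simp add: incseq_def)
  have "\<forall>i. d i \<le> 1" using d1 by blast
  then obtain D where D: "d \<longlonglongrightarrow> D"
    by (rule incseq_convergent[OF inc])
  have dD: "d m \<le> D" for m
    by (rule incseq_le[OF inc D])
  have D1: "D \<le> 1" using D d1 by (intro LIMSEQ_le_const2[OF D]) auto
  \<comment> \<open>Both points belong to the hull of the tail from m, so their midpoint has norm at
    least \<open>d m\<close>; the parallelogram law turns this into closeness.\<close>
  have close: "(nrm \<phi> (c m - c n))\<^sup>2 \<le> 4 * ((D + 1 / Suc m)\<^sup>2 - (d m)\<^sup>2)" if mn: "m \<le> n" for m n
  proof -
    have "mid_hull X m (cst (1/2) * (c m + c n))"
      using c(1) mid_hull_mono mn by (intro mid_hull.intros(2)) blast+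
    then have "d m \<le> nrm \<phi> (cst (1/2) * (c m + c n))" by (rule d_le)
    also have "\<dots> = nrm \<phi> (c m + c n) / 2" using cA by (simp add: nrm_cst_mult)
    finally have "(2 * d m)\<^sup>2 \<le> (nrm \<phi> (c m + c n))\<^sup>2"
      using d0[of m] by (intro power_mono) auto
    moreover have "(nrm \<phi> (c m))\<^sup>2 \<le> (D + 1 / Suc m)\<^sup>2"
      using c(2)[of m] dD[of m] cA by (intro power_mono) auto
    moreover have "(nrm \<phi> (c n))\<^sup>2 \<le> (D + 1 / Suc m)\<^sup>2"
    proof (rule power_mono)
      have "1 / real (Suc n) \<le> 1 / real (Suc m)" using mn by (simp add: frac_le)
      then show "nrm \<phi> (c n) \<le> D + 1 / real (Suc m)" using c(2)[of n] dD[of n] by linarith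
    qed (use cA in simp)
    ultimately show ?thesis
      using parallelogram[OF cA[of m] cA[of n]] by (simp add: power_mult_distrib)
  qed
  have null: "(\<lambda>m. 4 * ((D + 1 / Suc m)\<^sup>2 - (d m)\<^sup>2)) \<longlonglongrightarrow> 0"
  proof -
    have "(\<lambda>m. 4 * ((D + inverse (real (Suc m)))\<^sup>2 - (d m)\<^sup>2)) \<longlonglongrightarrow> 4 * ((D + 0)\<^sup>2 - D\<^sup>2)"
      by (intro tendsto_intros D LIMSEQ_inverse_real_of_nat)
    then show ?thesis by (simp add: inverse_eq_divide)
  qed
  have cau: "\<exists>K. \<forall>m\<ge>K. \<forall>n\<ge>K. nrm \<phi> (c m - c n) < e" if e: "e > 0" for e
  proof -
    obtain K where K: "\<And>m. m \<ge> K \<Longrightarrow> 4 * ((D + 1 / Suc m)\<^sup>2 - (d m)\<^sup>2) < e\<^sup>2"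
      using order_tendstoD(2)[OF null, of "e\<^sup>2"] e by (auto simp: eventually_sequentially)
    have half: "nrm \<phi> (c m - c n) < e" if "m \<ge> K" "m \<le> n" for m n
    proof -
      have "(nrm \<phi> (c m - c n))\<^sup>2 < e\<^sup>2" using close[OF that(2)] K[OF that(1)] by linarith
      then show ?thesis using e by (intro power_less_imp_less_base[of _ 2 e]) auto
    qed
    have "nrm \<phi> (c m - c n) < e" if "m \<ge> K" "n \<ge> K" for m n
    proof (cases "m \<le> n")
      case False
      then have "nrm \<phi> (c n - c m) < e" using that by (intro half) auto
      then show ?thesis using nrm_minus_commute[OF cA cA, of m n] by simp
    qed (use half that in auto)
    then show ?thesis by blast
  qed
  obtain G where G: "G \<in> A" "bounded_by 1 G" and Gl: "(\<lambda>n. nrm \<phi> (c n - G)) \<longlonglongrightarrow> 0"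
    using limit_exists[of c 1] cA hullB[OF c(1)] cau by blast
  show ?thesis
  proof (rule that[OF G], intro allI impI)
    fix \<l> K r i0
    assume "bounded_functional A \<phi> \<l> K" and le: "\<forall>i\<ge>i0. r \<le> Re (\<l> (X i))"
    then have add: "\<And>a b. a \<in> A \<Longrightarrow> b \<in> A \<Longrightarrow> \<l> (a + b) = \<l> a + \<l> b"
      and scale: "\<And>z a. a \<in> A \<Longrightarrow> \<l> (cst z * a) = z * \<l> a"
      and bd: "\<And>a. a \<in> A \<Longrightarrow> cmod (\<l> a) \<le> K * nrm \<phi> a"
      by (auto simp: bounded_functional_def)
    have hull: "r \<le> Re (\<l> a)" if "mid_hull X m a" "m \<ge> i0" for m a
      using that
    proof (induction rule: mid_hull.induct)
      case (2 a b)
      then show ?case using hullA by (simp add: add scale)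
    qed (use le in auto)
    have "(\<lambda>n. \<l> (c n)) \<longlonglongrightarrow> \<l> G"
    proof (rule LIM_zero_cancel, rule Lim_null_comparison)
      have "\<l> (c n) - \<l> G = \<l> (c n - G)" for n
        using add[of "c n - G" G] cA G by simp
      then show "\<forall>\<^sub>F n in sequentially. cmod (\<l> (c n) - \<l> G) \<le> K * nrm \<phi> (c n - G)"
        using bd cA G by simp
      show "(\<lambda>n. K * nrm \<phi> (c n - G)) \<longlonglongrightarrow> 0" using Gl by (rule tendsto_mult_right_zero)
    qed
    from tendsto_Re[OF this] show "r \<le> Re (\<l> G)"
      by (rule LIMSEQ_le_const) (use hull c(1) in blast)
  qed
qed

end

section \<open>The van der Corput estimate\<close>

context funalg
begin

lemma avg_mult: "avg N F * g = avg N (\<lambda>n. F n * g)"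
  by (simp add: mult_avg mult.commute[of _ g])

lemma avg_avg_swap: "avg N (\<lambda>n. avg H (\<lambda>h. u n h)) = avg H (\<lambda>h. avg N (\<lambda>n. u n h))"
  by (auto simp: fun_eq_iff avg_apply sum_divide_distrib mult.commute intro: sum.swap)

text \<open>Replacing u by its means \<open>b\<close> over windows of length H costs at most
  \<open>2 * H / N\<close>; convexity and expansion of the square of \<open>b\<close> leave the
  correlations of u at differences below H.\<close>

lemma van_der_corput:
  assumes u: "\<And>n. u n \<in> A" "\<And>n. nrm \<phi> (u n) \<le> 1" and H: "H > 0"
  shows "nrm \<phi> (avg N u) \<le> 2 * H / N +
    sqrt ((\<Sum>h<H. \<Sum>h'<H. cmod ((\<Sum>n<N. \<phi> (u (n + h) * cj (u (n + h')))) / of_nat N)) / H\<^sup>2)"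
proof -
  define b where "b n = avg H (\<lambda>h. u (n + h))" for n
  have bA: "b n \<in> A" for n using u by (simp add: b_def)
  have "nrm \<phi> (avg N b - avg N u) \<le> 2 * H / N"
  proof -
    have const: "avg H (\<lambda>h. avg N u) = avg N u"
      using H by (auto simp: fun_eq_iff avg_apply)
    have "avg N b = avg H (\<lambda>h. avg N (\<lambda>n. u (n + h)))"
      unfolding b_def by (rule avg_avg_swap)
    then have eq: "avg N b - avg N u = avg H (\<lambda>h. avg N (\<lambda>n. u (n + h)) - avg N u)"
      by (simp only: avg_diff const)
    show ?thesis unfolding eq
    proof (rule nrm_avg_le_const)
      fix h assume "h < H"
      have "nrm \<phi> (avg N (\<lambda>n. u (n + h)) - avg N u) \<le> 2 * real h * 1 / N" by (rule nrm_avg_shift[OF u])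
      also have "\<dots> \<le> 2 * H / N" using \<open>h < H\<close> by (intro divide_right_mono) auto
      finally show "nrm \<phi> (avg N (\<lambda>n. u (n + h)) - avg N u) \<le> 2 * H / N" .
    qed (use u in auto)
  qed
  then have 1: "nrm \<phi> (avg N u) \<le> nrm \<phi> (avg N b) + 2 * H / N"
    using nrm_le_add_diff[of "avg N u" "avg N b"] nrm_minus_commute[of "avg N u" "avg N b"] u bA by simp
  have b2: "(nrm \<phi> (b n))\<^sup>2 = Re (\<Sum>h<H. \<Sum>h'<H. \<phi> (u (n + h) * cj (u (n + h')))) / H\<^sup>2" for n
  proof -
    have "b n * cj (b n) = avg H (\<lambda>h. avg H (\<lambda>h'. u (n + h) * cj (u (n + h'))))"
      unfolding b_def cj_avg by (simp only: avg_mult) (simp only: mult_avg)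
    then have "\<phi> (b n * cj (b n)) = (\<Sum>h<H. \<Sum>h'<H. \<phi> (u (n + h) * cj (u (n + h')))) / of_nat (H\<^sup>2)"
      using u by (simp add: phi_avg sum_divide_distrib[symmetric] power2_eq_square)
    then show ?thesis using nrm_sq[OF bA, of n] by (simp only: Re_divide_of_nat)
  qed
  have "(nrm \<phi> (avg N b))\<^sup>2 \<le> (\<Sum>n<N. (nrm \<phi> (b n))\<^sup>2) / N"
    by (rule nrm_avg_sq_le[OF bA])
  also have "\<dots> = Re (\<Sum>n<N. \<Sum>h<H. \<Sum>h'<H. \<phi> (u (n + h) * cj (u (n + h')))) / H\<^sup>2 / N"
    unfolding b2 by (simp add: sum_divide_distrib Re_sum del: of_nat_power)
  also have "(\<Sum>n<N. \<Sum>h<H. \<Sum>h'<H. \<phi> (u (n + h) * cj (u (n + h')))) =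
      (\<Sum>h<H. \<Sum>n<N. \<Sum>h'<H. \<phi> (u (n + h) * cj (u (n + h'))))"
    by (rule sum.swap)
  also have "\<dots> = (\<Sum>h<H. \<Sum>h'<H. \<Sum>n<N. \<phi> (u (n + h) * cj (u (n + h'))))"
    by (rule sum.cong[OF refl], rule sum.swap)
  also have "Re \<dots> / H\<^sup>2 / N \<le> cmod \<dots> / H\<^sup>2 / N"
    by (intro divide_right_mono complex_Re_le_cmod) auto
  also have "cmod (\<Sum>h<H. \<Sum>h'<H. \<Sum>n<N. \<phi> (u (n + h) * cj (u (n + h')))) / H\<^sup>2 / N \<le>
      (\<Sum>h<H. \<Sum>h'<H. cmod (\<Sum>n<N. \<phi> (u (n + h) * cj (u (n + h'))))) / H\<^sup>2 / N"
    by (intro divide_right_mono sum_norm_le order_trans[OF norm_sum] order_refl) auto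
  also have "\<dots> = (\<Sum>h<H. \<Sum>h'<H. cmod ((\<Sum>n<N. \<phi> (u (n + h) * cj (u (n + h')))) / of_nat N)) / H\<^sup>2"
    by (simp add: norm_divide sum_divide_distrib[symmetric] mult.commute)
  finally have "nrm \<phi> (avg N b) \<le> sqrt ((\<Sum>h<H. \<Sum>h'<H. cmod ((\<Sum>n<N. \<phi> (u (n + h) * cj (u (n + h')))) / of_nat N)) / H\<^sup>2)"
    by (rule real_le_rsqrt)
  with 1 show ?thesis by simp
qed

end

text \<open>With truncated subtraction, \<open>(h - h') + (h' - h)\<close> is the distance of h and
  h'. For fixed h each distance occurs at most twice.\<close>

lemma sum_abs_diff_le:
  fixes x :: "nat \<Rightarrow> real"
  assumes x: "\<And>r. 0 \<le> x r"
  shows "(\<Sum>h<H. \<Sum>h'<H. x ((h - h') + (h' - h))) \<le> 2 * H * (\<Sum>r<H. x r)"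
proof -
  have "(\<Sum>h'<H. x ((h - h') + (h' - h))) \<le> 2 * (\<Sum>r<H. x r)" if h: "h < H" for h
  proof -
    have split: "{..<H} = {..h} \<union> {h<..<H}" using h by auto
    have "(\<Sum>h'<H. x ((h - h') + (h' - h))) =
        (\<Sum>h'\<le>h. x ((h - h') + (h' - h))) + (\<Sum>h'\<in>{h<..<H}. x ((h - h') + (h' - h)))"
      unfolding split by (rule sum.union_disjoint) auto
    also have "(\<Sum>h'\<le>h. x ((h - h') + (h' - h))) = (\<Sum>r\<le>h. x r)"
      by (rule sum.reindex_bij_witness[of _ "\<lambda>r. h - r" "\<lambda>r. h - r"]) auto
    also have "(\<Sum>r\<le>h. x r) \<le> (\<Sum>r<H. x r)"
      using h x by (intro sum_mono2) auto
    also have "(\<Sum>h'\<in>{h<..<H}. x ((h - h') + (h' - h))) = (\<Sum>r\<in>{0<..<H - h}. x r)"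
      by (rule sum.reindex_bij_witness[of _ "\<lambda>r. r + h" "\<lambda>r. r - h"]) auto
    also have "\<dots> \<le> (\<Sum>r<H. x r)"
      using x by (intro sum_mono2) auto
    finally show ?thesis by simp
  qed
  then have "(\<Sum>h<H. \<Sum>h'<H. x ((h - h') + (h' - h))) \<le> (\<Sum>h<H. 2 * (\<Sum>r<H. x r))"
    by (intro sum_mono) auto
  then show ?thesis by (simp add: mult_ac)
qed

text \<open>It linearises the square root from van der Corput or Cauchy-Schwarz, so that the
  resulting bounds can be averaged in the induction.\<close>

lemma sqrt_le_linear:
  fixes y \<eta> :: real
  assumes "0 \<le> y" "0 < \<eta>"
  shows "sqrt y \<le> \<eta> + y / (4 * \<eta>)"
proof -
  have "0 \<le> (sqrt y - 2 * \<eta>)\<^sup>2" by simp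
  also have "\<dots> = y + 4 * \<eta>\<^sup>2 - 4 * \<eta> * sqrt y"
    using assms by (simp add: power2_diff)
  finally show ?thesis using assms by (simp add: field_simps power2_eq_square)
qed

section \<open>Weighted averages of correlations\<close>

definition corr where
  "corr \<phi> T k f n = \<phi> (\<Prod>i\<le>k. pull T (i * n) (f i))"

lemma (in dyn) corr_bound:
  assumes "\<And>i. i \<le> k \<Longrightarrow> f i \<in> unit_ball A"
  shows "cmod (corr \<phi> T k f n) \<le> 1"
proof -
  have p: "(\<Prod>i\<le>k. pull T (i * n) (f i)) \<in> A" "bounded_by 1 (\<Prod>i\<le>k. pull T (i * n) (f i))"
    using assms by (intro prod_in pull_in bounded_by_prod1 bounded_by_pull; simp add: unit_ball_def)+
  show ?thesis
    unfolding corr_def by (rule order_trans[OF phi_le_nrm[OF p(1)] nrm_le_bound[OF p]])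
qed

section \<open>Control of correlations by seminorms\<close>

context
  fixes A :: "('a om \<Rightarrow> complex) set" and \<phi> T
  assumes S: "sys A \<phi> T"
begin

interpretation sys A \<phi> T by (rule S)

text \<open>The last function is made independent of n by translating the whole product and is then
  removed by Cauchy-Schwarz. In the remaining correlations the weight contributes only a constant of
  modulus 1, so the estimate for k functions has no weight. The terms \<open>2 * H / N\<close> come
  from shifting averages by less than H.\<close>

lemma corr_van_der_corput:
  fixes F :: "nat \<Rightarrow> nat \<Rightarrow> 'a om \<Rightarrow> complex"
  assumes f: "\<And>i. i \<le> Suc k \<Longrightarrow> f i \<in> unit_ball A" and w: "cmod w = 1" and H: "H > 0"
  defines "F r i \<equiv> pull T (i * r) (f i) * pull T (Suc k * r) (cj (f i))"
  shows "cmod ((\<Sum>n<N. w ^ n * corr \<phi> T (Suc k) f n) / of_nat N) \<le> 2 * H / N +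
    sqrt ((\<Sum>h<H. \<Sum>h'<H. cmod ((\<Sum>n<N. corr \<phi> T k (F ((h - h') + (h' - h))) n) / of_nat N) + 2 * H / N) / H\<^sup>2)"
proof -
  \<comment> \<open>Large enough that \<open>P - (n + h)\<close> is never truncated for
    \<open>n < N\<close> and \<open>h < H\<close>.\<close>
  define P where "P = N + H"
  define a where "a n = (\<Prod>i\<le>k. pull T (i * n) (f i))" for n
  \<comment> \<open>\<open>P - n\<close> replaces \<open>- n\<close>: the map need not be invertible.\<close>
  define u where "u n = cst (w ^ n) * pull T (Suc k * (P - n)) (a n)" for n
  have fA [simp]: "f i \<in> A" and fb: "bounded_by 1 (f i)" if "i \<le> Suc k" for i
    using f that by (auto simp: unit_ball_def)
  have aA [simp]: "a n \<in> A" and ab: "bounded_by 1 (a n)" for n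
    unfolding a_def by (intro prod_in pull_in bounded_by_prod1 bounded_by_pull; simp add: fb)+
  have uA: "u n \<in> A" for n by (simp add: u_def)
  have un: "nrm \<phi> (u n) \<le> 1" for n
    using nrm_le_bound[OF aA ab, of n] w by (simp add: u_def nrm_cst_mult norm_power)
  have ww: "w ^ n * cnj (w ^ n) = 1" for n
    using w by (simp add: complex_norm_square[symmetric] norm_power del: complex_cnj_power)
  have Fball: "F r i \<in> unit_ball A" if "i \<le> k" for r i
    using that by (simp add: F_def unit_ball_def bounded_by_mult1 bounded_by_pull fb)
  have "(\<Sum>n<N. w ^ n * corr \<phi> T (Suc k) f n) / of_nat N = \<phi> (pull T (Suc k * P) (f (Suc k)) * avg N u)"
  proof -
    have "w ^ n * corr \<phi> T (Suc k) f n = \<phi> (pull T (Suc k * P) (f (Suc k)) * u n)" if n: "n < N" for n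
    proof -
      have e: "Suc k * (P - n) + Suc k * n = Suc k * P"
        using n by (simp add: P_def distrib_left[symmetric] del: mult_Suc)
      have "corr \<phi> T (Suc k) f n = \<phi> (a n * pull T (Suc k * n) (f (Suc k)))"
        by (simp add: corr_def a_def del: mult_Suc)
      also have "\<dots> = \<phi> (pull T (Suc k * (P - n)) (a n * pull T (Suc k * n) (f (Suc k))))"
        by (intro phi_pull[symmetric] mult_in pull_in) auto
      also have "pull T (Suc k * (P - n)) (a n * pull T (Suc k * n) (f (Suc k))) =
          pull T (Suc k * (P - n)) (a n) * pull T (Suc k * P) (f (Suc k))"
        by (simp only: pull_mult pull_pull e)
      finally have "w ^ n * corr \<phi> T (Suc k) f n =
          \<phi> (cst (w ^ n) * (pull T (Suc k * (P - n)) (a n) * pull T (Suc k * P) (f (Suc k))))"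
        by (simp only: phi_scale mult_in pull_in aA fA order_refl)
      then show ?thesis by (simp only: u_def mult_ac)
    qed
    then show ?thesis
      using uA by (simp add: mult_avg phi_avg del: mult_Suc)
  qed
  then have "cmod ((\<Sum>n<N. w ^ n * corr \<phi> T (Suc k) f n) / of_nat N) \<le>
      nrm \<phi> (pull T (Suc k * P) (f (Suc k))) * nrm \<phi> (avg N u)"
    using uA by (simp only: cauchy_schwarz pull_in fA order_refl avg_in)
  also have "\<dots> \<le> 1 * nrm \<phi> (avg N u)"
    using uA nrm_le_bound[OF fA fb, of "Suc k"] by (intro mult_right_mono) (simp_all del: mult_Suc)
  also have "\<dots> \<le> 2 * H / N +
    sqrt ((\<Sum>h<H. \<Sum>h'<H. cmod ((\<Sum>n<N. \<phi> (u (n + h) * cj (u (n + h')))) / of_nat N)) / H\<^sup>2)"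
    using van_der_corput[OF uA un H] by simp
  also have "\<dots> \<le> 2 * H / N +
    sqrt ((\<Sum>h<H. \<Sum>h'<H. cmod ((\<Sum>n<N. corr \<phi> T k (F ((h - h') + (h' - h))) n) / of_nat N) + 2 * H / N) / H\<^sup>2)"
  proof (intro add_left_mono real_sqrt_le_mono divide_right_mono sum_mono)
    have inner: "\<phi> (u (n + s + r) * cj (u (n + s))) = w ^ r * corr \<phi> T k (F r) (n + s)"
      if "n < N" "s + r < H" for n s r
    proof -
      have e1: "Suc k * (P - (n + s)) = Suc k * (P - (n + s + r)) + Suc k * r"
        using that by (simp add: P_def distrib_left[symmetric] del: mult_Suc)
      have "u (n + s + r) * cj (u (n + s)) = cst (w ^ (n + s + r)) * cst (cnj (w ^ (n + s))) *
          pull T (Suc k * (P - (n + s + r))) (a (n + s + r) * pull T (Suc k * r) (cj (a (n + s))))"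
        unfolding u_def e1 by (simp add: mult_ac add.commute del: mult_Suc)
      also have "cst (w ^ (n + s + r)) * cst (cnj (w ^ (n + s))) = cst (w ^ r * (w ^ (n + s) * cnj (w ^ (n + s))))"
        by (simp add: cst_mult power_add mult_ac)
      also have "\<dots> = cst (w ^ r)" unfolding ww by simp
      also have "a (n + s + r) * pull T (Suc k * r) (cj (a (n + s))) = (\<Prod>i\<le>k. pull T (i * (n + s)) (F r i))"
        by (simp add: a_def F_def prod.distrib distrib_left add_ac del: mult_Suc)
      finally have "\<phi> (u (n + s + r) * cj (u (n + s))) =
          \<phi> (cst (w ^ r) * pull T (Suc k * (P - (n + s + r))) (\<Prod>i\<le>k. pull T (i * (n + s)) (F r i)))" by simp
      also have "\<dots> = w ^ r * corr \<phi> T k (F r) (n + s)"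
      proof -
        have "(\<Prod>i\<le>k. pull T (i * (n + s)) (F r i)) \<in> A"
          using Fball by (intro prod_in pull_in) (simp add: unit_ball_def)
        then show ?thesis
          by (simp only: corr_def phi_scale pull_in phi_pull)
      qed
      finally show ?thesis .
    qed
    have bound: "cmod ((\<Sum>n<N. \<phi> (u (n + (s + r)) * cj (u (n + s)))) / of_nat N) \<le>
        cmod ((\<Sum>n<N. corr \<phi> T k (F r) n) / of_nat N) + 2 * H / N" if sr: "s + r < H" for s r
    proof -
      have sums: "(\<Sum>n<N. \<phi> (u (n + (s + r)) * cj (u (n + s)))) = w ^ r * (\<Sum>n<N. corr \<phi> T k (F r) (n + s))"
        using inner sr by (simp add: sum_distrib_left add.assoc)
      have cb: "cmod (corr \<phi> T k (F r) n) \<le> 1" for n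
        by (rule corr_bound[OF Fball])
      from sums have "cmod ((\<Sum>n<N. \<phi> (u (n + (s + r)) * cj (u (n + s)))) / of_nat N) =
          cmod ((\<Sum>n<N. corr \<phi> T k (F r) (n + s)) / of_nat N)"
        using w by (simp add: norm_mult norm_divide norm_power)
      also have "\<dots> \<le> cmod ((\<Sum>n<N. corr \<phi> T k (F r) n) / of_nat N) + 2 * real s * 1 / N"
        using cesaro_shift[of "corr \<phi> T k (F r)" 1 s N, OF cb]
          norm_triangle_sub[of "(\<Sum>n<N. corr \<phi> T k (F r) (n + s)) / of_nat N" "(\<Sum>n<N. corr \<phi> T k (F r) n) / of_nat N"]
        by linarith
      also have "2 * real s * 1 / N \<le> 2 * H / N"
        using sr by (intro divide_right_mono) auto
      finally show ?thesis by simp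
    qed
    fix h h' assume "h \<in> {..<H}" "h' \<in> {..<H}"
    then have hH: "h < H" "h' < H" by auto
    show "cmod ((\<Sum>n<N. \<phi> (u (n + h) * cj (u (n + h')))) / of_nat N) \<le>
        cmod ((\<Sum>n<N. corr \<phi> T k (F ((h - h') + (h' - h))) n) / of_nat N) + 2 * H / N"
    proof (cases "h' \<le> h")
      case True
      then show ?thesis using bound[of h' "h - h'"] hH by simp
    next
      case False
      have "\<phi> (u (n + h) * cj (u (n + h'))) = cnj (\<phi> (u (n + h') * cj (u (n + h))))" for n
        using phi_cj[of "u (n + h') * cj (u (n + h))"] uA by (simp add: mult.commute)
      then have "(\<Sum>n<N. \<phi> (u (n + h) * cj (u (n + h')))) / of_nat N =
          cnj ((\<Sum>n<N. \<phi> (u (n + h') * cj (u (n + h)))) / of_nat N)" by simp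
      then show ?thesis using bound[of h "h' - h"] hH False by (simp del: complex_cnj_divide cnj_sum)
    qed
  qed auto
  finally show ?thesis by simp
qed

text \<open>The averages tend to the integral of \<open>f 0 \<otimes> f 1\<close>, which is at most
  the root of the first \<open>ghk\<close>. \<open>C\<close> comes from
  \<open>sqrt_le_linear\<close> with \<epsilon> / 2; the other half of \<epsilon> absorbs the
  passage to the limit.\<close>

lemma corr_le_ghk_1:
  assumes e: "\<epsilon> > 0"
  shows "\<exists>C\<ge>0. \<forall>f. (\<forall>i\<le>1. f i \<in> unit_ball A) \<longrightarrow>
    (\<forall>\<^sub>F N in sequentially. cmod ((\<Sum>n<N. corr \<phi> T 1 f n) / of_nat N) \<le> \<epsilon> + C * Re (ghk \<phi> T 1 (f 0)))"
proof (intro exI[of _ "1 / (2 * \<epsilon>)"] conjI allI impI)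
  fix f :: "nat \<Rightarrow> 'a om \<Rightarrow> complex" assume f: "\<forall>i\<le>1. f i \<in> unit_ball A"
  then have f0: "f 0 \<in> A" and f1: "f 1 \<in> A" and f1b: "bounded_by 1 (f 1)"
    by (auto simp: unit_ball_def)
  define G where "G = Re (ghk \<phi> T 1 (f 0))"
  have G: "G = Re (sq_phi \<phi> (sq_tensor T (f 0) (cj (f 0))))" by (simp add: G_def ghk_def)
  have G0: "0 \<le> G" unfolding G by (rule sq_tensor_le(2)[OF S f0 f1])
  have "cmod (sq_phi \<phi> (sq_tensor T (f 0) (f 1))) \<le> sqrt G * nrm \<phi> (f 1)"
    unfolding G by (rule sq_tensor_le(1)[OF S f0 f1])
  also have "\<dots> \<le> sqrt G * 1" using G0 nrm_le_bound[OF f1 f1b] by (intro mult_left_mono) auto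
  also have "\<dots> \<le> \<epsilon> / 2 + 1 / (2 * \<epsilon>) * G"
    using sqrt_le_linear[OF G0, of "\<epsilon> / 2"] e by simp
  finally have le: "cmod (sq_phi \<phi> (sq_tensor T (f 0) (f 1))) < \<epsilon> + 1 / (2 * \<epsilon>) * G" using e by linarith
  have "(\<lambda>N. cmod ((\<Sum>n<N. corr \<phi> T 1 f n) / of_nat N)) \<longlonglongrightarrow> cmod (sq_phi \<phi> (sq_tensor T (f 0) (f 1)))"
    using tendsto_norm[OF sq_tensor_lim[OF S f0 f1]] by (simp add: corr_def)
  from order_tendstoD(2)[OF this le]
  show "\<forall>\<^sub>F N in sequentially. cmod ((\<Sum>n<N. corr \<phi> T 1 f n) / of_nat N) \<le> \<epsilon> + 1 / (2 * \<epsilon>) * Re (ghk \<phi> T 1 (f 0))"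
    unfolding G_def[symmetric] by eventually_elim simp
qed (use e in simp)

text \<open>The bound is linear in \<open>ghk\<close> with \<open>C\<close> independent of f. It can
  therefore be applied to all \<open>F r\<close> at once and averaged over r, where
  \<open>ghk_lim\<close> turns the mean of the lower seminorms into the next one.\<close>

lemma corr_le_ghk_step:
  assumes IH: "\<And>\<epsilon>. \<epsilon> > 0 \<Longrightarrow> \<exists>C\<ge>0. \<forall>f. (\<forall>i\<le>Suc m. f i \<in> unit_ball A) \<longrightarrow>
    (\<forall>\<^sub>F N in sequentially. cmod ((\<Sum>n<N. corr \<phi> T (Suc m) f n) / of_nat N) \<le> \<epsilon> + C * Re (ghk \<phi> T (Suc m) (f 0)))"
    and w: "cmod w = 1" and e: "\<epsilon> > 0"
  shows "\<exists>C\<ge>0. \<forall>f. (\<forall>i\<le>Suc (Suc m). f i \<in> unit_ball A) \<longrightarrow>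
    (\<forall>\<^sub>F N in sequentially. cmod ((\<Sum>n<N. w ^ n * corr \<phi> T (Suc (Suc m)) f n) / of_nat N) \<le>
      \<epsilon> + C * Re (ghk \<phi> T (Suc (Suc m)) (f 0)))"
proof -
  define k where "k = Suc (Suc m)"
  \<comment> \<open>At the end the root contributes \<epsilon> / 4 + 3 \<delta> / \<epsilon>, which
    is 5/8 of \<epsilon>, and the shift error at most a further eighth.\<close>
  define \<delta> where "\<delta> = \<epsilon>\<^sup>2 / 8"
  have \<delta>: "\<delta> > 0" using e by (simp add: \<delta>_def)
  obtain C where C: "C \<ge> 0" and IHC: "\<And>f. (\<And>i. i \<le> Suc m \<Longrightarrow> f i \<in> unit_ball A) \<Longrightarrow>
    (\<forall>\<^sub>F N in sequentially. cmod ((\<Sum>n<N. corr \<phi> T (Suc m) f n) / of_nat N) \<le> \<delta> + C * Re (ghk \<phi> T (Suc m) (f 0)))"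
    using IH[OF \<delta>] by blast
  show ?thesis
  proof (intro exI[of _ "2 * C * k / \<epsilon>"] conjI allI impI)
    fix f :: "nat \<Rightarrow> 'a om \<Rightarrow> complex" assume "\<forall>i\<le>Suc (Suc m). f i \<in> unit_ball A"
    then have f: "\<And>i. i \<le> Suc (Suc m) \<Longrightarrow> f i \<in> unit_ball A" by blast
    define g where "g = f 0"
    have g: "g \<in> unit_ball A" "g \<in> A" using f[of 0] by (auto simp: g_def unit_ball_def)
    define G where "G = Re (ghk \<phi> T k g)"
    define y where "y s = Re (ghk \<phi> T (Suc m) (g * pull T s (cj g)))" for s
    have y0: "0 \<le> y s" for s
      unfolding y_def using g by (intro ghk_nonneg[OF S]) auto
    have G0: "0 \<le> G" unfolding G_def k_def using g by (intro ghk_nonneg[OF S])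
    have ylim: "(\<lambda>N. (\<Sum>s<N. y s) / N) \<longlonglongrightarrow> G"
      unfolding y_def G_def k_def by (rule ghk_lim[OF S g(1)])
    \<comment> \<open>This is the slack in the mean of \<open>y\<close>. It is later multiplied by
      \<open>2 * C * k\<close> and must then still be at most \<delta>; \<open>C + 1\<close> guards
      against \<open>C = 0\<close>.\<close>
    define \<eta> where "\<eta> = \<delta> / (2 * (C + 1) * k)"
    have k0: "0 < k" by (simp add: k_def)
    have \<eta>: "\<eta> > 0" using \<delta> C k0 by (simp add: \<eta>_def)
    have \<eta>2: "2 * C * k * \<eta> \<le> \<delta>"
    proof -
      have "\<eta> * (2 * (C + 1) * k) = \<delta>" using C k0 by (simp add: \<eta>_def)
      moreover have "C * (k * \<eta>) \<le> (C + 1) * (k * \<eta>)"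
        using \<eta> by (intro mult_right_mono) auto
      ultimately show ?thesis by (simp add: algebra_simps)
    qed
    obtain H0 where H0: "\<And>N. N \<ge> H0 \<Longrightarrow> (\<Sum>s<N. y s) / N < G + \<eta>"
      using order_tendstoD(2)[OF ylim, of "G + \<eta>"] \<eta> unfolding eventually_sequentially by auto
    \<comment> \<open>The window is fixed before N grows: means of \<open>y\<close> over
      \<open>H0\<close> or more terms are already below \<open>G + \<eta>\<close>.\<close>
    define H where "H = Suc H0"
    have H: "H > 0" by (simp add: H_def)
    define F where "F r i = pull T (i * r) (f i) * pull T (k * r) (cj (f i))" for r i
    have Fb: "F r i \<in> unit_ball A" if "i \<le> Suc m" for r i
      using f[of i] that by (simp add: F_def unit_ball_def bounded_by_mult1 bounded_by_pull)
    have F0: "Re (ghk \<phi> T (Suc m) (F r 0)) = y (k * r)" for r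
      by (simp add: F_def y_def g_def)
    \<comment> \<open>Only multiples of k occur as shifts. As \<open>y\<close> is nonnegative, their
      sum is at most the sum over all \<open>s < k * H\<close>, at the cost of a factor k.\<close>
    have sumy: "(\<Sum>r<H. y (k * r)) / H \<le> k * (G + \<eta>)"
    proof -
      have "(\<Sum>r<H. y (k * r)) = (\<Sum>s\<in>(\<lambda>r. k * r) ` {..<H}. y s)"
        using k0 by (subst sum.reindex) (auto simp: inj_on_def)
      also have "\<dots> \<le> (\<Sum>s<k * H. y s)"
        using y0 k0 by (intro sum_mono2) auto
      finally have "(\<Sum>r<H. y (k * r)) / H \<le> k * ((\<Sum>s<k * H. y s) / (k * H))"
        using k0 H by (simp add: field_simps)
      also have "\<dots> \<le> k * (G + \<eta>)"
      proof (intro mult_left_mono)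
        have "k * H \<ge> H0" using k0 by (cases k) (auto simp: H_def)
        then show "(\<Sum>s<k * H. y s) / (k * H) \<le> G + \<eta>" using H0[of "k * H"] by simp
      qed simp
      finally show ?thesis .
    qed
    have ev1: "\<forall>\<^sub>F N in sequentially. \<forall>r\<in>{..<H}. cmod ((\<Sum>n<N. corr \<phi> T (Suc m) (F r) n) / of_nat N) \<le> \<delta> + C * y (k * r)"
    proof (intro eventually_ball_finite ballI)
      show "\<forall>\<^sub>F N in sequentially. cmod ((\<Sum>n<N. corr \<phi> T (Suc m) (F r) n) / of_nat N) \<le> \<delta> + C * y (k * r)" for r
        using IHC[of "F r"] Fb unfolding F0 by blast
    qed simp
    have ev2: "\<forall>\<^sub>F N in sequentially. 2 * real H / real N < min \<delta> (\<epsilon> / 8)"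
      using order_tendstoD(2)[OF lim_const_over_n[of "2 * real H"], of "min \<delta> (\<epsilon> / 8)"] \<delta> e by simp
    show "\<forall>\<^sub>F N in sequentially. cmod ((\<Sum>n<N. w ^ n * corr \<phi> T (Suc (Suc m)) f n) / of_nat N) \<le>
        \<epsilon> + 2 * C * k / \<epsilon> * Re (ghk \<phi> T (Suc (Suc m)) (f 0))"
      using ev1 ev2
    proof eventually_elim
      case (elim N)
      define Y where "Y = (\<Sum>h<H. \<Sum>h'<H. cmod ((\<Sum>n<N. corr \<phi> T (Suc m) (F ((h - h') + (h' - h))) n) / of_nat N) + 2 * H / N) / (real H)\<^sup>2"
      have Y0: "0 \<le> Y" unfolding Y_def by (intro divide_nonneg_nonneg sum_nonneg) auto
      have "Y \<le> (\<Sum>h<H. \<Sum>h'<H. 2 * \<delta> + C * y (k * ((h - h') + (h' - h)))) / (real H)\<^sup>2"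
        unfolding Y_def
      proof (intro divide_right_mono sum_mono)
        fix h h' assume "h \<in> {..<H}" "h' \<in> {..<H}"
        then have "(h - h') + (h' - h) \<in> {..<H}" by auto
        then have "cmod ((\<Sum>n<N. corr \<phi> T (Suc m) (F ((h - h') + (h' - h))) n) / of_nat N) \<le>
            \<delta> + C * y (k * ((h - h') + (h' - h)))"
          using elim(1) by blast
        then show "cmod ((\<Sum>n<N. corr \<phi> T (Suc m) (F ((h - h') + (h' - h))) n) / of_nat N) + 2 * H / N \<le>
            2 * \<delta> + C * y (k * ((h - h') + (h' - h)))"
          using elim(2) by (simp only: of_nat_mult of_nat_numeral)
      qed simp
      also have "(\<Sum>h<H. \<Sum>h'<H. 2 * \<delta> + C * y (k * ((h - h') + (h' - h)))) =
          (real H)\<^sup>2 * (2 * \<delta>) + C * (\<Sum>h<H. \<Sum>h'<H. y (k * ((h - h') + (h' - h))))"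
        by (simp add: sum.distrib sum_distrib_left power2_eq_square)
      also have "\<dots> \<le> (real H)\<^sup>2 * (2 * \<delta>) + C * (2 * H * (\<Sum>r<H. y (k * r)))"
        using C sum_abs_diff_le[of "\<lambda>r. y (k * r)" H] y0 by (intro add_left_mono mult_left_mono) auto
      also have "((real H)\<^sup>2 * (2 * \<delta>) + C * (2 * H * (\<Sum>r<H. y (k * r)))) / (real H)\<^sup>2 =
          2 * \<delta> + 2 * C * ((\<Sum>r<H. y (k * r)) / H)"
        using H by (simp add: field_simps power2_eq_square)
      also have "\<dots> \<le> 2 * \<delta> + 2 * C * (k * (G + \<eta>))"
        using sumy C by (intro add_left_mono mult_left_mono) auto
      also have "\<dots> \<le> 3 * \<delta> + 2 * C * k * G"
        using \<eta>2 by (simp add: algebra_simps)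
      finally have Y: "Y \<le> 3 * \<delta> + 2 * C * k * G" by (simp add: divide_right_mono)
      have "sqrt Y \<le> \<epsilon> / 4 + Y / \<epsilon>"
        using sqrt_le_linear[OF Y0, of "\<epsilon> / 4"] e by simp
      also have "\<dots> \<le> \<epsilon> / 4 + (3 * \<delta> + 2 * C * k * G) / \<epsilon>"
        using Y e by (intro add_left_mono divide_right_mono) auto
      also have "\<dots> = 5 / 8 * \<epsilon> + 2 * C * k / \<epsilon> * G"
        using e by (simp add: \<delta>_def field_simps power2_eq_square)
      finally have sqrtY: "sqrt Y \<le> 5 / 8 * \<epsilon> + 2 * C * k / \<epsilon> * G" .
      have "cmod ((\<Sum>n<N. w ^ n * corr \<phi> T (Suc (Suc m)) f n) / of_nat N) \<le> 2 * H / N + sqrt Y"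
        using corr_van_der_corput[where k = "Suc m" and f = f and w = w and H = H and N = N, OF f w H]
        unfolding Y_def F_def k_def by simp
      then show ?case using elim sqrtY e unfolding G_def k_def g_def by linarith
    qed
  qed (use C e in simp)
qed

text \<open>The induction step removes the weight, so its hypothesis is used with weight 1. For
  \<open>m = 0\<close> no such step takes place, and the first seminorm sees only the invariant
  part, which does not control averages with another weight.\<close>

theorem corr_le_ghk:
  assumes w: "cmod w = 1" "m = 0 \<Longrightarrow> w = 1" and e: "\<epsilon> > 0"
  shows "\<exists>C\<ge>0. \<forall>f. (\<forall>i\<le>Suc m. f i \<in> unit_ball A) \<longrightarrow>
    (\<forall>\<^sub>F N in sequentially. cmod ((\<Sum>n<N. w ^ n * corr \<phi> T (Suc m) f n) / of_nat N) \<le>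
      \<epsilon> + C * Re (ghk \<phi> T (Suc m) (f 0)))"
  using assms
proof (induction m arbitrary: w \<epsilon>)
  case 0
  then show ?case using corr_le_ghk_1 by simp
next
  case (Suc m)
  show ?case
    by (rule corr_le_ghk_step) (use Suc.IH[of 1] Suc.prems in simp_all)
qed

end

context sys
begin

lemma weak_limit:
  fixes X :: "nat \<Rightarrow> 'a \<Rightarrow> complex"
  assumes X: "\<And>i. X i \<in> A" "\<And>i. bounded_by 1 (X i)"
    and h: "h \<in> A" and c: "0 < c" "\<And>i. c \<le> Re (\<phi> (h * X i))"
  obtains G where "G \<in> A" "bounded_by 1 G" "\<phi> (h * G) \<noteq> 0"
    "\<forall>\<l> K. bounded_functional A \<phi> \<l> K \<longrightarrow> (\<lambda>i. \<l> (X i)) \<longlonglongrightarrow> 0 \<longrightarrow> \<l> G = 0"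
proof (rule weak_limit_halfspaces[OF X])
  fix G
  assume G: "G \<in> A" "bounded_by 1 G" and
    half: "\<forall>\<l> K c m. bounded_functional A \<phi> \<l> K \<longrightarrow> (\<forall>i\<ge>m. c \<le> Re (\<l> (X i))) \<longrightarrow> c \<le> Re (\<l> G)"
  have "c \<le> Re (\<phi> (h * G))"
    using half bounded_functional_mult[OF h] c(2) by blast
  then have "\<phi> (h * G) \<noteq> 0" using c by auto
  moreover have "\<l> G = 0"
    if bf: "bounded_functional A \<phi> \<l> K" and lim: "(\<lambda>i. \<l> (X i)) \<longlonglongrightarrow> 0" for \<l> K
  proof -
    \<comment> \<open>Every rotation of the functional lies eventually above \<open>- e\<close>
      along \<open>X\<close>; the four rotations by powers of \<i> then force the value at
      \<open>G\<close> to be 0.\<close>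
    have pos: "0 \<le> Re (s * \<l> G)" if s: "cmod s = 1" for s
    proof (rule field_le_epsilon)
      fix e :: real assume e: "0 < e"
      obtain i0 where i0: "\<And>i. i \<ge> i0 \<Longrightarrow> cmod (\<l> (X i)) < e"
        using LIMSEQ_D[OF lim e] by auto
      have "bounded_functional A \<phi> (\<lambda>a. s * \<l> a) K"
        using bf s by (simp add: bounded_functional_def distrib_left norm_mult)
      moreover have "- e \<le> Re (s * \<l> (X i))" if "i \<ge> i0" for i
        using abs_Re_le_cmod[of "s * \<l> (X i)"] i0[OF that] s by (simp add: norm_mult)
      ultimately have "- e \<le> Re (s * \<l> G)" using half by blast
      then show "0 \<le> Re (s * \<l> G) + e" by simp
    qed
    show "\<l> G = 0"
      using pos[of 1] pos[of "-1"] pos[of \<i>] pos[of "-\<i>"] by (simp add: complex_eq_iff)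
  qed
  ultimately show ?thesis using that[OF G] by blast
qed

end

theorem corr_average_null:
  fixes A :: "('a om \<Rightarrow> complex) set"
  assumes w: "cmod w = 1" and "sys A \<phi> T" "no_eigen A \<phi> T w" "\<And>i. i \<le> Suc k \<Longrightarrow> f i \<in> unit_ball A"
  shows "(\<lambda>N. (\<Sum>n<N. w ^ n * corr \<phi> T (Suc k) f n) / of_nat N) \<longlonglongrightarrow> 0"
  using assms(2-)
proof (induction k arbitrary: A \<phi> T f)
  case 0
  interpret sys A \<phi> T by (rule 0)
  have f: "f 0 \<in> A" "f 1 \<in> A" using 0(3)[of 0] 0(3)[of 1] by (auto simp: unit_ball_def)
  have "(\<lambda>N. \<phi> (f 0 * tavg T w N (f 1))) \<longlonglongrightarrow> \<phi> (f 0 * 0)"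
    using no_eigen_tavg[OF w 0(2) f(2)] f by (intro phi_tendsto) auto
  moreover have "\<phi> (f 0 * tavg T w N (f 1)) = (\<Sum>n<N. w ^ n * corr \<phi> T (Suc 0) f n) / of_nat N" for N
  proof -
    have "\<phi> (f 0 * (cst (w ^ n) * pull T n (f 1))) = w ^ n * \<phi> (f 0 * pull T n (f 1))" for n
      unfolding mult.left_commute[of "f 0"] using f by (intro phi_scale) simp
    then show ?thesis using f by (simp add: tavg_def mult_avg phi_avg corr_def)
  qed
  ultimately show ?case by simp
next
  case (Suc k)
  interpret sys A \<phi> T by (rule Suc.prems)
  note S = Suc.prems(1)
  have fA [simp]: "f i \<in> A" and fb: "bounded_by 1 (f i)" if "i \<le> Suc (Suc k)" for i
    using Suc.prems(3)[OF that] by (auto simp: unit_ball_def)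
  define h where "h n = (\<Prod>i\<le>Suc k. pull T (Suc i * n) (f (Suc i)))" for n
  define X where "X N = avg N (\<lambda>n. cst (w ^ n) * h n)" for N
  have hA [simp]: "h n \<in> A" and hb: "bounded_by 1 (h n)" for n
    unfolding h_def by (intro prod_in pull_in bounded_by_prod1 bounded_by_pull; simp add: fb del: mult_Suc)+
  have XA [simp]: "X N \<in> A" for N by (simp add: X_def)
  have whb: "bounded_by 1 (cst (w ^ n) * h n)" for n
    using w hb by (intro bounded_by_mult1 bounded_by_cst) (simp_all add: norm_power)
  have Xb: "bounded_by 1 (X N)" for N
    unfolding X_def by (intro bounded_by_avg whb) simp
  have corr_eq: "(\<Sum>n<N. w ^ n * corr \<phi> T (Suc (Suc k)) (f(0 := g)) n) / of_nat N = \<phi> (g * X N)"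
    if g: "g \<in> A" for g N
  proof -
    have "corr \<phi> T (Suc (Suc k)) (f(0 := g)) n = \<phi> (g * h n)" for n
      unfolding corr_def h_def prod.atMost_Suc_shift[of _ "Suc k"] by (simp del: prod.atMost_Suc mult_Suc)
    moreover have "\<phi> (g * (cst (w ^ n) * h n)) = w ^ n * \<phi> (g * h n)" for n
      unfolding mult.left_commute[of g] using g by (intro phi_scale) simp
    ultimately show ?thesis
      using g by (simp add: X_def mult_avg phi_avg)
  qed
  show ?case
  proof (rule ccontr)
    define x where "x N = \<phi> (f 0 * X N)" for N
    assume "\<not> ?thesis"
    then have "\<not> x \<longlonglongrightarrow> 0"
      using corr_eq[of "f 0"] by (simp add: x_def[abs_def])
    then obtain e where e: "e > 0" "\<And>n0. \<exists>n\<ge>n0. e \<le> cmod (x n)"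
      unfolding LIMSEQ_iff by (auto simp: not_less)
    then obtain \<sigma> where \<sigma>: "\<And>i. \<sigma> i \<ge> i" "\<And>i. e \<le> cmod (x (\<sigma> i))" by metis
    have lim\<sigma>: "filterlim \<sigma> sequentially sequentially"
      using \<sigma>(1) by (rule filterlim_at_top_mono[OF filterlim_ident always_eventually[OF allI]])
    \<comment> \<open>The rotation makes every pairing with \<open>f 0\<close> a real number that is
      at least e, so the rotated averages lie in one half-space.\<close>
    define z where "z i = cnj (sgn (x (\<sigma> i)))" for i
    have zn: "cmod (z i) = 1" for i
      using \<sigma>(2)[of i] e(1) by (auto simp: z_def norm_sgn)
    have zx: "z i * x (\<sigma> i) = of_real (cmod (x (\<sigma> i)))" for i
    proof -
      have "x (\<sigma> i) * cnj (x (\<sigma> i)) = of_real (cmod (x (\<sigma> i))) * of_real (cmod (x (\<sigma> i)))"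
        by (simp add: complex_norm_square[symmetric] power2_eq_square flip: of_real_mult)
      then show ?thesis
        by (cases "x (\<sigma> i) = 0") (simp_all add: z_def sgn_eq field_simps)
    qed
    define Y where "Y i = cst (z i) * X (\<sigma> i)" for i
    have YA: "Y i \<in> A" for i by (simp add: Y_def)
    have Yb: "bounded_by 1 (Y i)" for i
      unfolding Y_def using Xb zn by (intro bounded_by_mult1 bounded_by_cst) auto
    have "\<phi> (f 0 * Y i) = z i * x (\<sigma> i)" for i
      using phi_scale[of "f 0 * X (\<sigma> i)" "z i"] by (simp add: Y_def x_def mult.left_commute)
    then have Re: "e \<le> Re (\<phi> (f 0 * Y i))" for i using zx \<sigma>(2) by simp
    obtain G where G: "G \<in> A" "bounded_by 1 G" and nz: "\<phi> (f 0 * G) \<noteq> 0" and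
      weak: "\<forall>\<l> K. bounded_functional A \<phi> \<l> K \<longrightarrow> (\<lambda>i. \<l> (Y i)) \<longlonglongrightarrow> 0 \<longrightarrow> \<l> G = 0"
      by (rule weak_limit[OF YA Yb fA[OF le0] e(1) Re])
    have Gball: "G \<in> unit_ball A" using G by (simp add: unit_ball_def)
    \<comment> \<open>The rotations have modulus 1 and \<sigma> tends to infinity, so a functional
      that is null along the original averages is null along \<open>Y\<close>.\<close>
    have weak': "\<l> G = 0"
      if bf: "bounded_functional A \<phi> \<l> K" and lim: "(\<lambda>N. \<l> (X N)) \<longlonglongrightarrow> 0" for \<l> K
    proof -
      have "\<l> (Y i) = z i * \<l> (X (\<sigma> i))" for i
        using bf by (simp add: Y_def bounded_functional_def)
      moreover have "(\<lambda>i. cmod (\<l> (X (\<sigma> i)))) \<longlonglongrightarrow> 0"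
        using filterlim_compose[OF lim lim\<sigma>] by (rule tendsto_norm_zero)
      ultimately have "(\<lambda>i. \<l> (Y i)) \<longlonglongrightarrow> 0"
        by (intro Lim_null_comparison[of "\<lambda>i. \<l> (Y i)" "\<lambda>i. cmod (\<l> (X (\<sigma> i)))"])
          (simp_all add: norm_mult zn)
      then show ?thesis using weak bf by blast
    qed
    \<comment> \<open>The level of the seminorm that controls these averages; \<open>tow_W\<close>
      then produces the exponents 1 to m on the other vertices, the same as those in
      \<open>h\<close>.\<close>
    define m where "m = Suc (Suc k)"
    interpret J: sys "tow_A A \<phi> T m" "tow_phi \<phi> m" "tow_T T m" by (rule tower_sys[OF S])
    interpret W: dyn "tow_A A \<phi> T m" "tow_phi \<phi> m" "tow_W m" by (rule tower_W[OF S])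
    note vin [simp] = vertex_in[OF S, of _ m]
    have dual: "dual T m G \<in> tow_A A \<phi> T m" "bounded_by 1 (dual T m G)"
      using dual_unit_ball[OF S Gball, of m] by (auto simp: unit_ball_def)
    have ghk0: "ghk \<phi> T m G = 0"
      unfolding ghk_def cube_vertex_dual
    \<comment> \<open>The functional varies the first vertex only and keeps \<open>G\<close> on all
      others; its value at \<open>G\<close> is the seminorm.\<close>
    proof (rule weak'[where \<l> = "\<lambda>a. tow_phi \<phi> m (vertex T m a * dual T m G)"])
      show "bounded_functional A \<phi> (\<lambda>a. tow_phi \<phi> m (vertex T m a * dual T m G)) (nrm (tow_phi \<phi> m) (dual T m G))"
        unfolding bounded_functional_def
      proof (intro conjI ballI allI)
        fix a assume a: "a \<in> A"
        show "tow_phi \<phi> m (vertex T m (cst c * a) * dual T m G) = c * tow_phi \<phi> m (vertex T m a * dual T m G)" for c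
          using a dual by (simp add: vertex_cst_mult mult.assoc J.phi_scale)
        show "cmod (tow_phi \<phi> m (vertex T m a * dual T m G)) \<le> nrm (tow_phi \<phi> m) (dual T m G) * nrm \<phi> a"
          using J.cauchy_schwarz[of "dual T m G" "vertex T m a"] a dual nrm_vertex[OF S a, of m]
          by (simp add: mult.commute)
        fix b assume "b \<in> A"
        then show "tow_phi \<phi> m (vertex T m (a + b) * dual T m G) =
            tow_phi \<phi> m (vertex T m a * dual T m G) + tow_phi \<phi> m (vertex T m b * dual T m G)"
          using a dual by (simp add: vertex_add distrib_right J.phi_add)
      qed
      obtain B where B: "\<And>i. B i \<in> unit_ball (tow_A A \<phi> T m)" "B 0 = 1" "W_poly T m (dual T m G) B"
        using dual_W_poly[OF S Gball, of m] by blast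
      \<comment> \<open>Factors with the same exponent \<open>Suc i\<close> are merged. The common
        translation by n drops out by invariance, so the exponents become 0 to \<open>Suc k\<close>,
        one moving function fewer.\<close>
      define F where "F i = vertex T m (f (Suc i)) * B (Suc i)" for i
      have Fb: "F i \<in> unit_ball (tow_A A \<phi> T m)" if "i \<le> Suc k" for i
        using that B(1) vertex_unit_ball[OF S, of "f (Suc i)" m] fb[of "Suc i"] unit_ball_mult[OF S]
        by (simp add: F_def unit_ball_def[of A])
      have FA: "F i \<in> tow_A A \<phi> T m" if "i \<le> Suc k" for i
        using Fb[OF that] by (simp add: unit_ball_def)
      have "tow_phi \<phi> m (vertex T m (h n) * dual T m G) = corr (tow_phi \<phi> m) (tow_T T m) (Suc k) F n" for n
      proof -
        have "tow_phi \<phi> m (vertex T m (h n) * dual T m G) =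
            tow_phi \<phi> m (pull (tow_W m) n (vertex T m (h n) * dual T m G))"
          using dual by (intro W.phi_pull[symmetric]) simp
        also have "pull (tow_W m) n (vertex T m (h n) * dual T m G) =
            vertex T m (h n) * (\<Prod>i\<le>m. pull (tow_T T m) (i * n) (B i))"
          using B(3) by (simp add: pull_W_vertex W_poly_def)
        also have "(\<Prod>i\<le>m. pull (tow_T T m) (i * n) (B i)) = (\<Prod>i\<le>Suc k. pull (tow_T T m) (Suc i * n) (B (Suc i)))"
          unfolding m_def prod.atMost_Suc_shift[of _ "Suc k"] using B(2) by (simp del: prod.atMost_Suc mult_Suc)
        also have "vertex T m (h n) * (\<Prod>i\<le>Suc k. pull (tow_T T m) (Suc i * n) (B (Suc i))) =
            pull (tow_T T m) n (\<Prod>i\<le>Suc k. pull (tow_T T m) (i * n) (F i))"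
          by (simp only: h_def vertex_prod pull_vertex[symmetric] prod.distrib[symmetric]
              pull_prod pull_pull pull_mult F_def mult_Suc)
        also have "tow_phi \<phi> m \<dots> = corr (tow_phi \<phi> m) (tow_T T m) (Suc k) F n"
          unfolding corr_def using FA by (intro J.phi_pull J.prod_in J.pull_in) simp
        finally show ?thesis .
      qed
      moreover have "vertex T m (X N) * dual T m G = avg N (\<lambda>n. cst (w ^ n) * (vertex T m (h n) * dual T m G))" for N
        by (simp add: X_def vertex_avg vertex_cst_mult avg_mult mult.assoc)
      ultimately have "tow_phi \<phi> m (vertex T m (X N) * dual T m G) =
          (\<Sum>n<N. w ^ n * corr (tow_phi \<phi> m) (tow_T T m) (Suc k) F n) / of_nat N" for N
        using dual by (simp add: J.phi_avg J.phi_scale)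
      then show "(\<lambda>N. tow_phi \<phi> m (vertex T m (X N) * dual T m G)) \<longlonglongrightarrow> 0"
        using Suc.IH[OF tower_sys[OF S, of m] tower_no_eigen[OF S w Suc.prems(2), of m] Fb] by simp
    qed
    \<comment> \<open>The estimate is in terms of the first function, which in the pairing with the
      averages is \<open>cj G\<close>.\<close>
    have "ghk \<phi> T m (cj G) = cnj (ghk \<phi> T m G)"
      using J.phi_cj[of "cube T m G"] cube_unit_ball[OF S Gball, of m]
      by (simp add: ghk_def cj_cube[symmetric] unit_ball_def)
    then have ghk1: "ghk \<phi> T m (cj G) = 0" using ghk0 by simp
    have "\<phi> (cj G * G) = 0"
    proof (rule weak'[where \<l> = "\<lambda>a. \<phi> (cj G * a)"])
      show "bounded_functional A \<phi> (\<lambda>a. \<phi> (cj G * a)) (nrm \<phi> (cj G))"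
        using G by (intro bounded_functional_mult cj_in)
      show "(\<lambda>N. \<phi> (cj G * X N)) \<longlonglongrightarrow> 0"
      proof (rule LIMSEQ_I)
        fix r :: real assume r: "r > 0"
        obtain C where C: "\<And>f. (\<forall>i\<le>Suc (Suc k). f i \<in> unit_ball A) \<Longrightarrow>
          (\<forall>\<^sub>F N in sequentially. cmod ((\<Sum>n<N. w ^ n * corr \<phi> T (Suc (Suc k)) f n) / of_nat N) \<le>
            r / 2 + C * Re (ghk \<phi> T (Suc (Suc k)) (f 0)))"
          using corr_le_ghk[OF S w, of "Suc k" "r / 2"] r by auto
        have "\<forall>i\<le>Suc (Suc k). (f(0 := cj G)) i \<in> unit_ball A"
          using G fb by (simp add: unit_ball_def)
        from C[OF this] have "\<forall>\<^sub>F N in sequentially. cmod (\<phi> (cj G * X N)) \<le> r / 2"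
          unfolding corr_eq[OF cj_in[OF G(1)]] fun_upd_same using ghk1 by (simp add: m_def)
        then obtain N0 where "\<And>N. N \<ge> N0 \<Longrightarrow> cmod (\<phi> (cj G * X N)) \<le> r / 2"
          unfolding eventually_sequentially by blast
        then show "\<exists>no. \<forall>n\<ge>no. norm (\<phi> (cj G * X n) - 0) < r"
          using r by (intro exI[of _ N0]) (auto intro: le_less_trans[of _ "r / 2"])
      qed
    qed
    then have "nrm \<phi> G = 0" using phi_sq[OF G(1)] by (simp add: mult.commute)
    then show False using phi_null[OF _ G(1), of "f 0"] nz by simp
  qed
qed

section \<open>The system of bounded measurable functions\<close>

definition on_om :: "('a \<Rightarrow> complex) \<Rightarrow> 'a om \<Rightarrow> complex" where
  "on_om f = (\<lambda>w. f (fst w))"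

definition base_A :: "'a measure \<Rightarrow> ('a om \<Rightarrow> complex) set" where
  "base_A M = on_om ` {f \<in> borel_measurable M. \<exists>C. bounded_by C f}"

text \<open>Functions in \<open>base_A\<close> ignore the sequence coordinate, so the sequence
  inserted here is an arbitrary choice.\<close>

definition base_phi :: "'a measure \<Rightarrow> ('a om \<Rightarrow> complex) \<Rightarrow> complex" where
  "base_phi M F = (\<integral>x. F (x, \<lambda>_. 0) \<partial>M)"

definition base_T :: "('a \<Rightarrow> 'a) \<Rightarrow> 'a om \<Rightarrow> 'a om" where
  "base_T T w = (T (fst w), snd w)"

lemma on_om_hom [simp]:
  "on_om f + on_om g = on_om (f + g)" "on_om f - on_om g = on_om (f - g)" "on_om f * on_om g = on_om (f * g)"
  "cj (on_om f) = on_om (cj f)" "cst c = on_om (cst c)"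
  by (auto simp: fun_eq_iff fun_apply on_om_def)

lemma base_T_pow: "(base_T T ^^ n) w = ((T ^^ n) (fst w), snd w)"
  by (induction n) (auto simp: base_T_def)

lemma pull_on_om: "pull (base_T T) n (on_om f) = on_om (pull T n f)"
  by (simp add: fun_eq_iff pull_apply base_T_pow on_om_def)

lemma bounded_by_on_om [simp]: "bounded_by C (on_om f) = bounded_by C f"
  unfolding bounded_by_def on_om_def by (metis fst_conv)

lemma base_phi_on_om [simp]: "base_phi M (on_om f) = (\<integral>x. f x \<partial>M)"
  by (simp add: base_phi_def on_om_def)

lemma base_A_on_om: "f \<in> borel_measurable M \<Longrightarrow> bounded_by C f \<Longrightarrow> on_om f \<in> base_A M"
  unfolding base_A_def by blast

lemma base_A_cases:
  assumes "F \<in> base_A M"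
  obtains f C where "F = on_om f" "f \<in> borel_measurable M" "bounded_by C f"
  using assms unfolding base_A_def by blast

lemma measurable_pointwise [measurable (raw)]:
  fixes f g :: "'a \<Rightarrow> complex"
  shows "f \<in> borel_measurable M \<Longrightarrow> cj f \<in> borel_measurable M"
    and "f \<in> borel_measurable M \<Longrightarrow> g \<in> borel_measurable M \<Longrightarrow> f + g \<in> borel_measurable M"
    and "f \<in> borel_measurable M \<Longrightarrow> g \<in> borel_measurable M \<Longrightarrow> f - g \<in> borel_measurable M"
    and "f \<in> borel_measurable M \<Longrightarrow> g \<in> borel_measurable M \<Longrightarrow> f * g \<in> borel_measurable M"
    and "cst c \<in> borel_measurable M"
proof -
  assume f: "f \<in> borel_measurable M"
  have "(\<lambda>x. cnj (f x)) \<in> borel_measurable M"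
    by (rule measurable_compose[OF f]) (intro borel_measurable_continuous_onI continuous_intros)
  then show "cj f \<in> borel_measurable M" by (simp add: cj_def)
qed (simp_all add: plus_fun_def fun_diff_def times_fun_def cst_def)

context prob_space
begin

lemma integrable_bounded_by:
  fixes f :: "'a \<Rightarrow> complex"
  assumes "f \<in> borel_measurable M" "bounded_by C f"
  shows "integrable M f"
  using assms by (intro integrable_const_bound[where B = C]) (auto simp: bounded_by_def)

lemma funalg_base: "funalg (base_A M) (base_phi M)"
proof
  fix F G c assume F: "F \<in> base_A M"
  then obtain f C where f: "F = on_om f" "f \<in> borel_measurable M" "bounded_by C f"
    by (rule base_A_cases)
  note int_f = integrable_bounded_by[OF f(2,3)]
  show "cj F \<in> base_A M"
    unfolding f(1) on_om_hom using f by (intro base_A_on_om[of _ _ C] measurable_pointwise) simp_all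
  show "\<exists>C. bounded_by C F" using f by auto
  show "base_phi M (cst c * F) = c * base_phi M F"
    unfolding f(1) on_om_hom base_phi_on_om by (simp add: times_fun_def cst_def)
  show "base_phi M (cj F) = cnj (base_phi M F)"
    unfolding f(1) on_om_hom base_phi_on_om by (simp add: cj_def)
  show "0 \<le> Re (base_phi M F)" if "\<And>x. Im (F x) = 0 \<and> 0 \<le> Re (F x)"
  proof -
    have "0 \<le> Re (f x)" for x using that[of "(x, undefined)"] by (simp add: f(1) on_om_def)
    then have "0 \<le> (\<integral>x. Re (f x) \<partial>M)" by (intro integral_nonneg_AE) simp
    then show ?thesis using int_f by (simp add: f(1))
  qed
  assume "G \<in> base_A M"
  then obtain g D where g: "G = on_om g" "g \<in> borel_measurable M" "bounded_by D g"
    by (rule base_A_cases)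
  show "F + G \<in> base_A M"
    unfolding f(1) g(1) on_om_hom
    by (intro base_A_on_om[of _ _ "C + D"] measurable_pointwise bounded_by_add f g)
  show "F * G \<in> base_A M"
    unfolding f(1) g(1) on_om_hom
    by (intro base_A_on_om[of _ _ "C * D"] measurable_pointwise bounded_by_mult f g)
  show "base_phi M (F + G) = base_phi M F + base_phi M G"
    unfolding f(1) g(1) on_om_hom base_phi_on_om
    using int_f integrable_bounded_by[OF g(2,3)] by (simp add: plus_fun_def)
next
  show "cst c \<in> base_A M" for c
    unfolding on_om_hom by (intro base_A_on_om[of _ _ "cmod c"] measurable_pointwise bounded_by_cst) simp
  have "base_phi M (cst 1) = 1"
    unfolding on_om_hom base_phi_on_om by (simp add: cst_def prob_space)
  then show "base_phi M 1 = 1" by (simp only: cst_1)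
qed

interpretation base: funalg "base_A M" "base_phi M" by (rule funalg_base)

lemma nrm_on_om:
  assumes "f \<in> borel_measurable M" "bounded_by C f"
  shows "(nrm (base_phi M) (on_om f))\<^sup>2 = (\<integral>x. (cmod (f x))\<^sup>2 \<partial>M)"
proof -
  have "(nrm (base_phi M) (on_om f))\<^sup>2 = Re (\<integral>x. complex_of_real ((cmod (f x))\<^sup>2) \<partial>M)"
    using base.nrm_sq[OF base_A_on_om[OF assms]]
    by (simp add: fun_apply complex_norm_square del: of_real_power)
  also have "\<dots> = (\<integral>x. (cmod (f x))\<^sup>2 \<partial>M)" by (simp only: integral_complex_of_real Re_complex_of_real)
  finally show ?thesis .
qed

lemma nrm_on_om_eq_0:
  assumes "f \<in> borel_measurable M" "bounded_by C f"
  shows "nrm (base_phi M) (on_om f) = 0 \<longleftrightarrow> (AE x in M. f x = 0)"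
proof -
  have "integrable M (\<lambda>x. (cmod (f x))\<^sup>2)"
    using assms by (intro integrable_const_bound[where B = "C\<^sup>2"]) (auto simp: bounded_by_def intro!: power_mono)
  then have "(\<integral>x. (cmod (f x))\<^sup>2 \<partial>M) = 0 \<longleftrightarrow> (AE x in M. (cmod (f x))\<^sup>2 = 0)"
    by (intro integral_nonneg_eq_0_iff_AE) auto
  then show ?thesis
    using nrm_on_om[OF assms] zero_eq_power2[of "nrm (base_phi M) (on_om f)"] by auto
qed

lemma integral_norm_le_nrm:
  assumes f: "f \<in> borel_measurable M" "bounded_by C f"
  shows "(\<integral>x. cmod (f x) \<partial>M) \<le> nrm (base_phi M) (on_om f)"
proof -
  define g where "g x = complex_of_real (cmod (f x))" for x
  have g: "g \<in> borel_measurable M" "bounded_by C g"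
    using f by (auto simp: g_def[abs_def] bounded_by_def)
  have "complex_of_real (\<integral>x. cmod (f x) \<partial>M) = base_phi M (on_om g)"
    by (simp add: g_def)
  then have "\<bar>\<integral>x. cmod (f x) \<partial>M\<bar> = cmod (base_phi M (on_om g))"
    by (metis norm_of_real)
  also have "\<dots> \<le> nrm (base_phi M) (on_om g)"
    by (rule base.phi_le_nrm[OF base_A_on_om[OF g]])
  also have "\<dots> = nrm (base_phi M) (on_om f)"
  proof -
    have "(nrm (base_phi M) (on_om g))\<^sup>2 = (nrm (base_phi M) (on_om f))\<^sup>2"
      unfolding nrm_on_om[OF g] nrm_on_om[OF f] by (simp add: g_def)
    then show ?thesis
      using base.nrm_nonneg[OF base_A_on_om[OF g]] base.nrm_nonneg[OF base_A_on_om[OF f]]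
      by (simp add: power2_eq_iff_nonneg)
  qed
  finally show ?thesis by simp
qed

text \<open>A subsequence converges almost everywhere since it is Cauchy in mean. The common bound
  gives quadratic convergence by domination, and the Cauchy property extends this to the whole
  sequence.\<close>

lemma seq_complete_base: "seq_complete (base_A M) (base_phi M)"
  unfolding seq_complete_def
proof (intro allI impI, elim conjE)
  fix F :: "nat \<Rightarrow> 'a om \<Rightarrow> complex" and C
  let ?n = "nrm (base_phi M)"
  assume FC: "\<forall>n. F n \<in> base_A M \<and> bounded_by C (F n)"
    and cau: "\<forall>e>0. \<exists>K. \<forall>m\<ge>K. \<forall>n\<ge>K. ?n (F m - F n) < e"
  have "\<exists>f. F n = on_om f \<and> f \<in> borel_measurable M" for n
    using FC base_A_cases by metis
  then obtain f where Ff: "\<And>n. F n = on_om (f n)" and fm [measurable]: "\<And>n. f n \<in> borel_measurable M" by metis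
  have fb: "bounded_by C (f n)" for n using FC by (simp add: Ff)
  have C0: "0 \<le> C" using bounded_by_nonneg[OF fb] .
  have diffb: "bounded_by (C + C) (f m - f n)" for m n
    using fb[of m] fb[of n] unfolding bounded_by_def minus_fun_apply'
    by (meson add_mono norm_triangle_ineq4 order_trans)
  have "\<exists>K. \<forall>m\<ge>K. \<forall>n\<ge>K. (\<integral>x. norm (f m x - f n x) \<partial>M) < e" if e: "e > 0" for e
  proof -
    obtain K where K: "\<forall>m\<ge>K. \<forall>n\<ge>K. ?n (F m - F n) < e" using cau e by blast
    have "(\<integral>x. norm (f m x - f n x) \<partial>M) < e" if "m \<ge> K" "n \<ge> K" for m n
    proof -
      have "(\<integral>x. cmod ((f m - f n) x) \<partial>M) \<le> ?n (on_om (f m - f n))"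
        by (rule integral_norm_le_nrm[OF measurable_pointwise(3)[OF fm fm] diffb])
      also have "\<dots> < e" using K that by (simp add: Ff)
      finally show ?thesis by (simp add: fun_apply)
    qed
    then show ?thesis by blast
  qed
  then obtain k where k: "strict_mono k" "AE x in M. Cauchy (\<lambda>j. f (k j) x)"
    by (rule cauchy_L1_AE_cauchy_subseq[OF integrable_bounded_by[OF fm fb]])
  have kj: "k j \<ge> j" for j using k(1) by (rule seq_suble)
  have lim: "AE x in M. (\<lambda>j. f (k j) x) \<longlonglongrightarrow> lim (\<lambda>j. f (k j) x)"
    using k(2) by (simp add: Cauchy_convergent_iff convergent_LIMSEQ_iff)
  \<comment> \<open>\<open>lim\<close> is unspecified where the subsequence diverges; the cutoff
    makes the bound C hold at every point, as \<open>bounded_by\<close> demands.\<close>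
  define g where "g x = (if cmod (lim (\<lambda>j. f (k j) x)) \<le> C then lim (\<lambda>j. f (k j) x) else 0)" for x
  have gm: "g \<in> borel_measurable M" unfolding g_def[abs_def] by measurable
  have gb: "bounded_by C g" using C0 by (auto simp: bounded_by_def g_def)
  have glim: "AE x in M. (\<lambda>j. f (k j) x) \<longlonglongrightarrow> g x"
    using lim
  proof eventually_elim
    case (elim x)
    then have "cmod (lim (\<lambda>j. f (k j) x)) \<le> C"
      using fb by (intro LIMSEQ_le_const2[OF tendsto_norm[OF elim]]) (auto simp: bounded_by_def)
    then show ?case using elim by (simp add: g_def)
  qed
  have G: "on_om g \<in> base_A M" by (rule base_A_on_om[OF gm gb])
  have fgb: "bounded_by (C + C) (f n - g)" for n
    using fb[of n] gb unfolding bounded_by_def minus_fun_apply'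
    by (meson add_mono norm_triangle_ineq4 order_trans)
  have "(\<lambda>j. \<integral>x. (cmod (f (k j) x - g x))\<^sup>2 \<partial>M) \<longlonglongrightarrow> (\<integral>x. 0 \<partial>M)"
  proof (rule integral_dominated_convergence[where w = "\<lambda>_. (C + C)\<^sup>2"])
    show "AE x in M. (\<lambda>j. (cmod (f (k j) x - g x))\<^sup>2) \<longlonglongrightarrow> 0"
      using glim
    proof eventually_elim
      case (elim x)
      then have "(\<lambda>j. (cmod (f (k j) x - g x))\<^sup>2) \<longlonglongrightarrow> (cmod (g x - g x))\<^sup>2" by (intro tendsto_intros)
      then show ?case by simp
    qed
    show "AE x in M. norm ((cmod (f (k j) x - g x))\<^sup>2) \<le> (C + C)\<^sup>2" for j
    proof (rule AE_I2)
      fix x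
      have "cmod (f (k j) x - g x) \<le> C + C" using fgb[of "k j"] by (simp add: bounded_by_def fun_apply)
      from power_mono[OF this norm_ge_zero, of 2]
      show "norm ((cmod (f (k j) x - g x))\<^sup>2) \<le> (C + C)\<^sup>2" by simp
    qed
  qed (use gm in simp_all)
  then have "(\<lambda>j. (?n (F (k j) - on_om g))\<^sup>2) \<longlonglongrightarrow> 0"
    using nrm_on_om[OF measurable_pointwise(3)[OF fm gm] fgb] by (simp add: Ff fun_apply)
  then have sub: "(\<lambda>j. ?n (F (k j) - on_om g)) \<longlonglongrightarrow> 0"
    using tendsto_real_sqrt[of "\<lambda>j. (?n (F (k j) - on_om g))\<^sup>2" 0] FC G
    by (simp del: on_om_hom)
  have "(\<lambda>n. ?n (F n - on_om g)) \<longlonglongrightarrow> 0"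
  proof (rule LIMSEQ_I)
    fix e :: real assume e: "e > 0"
    obtain N1 where N1: "\<forall>m\<ge>N1. \<forall>n\<ge>N1. ?n (F m - F n) < e / 2" using cau e by (meson half_gt_zero)
    obtain N2 where N2: "\<And>j. j \<ge> N2 \<Longrightarrow> ?n (F (k j) - on_om g) < e / 2"
      using order_tendstoD(2)[OF sub, of "e / 2"] e by (auto simp: eventually_sequentially)
    have "norm (?n (F n - on_om g) - 0) < e" if n: "n \<ge> N1" for n
    proof -
      define j where "j = max N1 N2"
      have "?n (F n - on_om g) \<le> ?n (F n - F (k j)) + ?n (F (k j) - on_om g)"
        using FC G by (intro base.nrm_triangle_diff) auto
      also have "?n (F n - F (k j)) < e / 2"
        using N1 n kj[of j] by (auto simp: j_def)
      also have "?n (F (k j) - on_om g) < e / 2" by (intro N2) (simp add: j_def)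
      finally have "?n (F n - on_om g) < e" by simp
      moreover have "0 \<le> ?n (F n - on_om g)" using FC G by (intro base.nrm_nonneg base.diff_in) auto
      ultimately show ?thesis by simp
    qed
    then show "\<exists>no. \<forall>n\<ge>no. norm (?n (F n - on_om g) - 0) < e" by blast
  qed
  then show "\<exists>f\<in>base_A M. bounded_by C f \<and> (\<lambda>n. ?n (F n - f)) \<longlonglongrightarrow> 0"
    using G gb by (intro bexI[of _ "on_om g"]) simp_all
qed

end

section \<open>The measure preserving system as a function system\<close>

context measure_preserving_system
begin

lemma funpow_measurable: "T ^^ n \<in> measurable M M"
  by (induction n) (auto intro: measurable_compose[OF _ measurable_T] simp: comp_def)

lemma distr_funpow: "distr M M (T ^^ n) = M"
proof (induction n)
  case 0
  show ?case by (simp add: distr_id id_def)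
next
  case (Suc n)
  have "distr M M (T ^^ Suc n) = distr (distr M M (T ^^ n)) M T"
    using funpow_measurable measurable_T by (simp add: distr_distr)
  then show ?case using Suc measure_preserving by (simp add: comp_def)
qed

lemma AE_funpow: "AE x in M. P x \<Longrightarrow> AE x in M. P ((T ^^ n) x)"
  by (rule AE_distrD[OF funpow_measurable]) (simp only: distr_funpow)

lemma sys_base: "sys (base_A M) (base_phi M) (base_T T)"
proof (intro sys.intro dyn.intro dyn_axioms.intro sys_axioms.intro funalg_base seq_complete_base)
  fix F assume "F \<in> base_A M"
  then obtain f C where f: "F = on_om f" "f \<in> borel_measurable M" "bounded_by C f"
    by (rule base_A_cases)
  have m: "pull T 1 f \<in> borel_measurable M"
    using measurable_compose[OF measurable_T f(2)] by (simp add: pull_def)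
  show "pull (base_T T) 1 F \<in> base_A M"
    unfolding f(1) pull_on_om by (rule base_A_on_om[OF m bounded_by_pull[OF f(3)]])
  have "(\<integral>x. f (T x) \<partial>M) = (\<integral>x. f x \<partial>distr M M T)"
    using f(2) by (intro integral_distr[symmetric] measurable_T)
  then show "base_phi M (pull (base_T T) 1 F) = base_phi M F"
    unfolding f(1) pull_on_om by (simp add: measure_preserving pull_def)
qed

text \<open>Bounded functions lie in \<open>L2\<close>, so an eigenfunction in the algebra would put
  \<theta> into the discrete spectrum; \<open>circle_exp (- \<theta>)\<close> is the inverse of the
  eigenvalue.\<close>

lemma no_eigen_base:
  assumes \<theta>: "\<theta> \<notin> discrete_spectrum M T"
  shows "no_eigen (base_A M) (base_phi M) (base_T T) (circle_exp (- \<theta>))"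
  unfolding no_eigen_def
proof (intro ballI impI)
  fix F assume "F \<in> base_A M"
  then obtain f C where f: "F = on_om f" "f \<in> borel_measurable M" "bounded_by C f"
    by (rule base_A_cases)
  let ?g = "cst (circle_exp (- \<theta>)) * pull T 1 f - f"
  have m: "pull T 1 f \<in> borel_measurable M"
    using measurable_compose[OF measurable_T f(2)] by (simp add: pull_def)
  have "bounded_by (1 * C + C) ?g"
    unfolding bounded_by_def
  proof
    fix x
    have "cmod (circle_exp (- \<theta>) * f (T x)) \<le> C"
      using f(3) by (simp add: norm_mult circle_exp_def bounded_by_def)
    moreover have "cmod (f x) \<le> C" using f(3) by (simp add: bounded_by_def)
    ultimately show "cmod (?g x) \<le> 1 * C + C"
      using norm_triangle_ineq4[of "circle_exp (- \<theta>) * f (T x)" "f x"] by (simp add: fun_apply pull_apply)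
  qed
  moreover have "?g \<in> borel_measurable M"
    by (intro measurable_pointwise m f)
  moreover assume "nrm (base_phi M) (cst (circle_exp (- \<theta>)) * pull (base_T T) 1 F - F) = 0"
  then have "nrm (base_phi M) (on_om ?g) = 0"
    by (simp only: f(1) pull_on_om on_om_hom)
  ultimately have "AE x in M. ?g x = 0" using nrm_on_om_eq_0 by blast
  then have eig: "AE x in M. f (T x) = circle_exp \<theta> * f x"
  proof eventually_elim
    case (elim x)
    have "circle_exp \<theta> * circle_exp (- \<theta>) = 1"
      by (simp add: circle_exp_def exp_add[symmetric])
    moreover have "circle_exp (- \<theta>) * f (T x) = f x" using elim by (simp add: fun_apply pull_apply)
    ultimately show ?case by (metis mult.assoc mult_1)
  qed
  have "integrable M (\<lambda>x. (cmod (f x))\<^sup>2)"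
    using f by (intro integrable_const_bound[where B = "C\<^sup>2"]) (auto simp: bounded_by_def intro!: power_mono)
  then have "f \<in> L2 M" using f by (simp add: L2_def)
  then have "AE x in M. f x = 0" using \<theta> eig unfolding discrete_spectrum_def by blast
  then show "nrm (base_phi M) F = 0" unfolding f(1) using nrm_on_om_eq_0[OF f(2,3)] by simp
qed

text \<open>The functions are only essentially bounded. Truncation changes them on null sets, and
  scaling brings them into the unit ball. A further constant function is appended, so that
  \<open>k = 0\<close> too falls under the result for \<open>Suc k\<close>.\<close>

lemma multi_correlation_eq_corr:
  assumes "\<And>i. i \<le> k \<Longrightarrow> f i \<in> L_infinity M"
  shows "\<exists>g D. (\<forall>i. g i \<in> borel_measurable M) \<and> (\<forall>i. bounded_by 1 (g i)) \<and>
    (\<forall>n. multi_correlation M T k f n = D * corr (base_phi M) (base_T T) (Suc k) (\<lambda>i. on_om (g i)) n)"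
proof -
  have "\<exists>C. AE x in M. cmod (f i x) \<le> C" if "i \<le> k" for i
    using assms[OF that] by (simp add: L_infinity_def)
  then obtain c where c: "\<And>i. i \<le> k \<Longrightarrow> AE x in M. cmod (f i x) \<le> c i" by metis
  define D where "D = 1 + (\<Sum>i\<le>k. \<bar>c i\<bar>)"
  have D: "D > 0" by (auto simp: D_def intro!: add_pos_nonneg sum_nonneg)
  have cD: "c i \<le> D" if "i \<le> k" for i
  proof -
    have "\<bar>c i\<bar> \<le> (\<Sum>i\<le>k. \<bar>c i\<bar>)" using that by (intro member_le_sum) auto
    then show ?thesis by (simp add: D_def)
  qed
  \<comment> \<open>The value 0 is taken on a null set only; the value 1 beyond k is the appended
    function.\<close>
  define g where "g i x = (if i \<le> k then if cmod (f i x) \<le> D then f i x / of_real D else 0 else 1)" for i x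
  have fm: "f i \<in> borel_measurable M" if "i \<le> k" for i using assms[OF that] by (simp add: L_infinity_def)
  have gm: "g i \<in> borel_measurable M" for i
    using fm[of i] by (cases "i \<le> k") (simp_all add: g_def[abs_def])
  have fT: "(\<lambda>x. f i ((T ^^ m) x)) \<in> borel_measurable M" if "i \<le> k" for i m
    by (rule measurable_compose[OF funpow_measurable fm[OF that]])
  have gT: "(\<lambda>x. g i ((T ^^ m) x)) \<in> borel_measurable M" for i m
    by (rule measurable_compose[OF funpow_measurable gm])
  have gb: "bounded_by 1 (g i)" for i
    using D by (auto simp: bounded_by_def g_def norm_divide)
  have fg: "AE x in M. f i x = of_real D * g i x" if "i \<le> k" for i
    using c[OF that] by eventually_elim (use D cD[OF that] that in \<open>auto simp: g_def\<close>)
  have "multi_correlation M T k f n = of_real D ^ Suc k * corr (base_phi M) (base_T T) (Suc k) (\<lambda>i. on_om (g i)) n" for n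
  proof -
    have set: "{..k} = insert 0 {1..k}" by auto
    have "AE x in M. \<forall>i\<in>{..k}. f i ((T ^^ (i * n)) x) = of_real D * g i ((T ^^ (i * n)) x)"
      using fg AE_funpow by (intro AE_finite_allI) auto
    then have "AE x in M. f 0 x * (\<Prod>i = 1..k. f i ((T ^^ (i * n)) x)) =
        of_real D ^ Suc k * (\<Prod>i\<le>k. g i ((T ^^ (i * n)) x))"
    proof eventually_elim
      case (elim x)
      have "f 0 x * (\<Prod>i = 1..k. f i ((T ^^ (i * n)) x)) = (\<Prod>i\<le>k. f i ((T ^^ (i * n)) x))"
        unfolding set by (subst prod.insert) auto
      also have "\<dots> = (\<Prod>i\<le>k. of_real D * g i ((T ^^ (i * n)) x))"
        using elim by (intro prod.cong) auto
      finally show ?case by (simp add: prod.distrib)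
    qed
    moreover have "(\<lambda>x. f 0 x * (\<Prod>i = 1..k. f i ((T ^^ (i * n)) x))) \<in> borel_measurable M"
      by (intro borel_measurable_times borel_measurable_prod fm fT) auto
    moreover have "(\<lambda>x. of_real D ^ Suc k * (\<Prod>i\<le>k. g i ((T ^^ (i * n)) x))) \<in> borel_measurable M"
      by (intro borel_measurable_times borel_measurable_prod gT borel_measurable_const)
    ultimately have "multi_correlation M T k f n = (\<integral>x. of_real D ^ Suc k * (\<Prod>i\<le>k. g i ((T ^^ (i * n)) x)) \<partial>M)"
      unfolding multi_correlation_def by (intro integral_cong_AE)
    also have "\<dots> = of_real D ^ Suc k * (\<integral>x. (\<Prod>i\<le>k. g i ((T ^^ (i * n)) x)) \<partial>M)" by simp
    also have "(\<integral>x. (\<Prod>i\<le>k. g i ((T ^^ (i * n)) x)) \<partial>M) = corr (base_phi M) (base_T T) (Suc k) (\<lambda>i. on_om (g i)) n"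
    proof -
      have "g (Suc k) = (\<lambda>_. 1)" by (simp add: g_def[abs_def])
      then show ?thesis
        by (simp add: corr_def base_phi_def prod_fun_apply fun_apply on_om_def pull_apply base_T_pow del: mult_Suc)
    qed
    finally show ?thesis .
  qed
  then show ?thesis using gm gb by blast
qed

end

theorem corollary2p3:
  fixes M :: "'a measure" and T :: "'a \<Rightarrow> 'a"
    and k :: nat and f :: "nat \<Rightarrow> 'a \<Rightarrow> complex"
  assumes "ergodic_system M T"
    and "\<And>i. i \<le> k \<Longrightarrow> f i \<in> L_infinity M"
  shows "seq_spectrum (multi_correlation M T k f) \<subseteq> discrete_spectrum M T"
proof
  fix \<theta> assume spec: "\<theta> \<in> seq_spectrum (multi_correlation M T k f)"
  show "\<theta> \<in> discrete_spectrum M T"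
  proof (rule ccontr)
    assume \<theta>: "\<theta> \<notin> discrete_spectrum M T"
    interpret ergodic_system M T by (rule assms(1))
    define w where "w = circle_exp (- \<theta>)"
    define \<eta> where "\<eta> = multi_correlation M T k f"
    have w: "cmod w = 1" by (simp add: w_def circle_exp_def)
    have wpow: "circle_exp (- \<theta> * real n) = w ^ n" for n
      by (simp add: w_def circle_exp_def exp_of_nat_mult[symmetric] mult_ac)
    obtain g D where gD: "\<forall>i. g i \<in> borel_measurable M" "\<forall>i. bounded_by 1 (g i)"
      "\<forall>n. \<eta> n = D * corr (base_phi M) (base_T T) (Suc k) (\<lambda>i. on_om (g i)) n"
      using multi_correlation_eq_corr[where k = k and f = f, OF assms(2)] unfolding \<eta>_def by blast
    note g = gD(1,2)[rule_format] and \<eta> = gD(3)[rule_format]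
    have "on_om (g i) \<in> unit_ball (base_A M)" for i
      using base_A_on_om[OF g] g(2) by (simp add: unit_ball_def)
    then have "(\<lambda>N. (\<Sum>n<N. w ^ n * corr (base_phi M) (base_T T) (Suc k) (\<lambda>i. on_om (g i)) n) / of_nat N) \<longlonglongrightarrow> 0"
      using no_eigen_base[OF \<theta>] unfolding w_def[symmetric] by (intro corr_average_null[OF w sys_base])
    then have "(\<lambda>N. D * ((\<Sum>n<N. w ^ n * corr (base_phi M) (base_T T) (Suc k) (\<lambda>i. on_om (g i)) n) / of_nat N)) \<longlonglongrightarrow> 0"
      by (rule tendsto_mult_right_zero)
    then have lim: "(\<lambda>N. (\<Sum>n<N. w ^ n * \<eta> n) / of_nat N) \<longlonglongrightarrow> 0"
      by (simp add: \<eta> sum_distrib_left mult_ac)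
    have "(\<lambda>N. cmod (1 / of_nat N * (\<Sum>n = 1..N. \<eta> n * circle_exp (- \<theta> * real n)))) \<longlonglongrightarrow> 0"
    proof -
      \<comment> \<open>The spectrum averages over 1 to N, the preceding result over 0 to N - 1; the
        two end terms are bounded and vanish after division by N.\<close>
      have "1 / of_nat N * (\<Sum>n = 1..N. \<eta> n * circle_exp (- \<theta> * real n)) =
          (\<Sum>n<N. w ^ n * \<eta> n) / of_nat N + (w ^ N * \<eta> N - \<eta> 0) / of_nat N" for N
      proof -
        have "(\<Sum>n = 1..N. \<eta> n * circle_exp (- \<theta> * real n)) = (\<Sum>n<N. w ^ n * \<eta> n) + (w ^ N * \<eta> N - \<eta> 0)"
          unfolding wpow by (induction N) (simp_all add: mult.commute)
        then show ?thesis by (simp add: add_divide_distrib)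
      qed
      moreover have "(\<lambda>N. (w ^ N * \<eta> N - \<eta> 0) / of_nat N) \<longlonglongrightarrow> 0"
      proof (rule Lim_null_comparison)
        interpret base: sys "base_A M" "base_phi M" "base_T T" by (rule sys_base)
        have "cmod (\<eta> n) \<le> cmod D" for n
          using base.corr_bound[of "Suc k" "\<lambda>i. on_om (g i)" n] \<open>\<And>i. on_om (g i) \<in> unit_ball (base_A M)\<close>
          by (simp add: \<eta> norm_mult mult_left_le)
        then have "cmod (w ^ N * \<eta> N - \<eta> 0) \<le> cmod D + cmod D" for N
          using w by (intro order_trans[OF norm_triangle_ineq4] add_mono) (simp_all add: norm_mult norm_power)
        then show "\<forall>\<^sub>F N in sequentially. cmod ((w ^ N * \<eta> N - \<eta> 0) / of_nat N) \<le> (cmod D + cmod D) / real N"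
          by (simp add: norm_divide divide_right_mono)
      qed (rule lim_const_over_n)
      ultimately show ?thesis
        using tendsto_norm_zero[OF tendsto_add_zero[OF lim]] by simp
    qed
    then have "limsup (\<lambda>N. ereal (cmod (1 / of_nat N * (\<Sum>n = 1..N. \<eta> n * circle_exp (- \<theta> * real n))))) = ereal 0"
      by (intro lim_imp_Limsup) (simp_all only: tendsto_ereal trivial_limit_sequentially not_False_eq_True)
    then show False using spec by (simp add: seq_spectrum_def \<eta>_def)
  qed
qed

end
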